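(* Let $d=2$ and consider the backward Euler DGSEM with graph viscosity: given the degrees of freedom (DOFs) $U_\kappa^{ij,n}\in[m,M]$ of $u_h^{(n)}$, find $u_h^{(n+1)}$, with DOFs $U_\kappa^{ij,n+1}$, such that for all $\kappa\in\Omega_h$ and $0\le i,j\le p$ $$\omega_i\omega_jJ_\kappa^{ij}\frac{U_\kappa^{ij,n+1}-U_\kappa^{ij,n}}{\Delta t^{(n)}}+R_\kappa^{ij}(u_h^{(n+1)})+V_\kappa^{ij}(u_h^{(n+1)})=0,\qquad \Delta t^{(n)}>0,$$ where the residual $R_\kappa^{ij}$ is built with the entropy conservative flux $h_{ec}$ associated with a given entropy pair $(\vartheta,\mathbf g)$ with $\vartheta''>0$, and where the coefficients of the graph viscosity $V_\kappa^{ij}$ satisfy $$d_\kappa\ \ge\ 4L_fL_u\max_{k\ne l}\frac{|D^p_{kl}|}{\omega_l}\quad\forall\kappa\in\Omega_h,\qquad L_u:=\sup_{m\le u^+\ne u^-\le M}\frac{\vartheta''(u^+)(u^+-u^-)}{v(u^+)-v(u^-)},\quad v=\vartheta'.$$ Then, for every $n\ge0$ and every $\Delta t^{(n)}>0$, the scheme has a unique solution $u_h^{(n+1)}$ satisfying the maximum principle $$m\le U_\kappa^{ij,n+1}\le M\qquad\forall\kappa\in\Omega_h,\ 0\le i,j\le p.$$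
   Context: **Continuous problem.** $\partial_tu+\nabla\cdot\mathbf f(u)=0$ in $\Omega\times(0,\infty)$, $u(\cdot,0)=u_0$, with $\Omega\subset\mathbb R^2$, $\mathbf f:\mathbb R\to\mathbb R^2$ locally Lipschitz, $u_0\in L^\infty$, $m:=\operatorname{ess\,inf}u_0$, $M:=\operatorname{ess\,sup}u_0$. Lipschitz constant of the flux: $L_f:=\sup_{m\le u^+\neq u^-\le M}\sup_{\mathbf n\in\mathbb S^{1}}\frac{|(\mathbf f(u^+)-\mathbf f(u^-))\cdot\mathbf n|}{|u^+-u^-|}$. **One-dimensional operators.** $p\ge1$; $-1=\xi_0<\dots<\xi_p=1$ are the Gauss-Lobatto nodes on $I=[-1,1]$, $\omega_k>0$ the associated quadrature weights ($\sum_k\omega_k=2$), $\ell_k$ the Lagrange polynomials with $\ell_k(\xi_l)=\delta_{kl}$; $D^p_{kl}=\ell_l'(\xi_k)$, $Q^p_{kl}=\omega_kD^p_{kl}$ for $0\le k,l\le p$. **Mesh.** $\Omega_h$ is a mesh of nonoverlapping nonempty open elements $\kappa$ partitioning $\Omega$ (possibly countably infinitely many). Each $\kappa$ is the image of $I^2$ under a mapping $\mathbf x_\kappa(\xi,\zeta)=\sum_{i,j=0}^p\ell_i(\xi)\ell_j(\zeta)\mathbf x_\kappa^{ij}$, with $\mathbf x_\kappa^{ij}=\mathbf x_\kappa(\xi_i,\xi_j)$ and $J_\kappa^{ij}=\det\mathbf x_\kappa'(\xi_i,\xi_j)>0$. Each edge $e\subset\partial\kappa$ is the image of $I$ under $\mathbf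 x_e$; $\mathbf x_e^k=\mathbf x_e(\xi_k)$, $J_e^k=|\mathbf x_e'(\xi_k)|>0$, $\mathbf n_e^k$ is the unit normal to $e$ at $\mathbf x_e^k$ pointing outward from $\kappa$. Metric terms ($\nabla\xi,\nabla\zeta$ are the physical gradients of the reference coordinates): $\mathbf n_\kappa^{(ik)j}=\frac12\big(J_\kappa^{ij}\nabla\xi(\xi_i,\xi_j)+J_\kappa^{kj}\nabla\xi(\xi_k,\xi_j)\big)$, $\mathbf n_\kappa^{i(jk)}=\frac12\big(J_\kappa^{ij}\nabla\zeta(\xi_i,\xi_j)+J_\kappa^{ik}\nabla\zeta(\xi_i,\xi_k)\big)$. The discrete metric identities hold: $\sum_{k=0}^p D^p_{ik}\mathbf n_\kappa^{(ik)j}+D^p_{jk}\mathbf n_\kappa^{i(jk)}=0$ for all $\kappa,i,j$. The mesh is watertight (geometry continuous across faces, face nodes of neighbours coincide) and at faces $\mathbf n_\kappa^{(pp)j}=J_e\mathbf n_e$ at $\mathbf x_\kappa^{pj}$, $\mathbf n_\kappa^{(00)j}=-J_e\mathbf n_e$ at $\mathbf x_\kappa^{0j}$, $\mathbf n_\kappa^{i(pp)}=J_e\mathbf n_e$ at $\mathbf x_\kappa^{ip}$, $\mathbf n_\kappa^{i(00)}=-J_e\mathbf n_e$ at $\mathbf x_\kappa^{i0}$. Every face is shared with a neighbouring element. Mesh regularity: $h:=\sup_\kappa\operatorname{diam}\kappa<\infty$ and there is a finite constant $b>0$ with $J_\kappa^{ij}\ge\frac{b}{2d}h^d$ and $\frac1{4db}h^{d-1}\ge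 J_e^k,|\mathbf n_\kappa^{(ik)j}|,|\mathbf n_\kappa^{i(jk)}|>0$ for all $\kappa,i,j,k$ (here $d=2$). **Discrete functions.** $u_h|_\kappa=\sum_{i,j=0}^p\phi_\kappa^{ij}U_\kappa^{ij}$ with $\phi_\kappa^{ij}(\mathbf x_\kappa(\xi,\zeta))=\ell_i(\xi)\ell_j(\zeta)$, so $U_\kappa^{ij}$ is the value of $u_h$ in $\kappa$ at $\mathbf x_\kappa^{ij}$. At a face node $\mathbf x_e^k$, $e\subset\partial\kappa$, $u_h^-$ is the trace from $\kappa$ and $u_h^+$ the trace from the neighbour; $\phi_\kappa^{ij}(\mathbf x_e^k)=1$ if $\mathbf x_\kappa^{ij}=\mathbf x_e^k$ and $0$ otherwise. Initial DOFs: $U_\kappa^{ij,0}=u_0(\mathbf x_\kappa^{ij})\in[m,M]$. **Residual and graph viscosity.** $$R_\kappa^{ij}(u_h)=2\Big(\omega_j\sum_{k=0}^pQ^p_{ik}h_{ec}(U_\kappa^{ij},U_\kappa^{kj},\mathbf n_\kappa^{(ik)j})+\omega_i\sum_{k=0}^pQ^p_{jk}h_{ec}(U_\kappa^{ij},U_\kappa^{ik},\mathbf n_\kappa^{i(jk)})\Big)+\sum_{e\in\partial\kappa}\sum_{k=0}^p\phi_\kappa^{ij}(\mathbf x_e^k)\omega_kJ_e^k\Big(h(U_\kappa^{ij},u_h^+(\mathbf x_e^k),\mathbf n_e^k)-\mathbf f(U_\kappa^{ij})\cdot\mathbf n_e^k\Big),$$ $$V_\kappa^{ij}(u_h)=d_\kappa\omega_i\omega_j\sum_{k=0}^p\Big(\frac{\omega_k}2|\mathbf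 n_\kappa^{(ik)j}|(U_\kappa^{ij}-U_\kappa^{kj})+\frac{\omega_k}2|\mathbf n_\kappa^{i(jk)}|(U_\kappa^{ij}-U_\kappa^{ik})\Big).$$ **Cell flux $h_{ec}$.** An entropy pair $(\vartheta,\mathbf g)$ means $\mathbf g(u)=\int^u\vartheta'(w)\mathbf f'(w)\,dw$. With $v(u)=\vartheta'(u)$ and $\boldsymbol\psi(u)=v(u)\mathbf f(u)-\mathbf g(u)$, $h_{ec}$ is smooth, consistent ($h_{ec}(u,u,\mathbf n)=\mathbf f(u)\cdot\mathbf n$), symmetric in its first two arguments, linear in $\mathbf n\in\mathbb R^2$, and entropy conservative: $(v(u^+)-v(u^-))h_{ec}(u^-,u^+,\mathbf n)=(\boldsymbol\psi(u^+)-\boldsymbol\psi(u^-))\cdot\mathbf n$. **Interface flux $h$.** $h$ is Lipschitz continuous, consistent ($h(u,u,\mathbf n)=\mathbf f(u)\cdot\mathbf n$), conservative ($h(u^-,u^+,\mathbf n)=-h(u^+,u^-,-\mathbf n)$), and monotone (nondecreasing in $u^-$, nonincreasing in $u^+$); its Lipschitz constants $L_1,L_2$ in its first two arguments satisfy $L_1+L_2\ge L_f$; and for all $u^-,u,u^+\in[m,M]$, $\mathbf n\in\mathbb S^1$, $\alpha\ge L_f$: $m\le u-\frac{h(u,u^+,\mathbf n)-h(u^-,u,\mathbf n)}{2\alpha}\le M$. *)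

theory Defs
  imports
    "HOL-Analysis.Analysis"
    "HOL-Probability.Essential_Supremum"
    "HOL-Computational_Algebra.Polynomial"
begin

section \<open>One-dimensional operators\<close>

text \<open>Rodrigues' formula.\<close>

definition legendre :: "nat \<Rightarrow> real poly" where
  "legendre p = smult (1 / (2 ^ p * fact p)) ((pderiv ^^ p) ([:-1, 0, 1:] ^ p))"

text \<open>The endpoints and, in increasing order, the \<open>p - 1\<close> zeros of the derivative of the
  Legendre polynomial of degree \<open>p\<close>.\<close>

definition gauss_lobatto_nodes :: "nat \<Rightarrow> (nat \<Rightarrow> real) \<Rightarrow> bool" where
  "gauss_lobatto_nodes p \<xi> \<longleftrightarrow>
     \<xi> 0 = -1 \<and> \<xi> p = 1 \<and> (\<forall>k<p. \<xi> k < \<xi> (Suc k)) \<and>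
     (\<forall>k. 0 < k \<and> k < p \<longrightarrow> poly (pderiv (legendre p)) (\<xi> k) = 0)"

definition lagrange :: "nat \<Rightarrow> (nat \<Rightarrow> real) \<Rightarrow> nat \<Rightarrow> real poly" where
  "lagrange p \<xi> k = (\<Prod>l\<in>{..p} - {k}. smult (1 / (\<xi> k - \<xi> l)) [:- \<xi> l, 1:])"

definition quad_weight :: "nat \<Rightarrow> (nat \<Rightarrow> real) \<Rightarrow> nat \<Rightarrow> real" where
  "quad_weight p \<xi> k = integral {-1..1} (poly (lagrange p \<xi> k))"

definition Dmat :: "nat \<Rightarrow> (nat \<Rightarrow> real) \<Rightarrow> nat \<Rightarrow> nat \<Rightarrow> real" where
  "Dmat p \<xi> k l = poly (pderiv (lagrange p \<xi> l)) (\<xi> k)"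

definition Qmat :: "nat \<Rightarrow> (nat \<Rightarrow> real) \<Rightarrow> nat \<Rightarrow> nat \<Rightarrow> real" where
  "Qmat p \<xi> k l = quad_weight p \<xi> k * Dmat p \<xi> k l"

section \<open>Meshes\<close>

text \<open>Elements and edges are represented by the point sets they occupy in the plane. The field
  \<open>geo_node T \<kappa> i j\<close> is the mapping coefficient \<open>x\<^sub>\<kappa>\<^sup>i\<^sup>j\<close>; \<open>edge_map T e\<close> parametrizes the edge \<open>e\<close>
  over \<open>[-1,1]\<close> and is common to the two elements sharing \<open>e\<close>; \<open>normal T \<kappa> e k\<close> is the unit normal
  at the \<open>k\<close>-th node of \<open>e\<close> pointing outward from \<open>\<kappa>\<close>.\<close>

type_synonym pt = "real ^ 2"

record dg_mesh =
  deg :: nat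
  gl :: "nat \<Rightarrow> real"
  domain :: "pt set"
  elems :: "pt set set"
  geo_node :: "pt set \<Rightarrow> nat \<Rightarrow> nat \<Rightarrow> pt"
  edge_map :: "pt set \<Rightarrow> real \<Rightarrow> pt"
  normal :: "pt set \<Rightarrow> pt set \<Rightarrow> nat \<Rightarrow> pt"

abbreviation ell :: "dg_mesh \<Rightarrow> nat \<Rightarrow> real poly" where
  "ell T \<equiv> lagrange (deg T) (gl T)"

abbreviation omega :: "dg_mesh \<Rightarrow> nat \<Rightarrow> real" where
  "omega T \<equiv> quad_weight (deg T) (gl T)"

abbreviation Dm :: "dg_mesh \<Rightarrow> nat \<Rightarrow> nat \<Rightarrow> real" where
  "Dm T \<equiv> Dmat (deg T) (gl T)"

abbreviation Qm :: "dg_mesh \<Rightarrow> nat \<Rightarrow> nat \<Rightarrow> real" where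
  "Qm T \<equiv> Qmat (deg T) (gl T)"

definition ref_square :: "pt set" where
  "ref_square = cbox (vec (-1)) (vec 1)"

definition elem_map :: "dg_mesh \<Rightarrow> pt set \<Rightarrow> pt \<Rightarrow> pt" where
  "elem_map T \<kappa> z =
     (\<Sum>i\<le>deg T. \<Sum>j\<le>deg T. (poly (ell T i) (z $ 1) * poly (ell T j) (z $ 2)) *\<^sub>R geo_node T \<kappa> i j)"

definition ref_node :: "dg_mesh \<Rightarrow> nat \<Rightarrow> nat \<Rightarrow> pt" where
  "ref_node T i j = vector [gl T i, gl T j]"

definition jac_matrix :: "dg_mesh \<Rightarrow> pt set \<Rightarrow> nat \<Rightarrow> nat \<Rightarrow> real ^ 2 ^ 2" where
  "jac_matrix T \<kappa> i j = matrix (frechet_derivative (elem_map T \<kappa>) (at (ref_node T i j)))"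

definition jac :: "dg_mesh \<Rightarrow> pt set \<Rightarrow> nat \<Rightarrow> nat \<Rightarrow> real" where
  "jac T \<kappa> i j = det (jac_matrix T \<kappa> i j)"

text \<open>The physical gradients of the two reference coordinates are the rows of the inverse of the
  Jacobian matrix of the mapping.\<close>

definition grad_xi :: "dg_mesh \<Rightarrow> pt set \<Rightarrow> nat \<Rightarrow> nat \<Rightarrow> pt" where
  "grad_xi T \<kappa> i j = row 1 (matrix_inv (jac_matrix T \<kappa> i j))"

definition grad_zeta :: "dg_mesh \<Rightarrow> pt set \<Rightarrow> nat \<Rightarrow> nat \<Rightarrow> pt" where
  "grad_zeta T \<kappa> i j = row 2 (matrix_inv (jac_matrix T \<kappa> i j))"

text \<open>\<open>metric_xi T \<kappa> i k j\<close> is \<open>n\<^sub>\<kappa>\<close> with superscript \<open>(ik)j\<close>, and \<open>metric_zeta T \<kappa> i j k\<close> is \<open>n\<^sub>\<kappa>\<close> with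
  superscript \<open>i(jk)\<close>.\<close>

definition metric_xi :: "dg_mesh \<Rightarrow> pt set \<Rightarrow> nat \<Rightarrow> nat \<Rightarrow> nat \<Rightarrow> pt" where
  "metric_xi T \<kappa> i k j =
     (1/2) *\<^sub>R (jac T \<kappa> i j *\<^sub>R grad_xi T \<kappa> i j + jac T \<kappa> k j *\<^sub>R grad_xi T \<kappa> k j)"

definition metric_zeta :: "dg_mesh \<Rightarrow> pt set \<Rightarrow> nat \<Rightarrow> nat \<Rightarrow> nat \<Rightarrow> pt" where
  "metric_zeta T \<kappa> i j k =
     (1/2) *\<^sub>R (jac T \<kappa> i j *\<^sub>R grad_zeta T \<kappa> i j + jac T \<kappa> i k *\<^sub>R grad_zeta T \<kappa> i k)"

datatype side = West | East | South | North

fun side_point :: "side \<Rightarrow> real \<Rightarrow> pt" where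
  "side_point West t = vector [-1, t]"
| "side_point East t = vector [1, t]"
| "side_point South t = vector [t, -1]"
| "side_point North t = vector [t, 1]"

fun side_outward :: "side \<Rightarrow> pt" where
  "side_outward West = vector [-1, 0]"
| "side_outward East = vector [1, 0]"
| "side_outward South = vector [0, -1]"
| "side_outward North = vector [0, 1]"

definition side_edge :: "dg_mesh \<Rightarrow> pt set \<Rightarrow> side \<Rightarrow> pt set" where
  "side_edge T \<kappa> s = (\<lambda>t. elem_map T \<kappa> (side_point s t)) ` {-1..1}"

definition edges :: "dg_mesh \<Rightarrow> pt set \<Rightarrow> pt set set" where
  "edges T \<kappa> = range (side_edge T \<kappa>)"

definition edge_node :: "dg_mesh \<Rightarrow> pt set \<Rightarrow> nat \<Rightarrow> pt" where
  "edge_node T e k = edge_map T e (gl T k)"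

definition edge_tangent :: "dg_mesh \<Rightarrow> pt set \<Rightarrow> nat \<Rightarrow> pt" where
  "edge_tangent T e k = vector_derivative (edge_map T e) (at (gl T k) within {-1..1})"

definition edge_jac :: "dg_mesh \<Rightarrow> pt set \<Rightarrow> nat \<Rightarrow> real" where
  "edge_jac T e k = norm (edge_tangent T e k)"

definition neighbour :: "dg_mesh \<Rightarrow> pt set \<Rightarrow> pt set \<Rightarrow> pt set" where
  "neighbour T \<kappa> e = (THE \<kappa>'. \<kappa>' \<in> elems T \<and> \<kappa>' \<noteq> \<kappa> \<and> e \<in> edges T \<kappa>')"

text \<open>A (possibly countably infinite) family of nonoverlapping nonempty open sets whose closures
  cover the domain. Each element is the image of the open reference square; injectivity on the
  closed square is what makes the mapped basis functions well defined.\<close>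

definition mesh_partition :: "dg_mesh \<Rightarrow> bool" where
  "mesh_partition T \<longleftrightarrow>
     countable (elems T) \<and> pairwise disjnt (elems T) \<and>
     \<Union>(elems T) \<subseteq> domain T \<and> domain T \<subseteq> (\<Union>\<kappa>\<in>elems T. closure \<kappa>) \<and>
     (\<forall>\<kappa>\<in>elems T. open \<kappa> \<and> \<kappa> \<noteq> {} \<and>
        \<kappa> = elem_map T \<kappa> ` interior ref_square \<and> inj_on (elem_map T \<kappa>) ref_square \<and>
        (\<forall>i\<le>deg T. \<forall>j\<le>deg T. jac T \<kappa> i j > 0))"

text \<open>Every face is shared with exactly one other element, and the common parametrization of the
  edge is, up to reversal, the restriction of either element mapping. As the Gauss-Lobatto nodes are
  symmetric about 0, the face nodes of neighbours coincide.\<close>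

definition mesh_watertight :: "dg_mesh \<Rightarrow> bool" where
  "mesh_watertight T \<longleftrightarrow>
     (\<forall>\<kappa>\<in>elems T. \<forall>s. \<exists>\<sigma>\<in>{1, -1}. \<forall>t\<in>{-1..1}.
        edge_map T (side_edge T \<kappa> s) t = elem_map T \<kappa> (side_point s (\<sigma> * t))) \<and>
     (\<forall>\<kappa>\<in>elems T. \<forall>e\<in>edges T \<kappa>. \<exists>!\<kappa>'. \<kappa>' \<in> elems T \<and> \<kappa>' \<noteq> \<kappa> \<and> e \<in> edges T \<kappa>')"

text \<open>Outwardness is measured along the image of the outward reference direction: at a corner of
  the element, moving along minus the outward normal of an edge need not lead into the element.\<close>

definition mesh_normals :: "dg_mesh \<Rightarrow> bool" where
  "mesh_normals T \<longleftrightarrow>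
     (\<forall>\<kappa>\<in>elems T. \<forall>s. \<forall>k\<le>deg T. \<forall>t\<in>{-1..1}.
        edge_node T (side_edge T \<kappa> s) k = elem_map T \<kappa> (side_point s t) \<longrightarrow>
        norm (normal T \<kappa> (side_edge T \<kappa> s) k) = 1 \<and>
        normal T \<kappa> (side_edge T \<kappa> s) k \<bullet> edge_tangent T (side_edge T \<kappa> s) k = 0 \<and>
        normal T \<kappa> (side_edge T \<kappa> s) k \<bullet>
          frechet_derivative (elem_map T \<kappa>) (at (side_point s t)) (side_outward s) > 0)"

definition discrete_metric_identities :: "dg_mesh \<Rightarrow> bool" where
  "discrete_metric_identities T \<longleftrightarrow>
     (\<forall>\<kappa>\<in>elems T. \<forall>i\<le>deg T. \<forall>j\<le>deg T.
        (\<Sum>k\<le>deg T. Dm T i k *\<^sub>R metric_xi T \<kappa> i k j + Dm T j k *\<^sub>R metric_zeta T \<kappa> i j k) = 0)"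

definition face_metrics :: "dg_mesh \<Rightarrow> bool" where
  "face_metrics T \<longleftrightarrow>
     (let p = deg T in
      \<forall>\<kappa>\<in>elems T. \<forall>l\<le>p. \<forall>k\<le>p.
        (edge_node T (side_edge T \<kappa> East) k = geo_node T \<kappa> p l \<longrightarrow>
           metric_xi T \<kappa> p p l =
             edge_jac T (side_edge T \<kappa> East) k *\<^sub>R normal T \<kappa> (side_edge T \<kappa> East) k) \<and>
        (edge_node T (side_edge T \<kappa> West) k = geo_node T \<kappa> 0 l \<longrightarrow>
           metric_xi T \<kappa> 0 0 l =
             - (edge_jac T (side_edge T \<kappa> West) k *\<^sub>R normal T \<kappa> (side_edge T \<kappa> West) k)) \<and>
        (edge_node T (side_edge T \<kappa> North) k = geo_node T \<kappa> l p \<longrightarrow>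
           metric_zeta T \<kappa> l p p =
             edge_jac T (side_edge T \<kappa> North) k *\<^sub>R normal T \<kappa> (side_edge T \<kappa> North) k) \<and>
        (edge_node T (side_edge T \<kappa> South) k = geo_node T \<kappa> l 0 \<longrightarrow>
           metric_zeta T \<kappa> l 0 0 =
             - (edge_jac T (side_edge T \<kappa> South) k *\<^sub>R normal T \<kappa> (side_edge T \<kappa> South) k)))"

definition mesh_size :: "dg_mesh \<Rightarrow> real" where
  "mesh_size T = (SUP \<kappa>\<in>elems T. diameter \<kappa>)"

text \<open>The constants are those of general dimension \<open>d\<close>, instantiated at \<open>d = 2\<close>.\<close>

definition mesh_regular :: "dg_mesh \<Rightarrow> bool" where
  "mesh_regular T \<longleftrightarrow>
     bdd_above (diameter ` elems T) \<and>
     (\<exists>b>0. \<forall>\<kappa>\<in>elems T. \<forall>i\<le>deg T. \<forall>j\<le>deg T. \<forall>k\<le>deg T.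
        jac T \<kappa> i j \<ge> b / (2 * 2) * mesh_size T ^ 2 \<and>
        (\<forall>e\<in>edges T \<kappa>. 0 < edge_jac T e k \<and> edge_jac T e k \<le> 1 / (4 * 2 * b) * mesh_size T) \<and>
        0 < norm (metric_xi T \<kappa> i k j) \<and>
        norm (metric_xi T \<kappa> i k j) \<le> 1 / (4 * 2 * b) * mesh_size T \<and>
        0 < norm (metric_zeta T \<kappa> i j k) \<and>
        norm (metric_zeta T \<kappa> i j k) \<le> 1 / (4 * 2 * b) * mesh_size T)"

definition admissible_mesh :: "dg_mesh \<Rightarrow> bool" where
  "admissible_mesh T \<longleftrightarrow>
     deg T \<ge> 1 \<and> gauss_lobatto_nodes (deg T) (gl T) \<and> mesh_partition T \<and> mesh_watertight T \<and>
     mesh_normals T \<and> discrete_metric_identities T \<and> face_metrics T \<and> mesh_regular T"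

section \<open>Data and fluxes\<close>

definition essinf :: "'a measure \<Rightarrow> ('a \<Rightarrow> ereal) \<Rightarrow> ereal" where
  "essinf N f = - esssup N (\<lambda>x. - f x)"

definition locally_lipschitz :: "(real \<Rightarrow> pt) \<Rightarrow> bool" where
  "locally_lipschitz f \<longleftrightarrow> (\<forall>u. \<exists>r>0. \<exists>L. L-lipschitz_on (cball u r) f)"

text \<open>The element 0 only fixes the supremum in the degenerate case \<open>m = M\<close>, where the index set is
  empty; otherwise all quotients are nonnegative. The same applies to \<open>entropy_ratio\<close> below.\<close>

definition flux_lipschitz :: "(real \<Rightarrow> pt) \<Rightarrow> real \<Rightarrow> real \<Rightarrow> real" where
  "flux_lipschitz f m M =
     Sup (insert 0 {\<bar>(f a - f b) \<bullet> n\<bar> / \<bar>a - b\<bar> | a b n.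
       a \<in> {m..M} \<and> b \<in> {m..M} \<and> a \<noteq> b \<and> n \<in> sphere 0 1})"

definition entropy_ratio :: "(real \<Rightarrow> real) \<Rightarrow> real \<Rightarrow> real \<Rightarrow> real" where
  "entropy_ratio \<theta> m M =
     Sup (insert 0 {deriv (deriv \<theta>) a * (a - b) / (deriv \<theta> a - deriv \<theta> b) | a b.
       a \<in> {m..M} \<and> b \<in> {m..M} \<and> a \<noteq> b})"

text \<open>A locally Lipschitz flux is differentiable almost everywhere, so the integral does not depend
  on the values of \<open>vector_derivative\<close> elsewhere.\<close>

definition entropy_pair :: "(real \<Rightarrow> pt) \<Rightarrow> (real \<Rightarrow> real) \<Rightarrow> (real \<Rightarrow> pt) \<Rightarrow> bool" where
  "entropy_pair f \<theta> g \<longleftrightarrow>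
     (\<forall>u. \<theta> differentiable (at u)) \<and> (\<forall>u. deriv \<theta> differentiable (at u)) \<and>
     continuous_on UNIV (deriv (deriv \<theta>)) \<and>
     (\<forall>a b. a \<le> b \<longrightarrow>
        ((\<lambda>w. deriv \<theta> w *\<^sub>R vector_derivative f (at w)) has_integral (g b - g a)) {a..b})"

definition entropy_potential ::
    "(real \<Rightarrow> pt) \<Rightarrow> (real \<Rightarrow> real) \<Rightarrow> (real \<Rightarrow> pt) \<Rightarrow> real \<Rightarrow> pt" where
  "entropy_potential f \<theta> g u = deriv \<theta> u *\<^sub>R f u - g u"

definition C1 :: "(real \<times> real \<Rightarrow> real) \<Rightarrow> bool" where
  "C1 F \<longleftrightarrow> (\<exists>F' :: real \<times> real \<Rightarrow> (real \<times> real) \<Rightarrow>\<^sub>L real.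
     (\<forall>z. (F has_derivative blinfun_apply (F' z)) (at z)) \<and> continuous_on UNIV F')"

text \<open>Of the smoothness of the two-point flux only continuous differentiability in the two states
  is required.\<close>

definition entropy_conservative_flux ::
    "(real \<Rightarrow> pt) \<Rightarrow> (real \<Rightarrow> real) \<Rightarrow> (real \<Rightarrow> pt) \<Rightarrow> (real \<Rightarrow> real \<Rightarrow> pt \<Rightarrow> real) \<Rightarrow> bool" where
  "entropy_conservative_flux f \<theta> g hec \<longleftrightarrow>
     (\<forall>n. C1 (\<lambda>(a, b). hec a b n)) \<and>
     (\<forall>u n. hec u u n = f u \<bullet> n) \<and>
     (\<forall>a b n. hec a b n = hec b a n) \<and>
     (\<forall>a b. linear (hec a b)) \<and>
     (\<forall>a b n. (deriv \<theta> b - deriv \<theta> a) * hec a b n =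
        (entropy_potential f \<theta> g b - entropy_potential f \<theta> g a) \<bullet> n)"

text \<open>The properties are only required on \<open>[m,M]\<close>, as for a Lax-Friedrichs flux with dissipation
  tuned to this interval.\<close>

definition interface_flux ::
    "(real \<Rightarrow> pt) \<Rightarrow> real \<Rightarrow> real \<Rightarrow> (real \<Rightarrow> real \<Rightarrow> pt \<Rightarrow> real) \<Rightarrow> bool" where
  "interface_flux f m M h \<longleftrightarrow>
     (\<exists>L1 L2. L1 + L2 \<ge> flux_lipschitz f m M \<and>
        (\<forall>n\<in>sphere 0 1. \<forall>w\<in>{m..M}.
           L1-lipschitz_on {m..M} (\<lambda>u. h u w n) \<and> L2-lipschitz_on {m..M} (\<lambda>u. h w u n))) \<and>
     (\<forall>n\<in>sphere 0 1. \<forall>u\<in>{m..M}. h u u n = f u \<bullet> n) \<and>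
     (\<forall>n\<in>sphere 0 1. \<forall>a\<in>{m..M}. \<forall>b\<in>{m..M}. h a b n = - h b a (- n)) \<and>
     (\<forall>n\<in>sphere 0 1. \<forall>w\<in>{m..M}.
        mono_on {m..M} (\<lambda>u. h u w n) \<and> antimono_on {m..M} (\<lambda>u. h w u n)) \<and>
     (\<forall>n\<in>sphere 0 1. \<forall>a\<in>{m..M}. \<forall>u\<in>{m..M}. \<forall>b\<in>{m..M}. \<forall>\<alpha>\<ge>flux_lipschitz f m M.
        u - (h u b n - h a u n) / (2 * \<alpha>) \<in> {m..M})"

section \<open>The scheme\<close>

type_synonym dofs = "pt set \<Rightarrow> nat \<Rightarrow> nat \<Rightarrow> real"

definition basis_fun :: "dg_mesh \<Rightarrow> pt set \<Rightarrow> nat \<Rightarrow> nat \<Rightarrow> pt \<Rightarrow> real" where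
  "basis_fun T \<kappa> i j x =
     (let z = inv_into ref_square (elem_map T \<kappa>) x
      in poly (ell T i) (z $ 1) * poly (ell T j) (z $ 2))"

text \<open>The restriction of the discrete function to the closure of \<open>\<kappa>\<close>; at points of an edge of
  \<open>\<kappa>\<close> it is the trace taken from \<open>\<kappa>\<close>.\<close>

definition dg_fun :: "dg_mesh \<Rightarrow> dofs \<Rightarrow> pt set \<Rightarrow> pt \<Rightarrow> real" where
  "dg_fun T U \<kappa> x = (\<Sum>i\<le>deg T. \<Sum>j\<le>deg T. basis_fun T \<kappa> i j x * U \<kappa> i j)"

definition residual ::
    "dg_mesh \<Rightarrow> (real \<Rightarrow> pt) \<Rightarrow> (real \<Rightarrow> real \<Rightarrow> pt \<Rightarrow> real) \<Rightarrow> (real \<Rightarrow> real \<Rightarrow> pt \<Rightarrow> real)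
       \<Rightarrow> dofs \<Rightarrow> pt set \<Rightarrow> nat \<Rightarrow> nat \<Rightarrow> real" where
  "residual T f hec h U \<kappa> i j =
     2 * (omega T j * (\<Sum>k\<le>deg T. Qm T i k * hec (U \<kappa> i j) (U \<kappa> k j) (metric_xi T \<kappa> i k j)) +
          omega T i * (\<Sum>k\<le>deg T. Qm T j k * hec (U \<kappa> i j) (U \<kappa> i k) (metric_zeta T \<kappa> i j k))) +
     (\<Sum>e\<in>edges T \<kappa>. \<Sum>k\<le>deg T.
        basis_fun T \<kappa> i j (edge_node T e k) * omega T k * edge_jac T e k *
        (h (U \<kappa> i j) (dg_fun T U (neighbour T \<kappa> e) (edge_node T e k)) (normal T \<kappa> e k)
         - f (U \<kappa> i j) \<bullet> normal T \<kappa> e k))"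

definition graph_viscosity ::
    "dg_mesh \<Rightarrow> (pt set \<Rightarrow> real) \<Rightarrow> dofs \<Rightarrow> pt set \<Rightarrow> nat \<Rightarrow> nat \<Rightarrow> real" where
  "graph_viscosity T d U \<kappa> i j =
     d \<kappa> * omega T i * omega T j *
     (\<Sum>k\<le>deg T. omega T k / 2 * norm (metric_xi T \<kappa> i k j) * (U \<kappa> i j - U \<kappa> k j) +
                 omega T k / 2 * norm (metric_zeta T \<kappa> i j k) * (U \<kappa> i j - U \<kappa> i k))"

definition backward_euler_step ::
    "dg_mesh \<Rightarrow> (real \<Rightarrow> pt) \<Rightarrow> (real \<Rightarrow> real \<Rightarrow> pt \<Rightarrow> real) \<Rightarrow> (real \<Rightarrow> real \<Rightarrow> pt \<Rightarrow> real)
       \<Rightarrow> (pt set \<Rightarrow> real) \<Rightarrow> real \<Rightarrow> dofs \<Rightarrow> dofs \<Rightarrow> bool" where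
  "backward_euler_step T f hec h d dt U V \<longleftrightarrow>
     (\<forall>\<kappa>\<in>elems T. \<forall>i\<le>deg T. \<forall>j\<le>deg T.
        omega T i * omega T j * jac T \<kappa> i j * ((V \<kappa> i j - U \<kappa> i j) / dt)
        + residual T f hec h V \<kappa> i j + graph_viscosity T d V \<kappa> i j = 0)"

definition dofs_within :: "dg_mesh \<Rightarrow> real \<Rightarrow> real \<Rightarrow> dofs \<Rightarrow> bool" where
  "dofs_within T m M U \<longleftrightarrow>
     (\<forall>\<kappa>\<in>elems T. \<forall>i\<le>deg T. \<forall>j\<le>deg T. m \<le> U \<kappa> i j \<and> U \<kappa> i j \<le> M)"

text \<open>Only the values at elements of the mesh and at indices up to the degree are DOFs.\<close>

definition dofs_eq :: "dg_mesh \<Rightarrow> dofs \<Rightarrow> dofs \<Rightarrow> bool" where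
  "dofs_eq T U V \<longleftrightarrow> (\<forall>\<kappa>\<in>elems T. \<forall>i\<le>deg T. \<forall>j\<le>deg T. U \<kappa> i j = V \<kappa> i j)"

end

theory Submission
  imports Defs
begin

text \<open>
  In each cell the entropy conservative flux is \<open>f(c) \<cdot> n\<close> for some \<open>c\<close> between its two states (Cauchy's
  mean value theorem), so it is Lipschitz in either state with constant \<open>L\<^sub>f L\<^sub>u |n|\<close>, and the graph
  viscosity makes every equation of the scheme nonincreasing in all DOFs but its own. The metric
  identities make the constants \<open>m\<close> and \<open>M\<close> a sub- and a supersolution. Perron's method then gives a
  solution that lies above all others.

  For uniqueness, let \<open>D \<ge> 0\<close> be the difference of this solution and another one. Summation by parts
  cancels the cell fluxes, and the face fluxes cancel in pairs because neighbours see opposite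
  normals: two elements lying on the same side of a common edge would overlap. So the mass of \<open>D\<close> in
  the ball of radius \<open>R\<close> is bounded by a constant times its mass in the shell of width \<open>h\<close> around it.
  It thus grows exponentially in \<open>R\<close> unless \<open>D = 0\<close>, whereas it is at most a multiple of the total
  area of the elements in the ball, by the exactness of the quadrature for the Jacobian.
\<close>

section \<open>Gauss-Lobatto quadrature\<close>

text \<open>The mesh may be infinite, and an equation need not be monotone in its own DOF, on which
  the cell fluxes and the term -f . n may depend in either direction. Perron's method copes with
  both: it asks only for continuity in the own DOF. It yields no comparison principle, however, so
  uniqueness has to come from conservation. The total mass of \<open>D\<close> over the mesh may be
  infinite, which is why balances are summed over balls only. The largest solution is used there
  because it makes \<open>D\<close> one-signed: as the interface flux is nondecreasing in the inner
  state, the \<open>D\<close> of an element can only increase its own outflow, and the inflow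
  through an edge is bounded by the \<open>D\<close> of the neighbour alone. The uniform bounds on
  the Jacobians make the constant in this estimate the same for all elements and put only finitely
  many elements into a ball. The Gauss-Lobatto nodes are given merely as zeros of the derivative of
  a Legendre polynomial, so exactness, positive weights and symmetry are all derived from Rodrigues'
  formula.\<close>

definition pint :: "real poly \<Rightarrow> real" where
  "pint q = integral {-1..1} (poly q)"

lemma poly_integrable [simp]: "poly (q :: real poly) integrable_on {-1..1}"
  by (rule integrable_continuous_real) (simp add: continuous_on_poly continuous_on_id)

lemma pint_add: "pint (q + r) = pint q + pint r"
  using integral_add[OF poly_integrable[of q] poly_integrable[of r]] by (simp add: pint_def poly_add[abs_def])

lemma pint_diff: "pint (q - r) = pint q - pint r"
  using integral_diff[OF poly_integrable[of q] poly_integrable[of r]] by (simp add: pint_def poly_diff[abs_def])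

lemma pint_smult: "pint (smult c q) = c * pint q"
  by (simp add: pint_def poly_smult[abs_def])

lemma pint_0 [simp]: "pint 0 = 0"
  by (simp add: pint_def poly_0[abs_def])

lemma pint_sum: "pint (\<Sum>i\<in>S. q i) = (\<Sum>i\<in>S. pint (q i))"
  by (induction S rule: infinite_finite_induct) (simp_all add: pint_add)

lemma pint_pderiv: "pint (pderiv q) = poly q 1 - poly q (-1)"
  unfolding pint_def by (intro integral_unique fundamental_theorem_of_calculus)
     (auto simp: has_real_derivative_iff_has_vector_derivative[symmetric] intro!: poly_DERIV[THEN DERIV_subset])

lemma pint_by_parts:
  "pint (pderiv q * r) = poly q 1 * poly r 1 - poly q (-1) * poly r (-1) - pint (q * pderiv r)"
  using pint_pderiv[of "q * r"] by (simp add: pderiv_mult pint_add mult.commute)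

section \<open>Rodrigues' formula: orthogonality and parity of the Legendre polynomials\<close>

lemma power_dvd_pderiv:
  fixes w q :: "real poly"
  assumes "w ^ Suc n dvd q" shows "w ^ n dvd pderiv q"
proof -
  from assms obtain r where "q = w * w ^ n * r" by auto
  \<comment> \<open>The extra factor \<open>w\<close> makes up for the power that the derivative of
    \<open>w ^ n\<close> loses.\<close>
  moreover have "w ^ n dvd w * pderiv (w ^ n)"
  proof (cases n)
    case (Suc m)
    then have "w * pderiv (w ^ n) = w ^ n * smult (1 + of_nat m) (pderiv w)"
      unfolding Suc pderiv_power_Suc by (simp add: mult_ac)
    then show ?thesis by (simp add: dvd_smult)
  qed simp
  ultimately show ?thesis
    by (auto simp: pderiv_mult distrib_left mult.assoc mult.left_commute
        intro!: dvd_add dvd_mult2 dvd_mult)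
qed

abbreviation bump :: "real poly" where "bump \<equiv> [:-1, 0, 1:]"

lemma bump_power_dvd_iterated_pderiv:
  "k \<le> n \<Longrightarrow> bump ^ (n - k) dvd (pderiv ^^ k) (bump ^ n)"
proof (induction k)
  case (Suc k)
  then have "bump ^ Suc (n - Suc k) dvd (pderiv ^^ k) (bump ^ n)"
    by (metis Suc_diff_le Suc_leD diff_Suc_Suc)
  from power_dvd_pderiv[OF this] show ?case by simp
qed simp

text \<open>Fewer than \<open>n\<close> derivatives leave at least one factor x^2 - 1, which
  vanishes at both endpoints.\<close>

lemma iterated_pderiv_bump_endpoints:
  assumes "k < n"
  shows "poly ((pderiv ^^ k) (bump ^ n)) 1 = 0" "poly ((pderiv ^^ k) (bump ^ n)) (-1) = 0"
proof -
  have "bump dvd bump ^ (n - k)" using assms by (simp add: dvd_power)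
  then have "bump dvd (pderiv ^^ k) (bump ^ n)"
    using bump_power_dvd_iterated_pderiv[of k n] assms dvd_trans less_imp_le by blast
  then show "poly ((pderiv ^^ k) (bump ^ n)) 1 = 0" "poly ((pderiv ^^ k) (bump ^ n)) (-1) = 0"
    by (auto elim!: dvdE simp del: mult_pCons_left)
qed

text \<open>Integration by parts moves the derivatives onto \<open>q\<close> one at a time, and
  \<open>k \<le> n\<close> makes every boundary term vanish. The base case is vacuous.\<close>

lemma iterated_pderiv_bump_orthogonal:
  "k \<le> n \<Longrightarrow> degree q < k \<Longrightarrow> pint ((pderiv ^^ k) (bump ^ n) * q) = 0"
proof (induction k arbitrary: q)
  case (Suc k)
  \<comment> \<open>A constant \<open>q\<close> is treated apart: its derivative is 0, but its
    degree cannot drop, as the induction hypothesis would need at \<open>k = 0\<close>.\<close>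
  have "pint ((pderiv ^^ k) (bump ^ n) * pderiv q) = 0"
  proof (cases "degree q = 0")
    case True
    then have "pderiv q = 0" by (simp add: pderiv_eq_0_iff)
    then show ?thesis by simp
  next
    case False
    then show ?thesis using Suc by (intro Suc.IH) (auto simp: degree_pderiv)
  qed
  then show ?case
    using pint_by_parts[of "(pderiv ^^ k) (bump ^ n)" q] iterated_pderiv_bump_endpoints[of k n] Suc.prems
    by simp
qed simp

lemma legendre_orthogonal: "degree q < p \<Longrightarrow> pint (legendre p * q) = 0"
  using iterated_pderiv_bump_orthogonal[of p p q] by (simp add: legendre_def pint_smult)

lemma degree_iterated_pderiv: "degree ((pderiv ^^ k) (q :: real poly)) = degree q - k"
  by (induction k) (auto simp: degree_pderiv)

lemma degree_legendre: "degree (legendre p) = p"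
  by (simp add: legendre_def degree_iterated_pderiv degree_power_eq)

text \<open>Every derivative contributes one sign under the substitution of -x for x, and x^2 - 1 is
  even.\<close>

lemma legendre_reflect: "poly (legendre p) (- x) = (-1) ^ p * poly (legendre p) x"
proof -
  have *: "pcompose ((pderiv ^^ k) q) [:0, -1:] = smult ((-1) ^ k) ((pderiv ^^ k) (pcompose q [:0, -1:]))"
    for k and q :: "real poly"
  proof (induction k)
    case (Suc k)
    have "pderiv (pcompose ((pderiv ^^ k) q) [:0, -1:])
        = pcompose (pderiv ((pderiv ^^ k) q)) [:0, -1:] * [:-1:]"
      by (simp add: pderiv_pcompose pderiv_pCons)
    then have "pcompose (pderiv ((pderiv ^^ k) q)) [:0, -1:]
        = - pderiv (pcompose ((pderiv ^^ k) q) [:0, -1:])" by simp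
    then show ?case using Suc by (simp add: pderiv_smult)
  qed simp
  have b: "pcompose (bump ^ p) [:0, -1:] = bump ^ p"
    by (induction p) (simp_all add: pcompose_mult pcompose_pCons pcompose_1 del: mult_pCons_left)
  have "poly (legendre p) (- x) = poly (pcompose (legendre p) [:0, -1:]) x"
    by (simp add: poly_pcompose)
  also have "\<dots> = (-1) ^ p * poly (legendre p) x"
    by (simp add: legendre_def pcompose_smult * b)
  finally show ?thesis .
qed

lemma legendre_deriv_reflect:
  assumes "poly (pderiv (legendre p)) x = 0" shows "poly (pderiv (legendre p)) (- x) = 0"
proof -
  have "pcompose (legendre p) [:0, -1:] = smult ((-1) ^ p) (legendre p)"
    by (subst poly_eq_poly_eq_iff[symmetric]) (simp add: fun_eq_iff poly_pcompose legendre_reflect)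
  then have "pderiv (pcompose (legendre p) [:0, -1:]) = smult ((-1) ^ p) (pderiv (legendre p))"
    by (simp add: pderiv_smult)
  then have "poly (pderiv (pcompose (legendre p) [:0, -1:])) x = 0" using assms by simp
  then show ?thesis by (simp add: pderiv_pcompose poly_pcompose pderiv_pCons)
qed

text \<open>Distinctness of the points lets the remaining roots pass to the quotient when one linear
  factor is split off.\<close>

lemma prod_linear_dvd:
  fixes q :: "real poly"
  assumes "finite S" "inj_on \<xi> S" "\<And>i. i \<in> S \<Longrightarrow> poly q (\<xi> i) = 0"
  shows "(\<Prod>i\<in>S. [:- \<xi> i, 1:]) dvd q"
  using assms
proof (induction S arbitrary: q rule: finite_induct)
  case (insert a S)
  then obtain r where r: "q = [:- \<xi> a, 1:] * r" by (metis dvdE insertI1 poly_eq_0_iff_dvd)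
  have "poly r (\<xi> i) = 0" if "i \<in> S" for i
  proof -
    have "\<xi> i \<noteq> \<xi> a" using insert.prems(1) insert.hyps that by (auto simp: inj_on_def)
    moreover have "poly q (\<xi> i) = 0" using insert.prems that by auto
    ultimately show ?thesis unfolding r by (simp add: algebra_simps)
  qed
  then have "(\<Prod>i\<in>S. [:- \<xi> i, 1:]) dvd r" using insert by auto
  then show ?case unfolding r using insert by (simp add: mult_dvd_mono del: mult_pCons_left)
qed simp

section \<open>Exactness, positivity, summation by parts and symmetry of the quadrature\<close>

locale gauss_lobatto =
  fixes p :: nat and \<xi> :: "nat \<Rightarrow> real"
  assumes p_pos: "p \<ge> 1" and nodes: "gauss_lobatto_nodes p \<xi>"
begin

abbreviation "\<omega> \<equiv> quad_weight p \<xi>"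
abbreviation "lag \<equiv> lagrange p \<xi>"

lemma node_0 [simp]: "\<xi> 0 = -1" and node_p [simp]: "\<xi> p = 1"
  using nodes by (auto simp: gauss_lobatto_nodes_def)

lemma node_mono: "i < j \<Longrightarrow> j \<le> p \<Longrightarrow> \<xi> i < \<xi> j"
proof (induction j)
  case (Suc j)
  have "\<xi> j < \<xi> (Suc j)" using Suc.prems nodes by (auto simp: gauss_lobatto_nodes_def)
  then show ?case using Suc by (cases "i = j") auto
qed simp

lemma node_eq_iff: "i \<le> p \<Longrightarrow> j \<le> p \<Longrightarrow> \<xi> i = \<xi> j \<longleftrightarrow> i = j"
  by (metis linorder_neqE_nat node_mono order_less_irrefl)

lemma node_inj: "inj_on \<xi> {..p}"
  by (auto simp: inj_on_def node_eq_iff)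

lemma node_bounds: "i \<le> p \<Longrightarrow> \<xi> i \<in> {-1..1}"
  using node_mono[of 0 i] node_mono[of i p] by (cases "i = 0"; cases "i = p") auto

lemma lag_node: "k \<le> p \<Longrightarrow> l \<le> p \<Longrightarrow> poly (lag k) (\<xi> l) = (if k = l then 1 else 0)"
  by (auto simp: lagrange_def poly_prod node_eq_iff intro!: prod.neutral
      divide_self bexI[of _ l] simp flip: left_diff_distrib diff_divide_distrib)

lemma degree_lag: assumes "k \<le> p" shows "degree (lag k) \<le> p"
proof -
  have "degree (lag k) \<le> (\<Sum>l\<in>{..p} - {k}. degree (smult (1 / (\<xi> k - \<xi> l)) [:- \<xi> l, 1:]))"
    unfolding lagrange_def by (rule degree_prod_sum_le[unfolded comp_def]) simp
  also have "\<dots> \<le> (\<Sum>l\<in>{..p} - {k}. 1)" by (intro sum_mono) simp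
  also have "\<dots> = p" using assms by simp
  finally show ?thesis .
qed

text \<open>The nodes are p + 1 distinct roots of a polynomial of degree p + 1, so the cofactor is
  constant. Both the exactness and the symmetry of the rule rest on this link between the nodes and
  the Legendre polynomial.\<close>

lemma nodal_polynomial:
  obtains c where "c \<noteq> 0" "bump * pderiv (legendre p) = smult c (\<Prod>i\<le>p. [:- \<xi> i, 1:])"
proof -
  have "(\<Prod>i\<le>p. [:- \<xi> i, 1:]) dvd bump * pderiv (legendre p)"
  proof (rule prod_linear_dvd)
    fix i assume "i \<in> {..p}"
    then consider "i = 0" | "i = p" | "0 < i" "i < p" by fastforce
    then show "poly (bump * pderiv (legendre p)) (\<xi> i) = 0"
      using nodes by cases (auto simp: gauss_lobatto_nodes_def simp del: mult_pCons_left)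
  qed (auto simp: node_inj)
  then obtain s where s: "bump * pderiv (legendre p) = (\<Prod>i\<le>p. [:- \<xi> i, 1:]) * s" by (elim dvdE)
  have nz: "pderiv (legendre p) \<noteq> 0"
    using degree_legendre[of p] p_pos by (simp add: pderiv_eq_0_iff)
  have "degree (bump * pderiv (legendre p)) = p + 1"
    using nz p_pos by (subst degree_mult_eq) (auto simp: degree_pderiv degree_legendre)
  moreover have "s \<noteq> 0" using s nz by (metis mult_eq_0_iff pCons_eq_0_iff one_neq_zero)
  moreover have "degree (\<Prod>i\<le>p. [:- \<xi> i, 1:]) = p + 1"
    by (subst degree_prod_eq_sum_degree) auto
  ultimately have "degree s = 0"
    unfolding s by (subst (asm) degree_mult_eq) auto
  then obtain c where "s = [:c:]" by (elim degree_eq_zeroE)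
  with \<open>s \<noteq> 0\<close> s show ?thesis by (intro that[of c]) auto
qed

text \<open>The interpolation error is a multiple of (x^2 - 1) P_p' s with \<open>s\<close> of
  degree at most p - 2. One integration by parts takes the derivative off P_p without boundary
  terms, and P_p is orthogonal to ((x^2 - 1) s)', whose degree is below p.\<close>

theorem quadrature_exact:
  assumes "degree q \<le> 2 * p - 1"
  shows "pint q = (\<Sum>k\<le>p. \<omega> k * poly q (\<xi> k))"
proof -
  let ?r = "\<Sum>k\<le>p. smult (poly q (\<xi> k)) (lag k)"
  have r: "pint ?r = (\<Sum>k\<le>p. \<omega> k * poly q (\<xi> k))"
    by (simp add: pint_sum pint_smult quad_weight_def pint_def[symmetric] mult.commute)
  have dr: "degree ?r \<le> p"
    by (intro degree_sum_le order.trans[OF degree_smult_le]) (auto simp: degree_lag)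
  have "(\<Prod>i\<le>p. [:- \<xi> i, 1:]) dvd q - ?r"
    by (rule prod_linear_dvd)
       (auto simp: node_inj poly_sum lag_node if_distrib[of "(*) _"] cong: if_cong)
  then obtain s where s: "q - ?r = (\<Prod>i\<le>p. [:- \<xi> i, 1:]) * s" by (elim dvdE)
  obtain c where c: "c \<noteq> 0" "bump * pderiv (legendre p) = smult c (\<Prod>i\<le>p. [:- \<xi> i, 1:])"
    by (rule nodal_polynomial)
  have "pint (q - ?r) = 0"
  proof (cases "s = 0")
    case False
    have "degree (q - ?r) = p + 1 + degree s"
      unfolding s using False
      by (subst degree_mult_eq) (auto simp: prod_zero_iff degree_prod_eq_sum_degree)
    moreover have "degree (q - ?r) \<le> max (2 * p - 1) p"
      using degree_diff_le_max[of q ?r] assms dr by linarith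
    ultimately have ds: "degree s + 2 \<le> p" by linarith
    have "degree (bump * s) = degree s + 2" using False by (subst degree_mult_eq) auto
    then have "degree (pderiv (bump * s)) < p" using ds by (simp only: degree_pderiv)
    then have "pint (legendre p * pderiv (bump * s)) = 0" by (rule legendre_orthogonal)
    then have "pint (pderiv (legendre p) * (bump * s)) = 0"
      unfolding pint_by_parts by (simp del: mult_pCons_left)
    moreover have "pderiv (legendre p) * (bump * s) = smult c (q - ?r)"
      unfolding s by (metis c(2) mult.assoc mult.commute mult_smult_left)
    ultimately show ?thesis using c(1) by (simp add: pint_smult)
  qed (simp add: s)
  then show ?thesis using r by (simp add: pint_diff)
qed

lemma pint_pos:
  assumes "\<And>x. x \<in> {-1..1} \<Longrightarrow> poly q x \<ge> 0" "q \<noteq> 0"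
  shows "pint q > 0"
proof -
  have "pint q \<ge> 0" unfolding pint_def by (intro integral_nonneg) (auto simp: assms)
  moreover have "pint q \<noteq> 0"
  proof
    assume "pint q = 0"
    then have "\<And>x. x \<in> {-1..1} \<Longrightarrow> poly q x = 0"
      using integral_eq_0_iff[of "-1" 1 "poly q"] assms by (auto simp: pint_def continuous_on_poly)
    then have "{-1..1} \<subseteq> {x. poly q x = 0}" by auto
    then have "finite {-1..1::real}" using poly_roots_finite[OF assms(2)] finite_subset by blast
    then show False by (simp add: infinite_Icc)
  qed
  ultimately show ?thesis by linarith
qed

text \<open>Exactness is applied to a polynomial that is nonnegative on [-1,1] and vanishes at every
  node except node \<open>k\<close>. Interior nodes are removed by squares, the endpoints by simple
  factors, which do not change sign on the interval; this economy keeps the degree within 2p -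
  1.\<close>

theorem weight_pos:
  assumes "k \<le> p" shows "\<omega> k > 0"
proof -
  define a :: "real poly" where
    "a = (if k = 0 then [:1, -1:] else if k = p then [:1, 1:] else [:1, 0, -1:])"
  define S where "S = {0<..<p} - {k}"
  define b where "b = (\<Prod>l\<in>S. [:- \<xi> l, 1:])"
  have b0: "b \<noteq> 0" by (auto simp: b_def S_def prod_zero_iff)
  have a0: "a \<noteq> 0" by (auto simp: a_def)
  have db: "degree b = card S" unfolding b_def by (subst degree_prod_eq_sum_degree) auto
  have cS: "card S = (if 0 < k \<and> k < p then p - 2 else p - 1)" by (auto simp: S_def)
  have "degree (a * b ^ 2) = degree a + 2 * card S"
    using a0 b0 by (simp add: degree_mult_eq degree_power_eq db)
  also have "\<dots> \<le> 2 * p - 1" using assms p_pos by (auto simp: cS a_def)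
  finally have "pint (a * b ^ 2) = (\<Sum>l\<le>p. \<omega> l * poly (a * b ^ 2) (\<xi> l))"
    by (rule quadrature_exact)
  also have "\<dots> = (\<Sum>l\<in>{k}. \<omega> l * poly (a * b ^ 2) (\<xi> l))"
  proof (rule sum.mono_neutral_right)
    show "\<forall>l\<in>{..p} - {k}. \<omega> l * poly (a * b ^ 2) (\<xi> l) = 0"
    proof
      fix l assume l: "l \<in> {..p} - {k}"
      show "\<omega> l * poly (a * b ^ 2) (\<xi> l) = 0"
      proof (cases "l \<in> S")
        case True
        then have "poly b (\<xi> l) = 0" by (auto simp: b_def poly_prod S_def)
        then show ?thesis by simp
      next
        case False
        then have "l = 0 \<or> l = p" using l by (auto simp: S_def)
        then have "poly a (\<xi> l) = 0" using l p_pos by (auto simp: a_def)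
        then show ?thesis by simp
      qed
    qed
  qed (use assms in auto)
  also have "\<dots> = \<omega> k * poly (a * b ^ 2) (\<xi> k)" by simp
  finally have eq: "pint (a * b ^ 2) = \<omega> k * poly (a * b ^ 2) (\<xi> k)" .
  have nonneg: "poly (a * b ^ 2) x \<ge> 0" if "x \<in> {-1..1}" for x
  proof -
    have "x * x \<le> 1" using that abs_square_le_1[of x] by (simp add: abs_le_iff power2_eq_square)
    then have "poly a x \<ge> 0" using that by (auto simp: a_def)
    then show ?thesis by simp
  qed
  have "pint (a * b ^ 2) > 0" using a0 b0 by (intro pint_pos nonneg) auto
  moreover have "poly (a * b ^ 2) (\<xi> k) \<ge> 0" by (rule nonneg) (rule node_bounds[OF assms])
  ultimately show ?thesis unfolding eq by (simp add: zero_less_mult_iff)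
qed

text \<open>A Lagrange polynomial times the derivative of another has degree at most 2p - 1, so
  \<open>Qmat\<close> is an exact integral and the identity is integration by parts.\<close>

theorem summation_by_parts:
  assumes "i \<le> p" "k \<le> p"
  shows "Qmat p \<xi> i k + Qmat p \<xi> k i
    = (if i = p \<and> k = p then 1 else 0) - (if i = 0 \<and> k = 0 then 1 else 0)"
proof -
  have Q: "Qmat p \<xi> i k = pint (lag i * pderiv (lag k))" if "i \<le> p" "k \<le> p" for i k
  proof -
    have "degree (lag i * pderiv (lag k)) \<le> 2 * p - 1"
      using degree_mult_le[of "lag i" "pderiv (lag k)"] degree_lag[OF that(1)] degree_lag[OF that(2)] p_pos
      by (simp add: degree_pderiv)
    then have "pint (lag i * pderiv (lag k)) = (\<Sum>l\<le>p. \<omega> l * poly (lag i * pderiv (lag k)) (\<xi> l))"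
      by (rule quadrature_exact)
    also have "\<dots> = (\<Sum>l\<le>p. if l = i then \<omega> i * poly (pderiv (lag k)) (\<xi> i) else 0)"
      by (intro sum.cong) (auto simp: lag_node that)
    also have "\<dots> = Qmat p \<xi> i k" using that by (simp add: Qmat_def Dmat_def)
    finally show ?thesis by simp
  qed
  have "Qmat p \<xi> i k + Qmat p \<xi> k i = poly (lag k) 1 * poly (lag i) 1 - poly (lag k) (-1) * poly (lag i) (-1)"
    using pint_by_parts[of "lag k" "lag i"] assms by (simp add: Q mult.commute)
  \<comment> \<open>The endpoints are written as nodes again, so that the cardinal property of the
    Lagrange polynomials evaluates them.\<close>
  also have "\<dots> = poly (lag k) (\<xi> p) * poly (lag i) (\<xi> p) - poly (lag k) (\<xi> 0) * poly (lag i) (\<xi> 0)"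
    by simp
  also have "\<dots> = (if i = p \<and> k = p then 1 else 0) - (if i = 0 \<and> k = 0 then 1 else 0)"
    using assms by (auto simp: lag_node simp del: node_0 node_p)
  finally show ?thesis .
qed

text \<open>By definition the interior nodes are zeros of P_p'; the factorization adds that there
  are no further ones. The node set thus inherits the symmetry of the zeros about 0.\<close>

lemma node_set: "\<xi> ` {..p} = {x. poly (bump * pderiv (legendre p)) x = 0}"
proof -
  obtain c where c: "c \<noteq> 0" "bump * pderiv (legendre p) = smult c (\<Prod>i\<le>p. [:- \<xi> i, 1:])"
    by (rule nodal_polynomial)
  show ?thesis unfolding c(2) using c(1) by (auto simp: poly_prod image_iff)
qed

lemma node_reflect_mem:
  assumes "i \<le> p" shows "- \<xi> i \<in> \<xi> ` {..p}"
proof -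
  have "\<xi> i \<in> \<xi> ` {..p}" using assms by auto
  then show ?thesis unfolding node_set
    by (auto simp: legendre_deriv_reflect simp del: mult_pCons_left)
qed

lemma node_symmetric:
  assumes "i \<le> p" shows "\<xi> (p - i) = - \<xi> i"
proof -
  \<comment> \<open>Both sides enumerate the node set in increasing order.\<close>
  have *: "map \<xi> [0..<Suc p] = map (\<lambda>i. - \<xi> (p - i)) [0..<Suc p]"
  proof (rule sorted_distinct_set_unique)
    show "sorted (map \<xi> [0..<Suc p])"
      unfolding sorted_iff_nth_mono_less by (auto simp: less_Suc_eq_le intro!: node_mono[THEN less_imp_le] simp del: upt_Suc)
    show "sorted (map (\<lambda>i. - \<xi> (p - i)) [0..<Suc p])"
      unfolding sorted_iff_nth_mono_less
      by (auto simp: less_Suc_eq_le intro!: node_mono[THEN less_imp_le] simp del: upt_Suc)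
    show "distinct (map \<xi> [0..<Suc p])"
      unfolding distinct_map using node_inj by (auto simp: inj_on_def less_Suc_eq_le node_eq_iff simp del: upt_Suc)
    show "distinct (map (\<lambda>i. - \<xi> (p - i)) [0..<Suc p])"
      unfolding distinct_map by (auto simp: inj_on_def less_Suc_eq_le node_eq_iff simp del: upt_Suc)
    have eq: "(\<lambda>i. - \<xi> (p - i)) ` {..p} = uminus ` \<xi> ` {..p}"
      by (auto simp: image_iff) (metis diff_diff_cancel diff_le_self atMost_iff)+
    have "uminus ` \<xi> ` {..p} = \<xi> ` {..p}"
    proof (rule card_subset_eq)
      show "uminus ` \<xi> ` {..p} \<subseteq> \<xi> ` {..p}" using node_reflect_mem by auto
      show "card (uminus ` \<xi> ` {..p}) = card (\<xi> ` {..p})" by (rule card_image) auto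
    qed simp
    then show "set (map \<xi> [0..<Suc p]) = set (map (\<lambda>i. - \<xi> (p - i)) [0..<Suc p])"
      using eq by (simp add: atLeast0LessThan lessThan_Suc_atMost del: upt_Suc)
  qed
  have "map \<xi> [0..<Suc p] ! i = map (\<lambda>i. - \<xi> (p - i)) [0..<Suc p] ! i" by (simp only: *)
  then show ?thesis using assms by (simp add: less_Suc_eq_le del: upt_Suc)
qed

text \<open>Reflection permutes the nodes, hence the cardinal polynomials, and preserves the
  integral. This matters because two neighbours may traverse their common edge in opposite
  directions.\<close>

lemma weight_symmetric:
  assumes "k \<le> p" shows "\<omega> (p - k) = \<omega> k"
proof -
  have "lag (p - k) = pcompose (lag k) [:0, -1:]"
  proof (rule poly_eqI_degree[where A = "\<xi> ` {..p}"])
    show "degree (lag (p - k)) < card (\<xi> ` {..p})"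
      "degree (pcompose (lag k) [:0, -1:]) < card (\<xi> ` {..p})"
      using degree_lag[of "p - k"] degree_lag[OF assms] degree_pcompose[of "lag k" "[:0, -1:]"]
      by (simp_all add: card_image node_inj del: degree_pcompose)
    fix x assume "x \<in> \<xi> ` {..p}"
    then obtain l where l: "l \<le> p" "x = \<xi> l" by auto
    have "poly (pcompose (lag k) [:0, -1:]) x = poly (lag k) (\<xi> (p - l))"
      using l by (simp add: poly_pcompose node_symmetric)
    then show "poly (lag (p - k)) x = poly (pcompose (lag k) [:0, -1:]) x"
      using l assms by (auto simp: lag_node)
  qed
  then have "\<omega> (p - k) = integral {-1..1} (\<lambda>x. poly (lag k) (- x))"
    by (simp add: quad_weight_def poly_pcompose[abs_def])
  also have "\<dots> = \<omega> k" unfolding quad_weight_def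
    using Henstock_Kurzweil_Integration.integral_reflect_real[of 1 "-1" "poly (lag k)"] by simp
  finally show ?thesis .
qed

end

section \<open>Two-point fluxes\<close>

lemma C1_section:
  assumes "C1 F" shows "isCont (\<lambda>b. F (a, b)) b"
proof -
  from assms obtain F' where F: "\<And>z. (F has_derivative blinfun_apply (F' z)) (at z)"
    unfolding C1_def by auto
  have "isCont F (a, b)" using F has_derivative_continuous by blast
  moreover have "isCont (\<lambda>b. (a, b)) b" by (intro continuous_intros)
  ultimately show ?thesis by (rule isCont_o2[rotated])
qed

lemma C1_diagonal:
  assumes "C1 F"
  obtains D where "\<And>u. ((\<lambda>u. F (u, u)) has_real_derivative D u) (at u)" "continuous_on UNIV D"
proof -
  from assms obtain F' where F: "\<And>z. (F has_derivative blinfun_apply (F' z)) (at z)"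
    and c: "continuous_on UNIV F'"
    unfolding C1_def by auto
  have "((\<lambda>u. F (u, u)) has_real_derivative blinfun_apply (F' (u, u)) (1, 1)) (at u)" for u
  proof -
    have d: "((\<lambda>u. F (u, u)) has_derivative (\<lambda>h. blinfun_apply (F' (u, u)) (h, h))) (at u)"
      by (rule has_derivative_compose[of "\<lambda>u. (u, u)" "\<lambda>h. (h, h)" u UNIV F, OF _ F])
        (auto intro!: derivative_eq_intros)
    have eq: "(\<lambda>h. blinfun_apply (F' (u, u)) (h, h)) = (*) (blinfun_apply (F' (u, u)) (1, 1))"
    proof
      fix h :: real
      have "(h, h) = h *\<^sub>R (1, 1)" by simp
      then show "blinfun_apply (F' (u, u)) (h, h) = blinfun_apply (F' (u, u)) (1, 1) * h"
        by (simp only: blinfun.scaleR_right real_scaleR_def mult.commute)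
    qed
    show ?thesis unfolding has_field_derivative_def by (rule has_derivative_eq_rhs[OF d eq])
  qed
  moreover have "continuous_on UNIV (\<lambda>u. blinfun_apply (F' (u, u)) (1, 1))"
    by (intro continuous_intros continuous_on_compose2[OF c]) auto
  ultimately show ?thesis by (rule that)
qed

section \<open>Regularity of the entropy data and the Lipschitz bound of the cell flux\<close>

locale entropy_fluxes =
  fixes f g :: "real \<Rightarrow> pt" and \<theta> :: "real \<Rightarrow> real" and hec :: "real \<Rightarrow> real \<Rightarrow> pt \<Rightarrow> real"
    and m M :: real
  assumes entropy: "entropy_pair f \<theta> g"
    and convex: "\<And>u. deriv (deriv \<theta>) u > 0"
    and cell_flux: "entropy_conservative_flux f \<theta> g hec"
begin

abbreviation "v \<equiv> deriv \<theta>"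
abbreviation "v' \<equiv> deriv (deriv \<theta>)"
abbreviation "\<psi> \<equiv> entropy_potential f \<theta> g"
abbreviation "f' u \<equiv> vector_derivative f (at u)"
abbreviation "Lf \<equiv> flux_lipschitz f m M"
abbreviation "Lu \<equiv> entropy_ratio \<theta> m M"

lemma hec_diag: "hec u u n = f u \<bullet> n"
  and hec_sym: "hec a b n = hec b a n"
  and hec_entropy: "(v b - v a) * hec a b n = (\<psi> b - \<psi> a) \<bullet> n"
  and hec_C1: "C1 (\<lambda>(a, b). hec a b n)"
  using cell_flux unfolding entropy_conservative_flux_def by blast+

lemma hec_isCont: "isCont (\<lambda>b. hec a b n) b"
  using C1_section[OF hec_C1[of n], where a = a and b = b] by simp

lemma v_deriv: "(v has_real_derivative v' u) (at u)"
  using entropy by (auto simp: entropy_pair_def DERIV_deriv_iff_real_differentiable)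

lemma v'_continuous: "continuous_on UNIV v'"
  using entropy by (auto simp: entropy_pair_def)

lemma v_less: "a < b \<Longrightarrow> v a < v b"
  using DERIV_pos_imp_increasing[of a b v] v_deriv convex by blast

lemma v_eq_iff: "v a = v b \<longleftrightarrow> a = b"
  using v_less by (metis linorder_neqE_linordered_idom order_less_irrefl)

text \<open>By consistency the components of \<open>f\<close> are diagonals of the C1 function
  \<open>hec\<close>. So \<open>f\<close> is continuously differentiable everywhere, whereas local
  Lipschitz continuity yields derivatives only almost everywhere.\<close>

lemma flux_component_deriv:
  obtains D where "\<And>u. ((\<lambda>u. f u \<bullet> n) has_real_derivative D u) (at u)" "continuous_on UNIV D"
proof -
  obtain D where "\<And>u. ((\<lambda>u. case (u, u) of (a, b) \<Rightarrow> hec a b n) has_real_derivative D u) (at u)"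
    "continuous_on UNIV D"
    using C1_diagonal[OF hec_C1[of n]] by blast
  then show ?thesis by (intro that[of D]) (simp_all add: hec_diag)
qed

lemma flux_deriv: "(f has_vector_derivative f' u) (at u)"
proof -
  have "(\<lambda>u. f u \<bullet> n) differentiable (at u)" for n
    using flux_component_deriv[of n] by (metis real_differentiable_def)
  then have "f differentiable (at u)"
    by (subst differentiable_componentwise_within) blast
  then show ?thesis by (simp add: vector_derivative_works)
qed

lemma flux_inner_deriv: "((\<lambda>u. f u \<bullet> n) has_real_derivative f' u \<bullet> n) (at u)"
proof -
  have "((\<lambda>u. f u \<bullet> n) has_vector_derivative f' u \<bullet> n) (at u)"
    by (rule bounded_linear.has_vector_derivative[OF bounded_linear_inner_left flux_deriv])
  then show ?thesis by (simp add: has_real_derivative_iff_has_vector_derivative)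
qed

lemma flux_deriv_inner_continuous: "continuous_on UNIV (\<lambda>u. f' u \<bullet> n)"
proof -
  obtain D where D: "\<And>u. ((\<lambda>u. f u \<bullet> n) has_real_derivative D u) (at u)" "continuous_on UNIV D"
    using flux_component_deriv[of n] by blast
  have "f' u \<bullet> n = D u" for u using DERIV_unique[OF flux_inner_deriv D(1)] .
  then show ?thesis using D(2) by simp
qed

lemma flux_deriv_continuous: "continuous_on UNIV (\<lambda>u. f' u)"
  by (subst continuous_on_componentwise) (use flux_deriv_inner_continuous in blast)

lemma v_continuous: "continuous_on S v"
  using v_deriv by (meson DERIV_isCont continuous_at_imp_continuous_on)

lemma entropy_flux_deriv: "((\<lambda>u. g u \<bullet> n) has_real_derivative v u * (f' u \<bullet> n)) (at u)"
proof -
  define G where "G w = v w * (f' w \<bullet> n)" for w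
  have G_cont: "continuous_on S G" for S
    unfolding G_def
    by (intro continuous_intros v_continuous continuous_on_subset[OF flux_deriv_inner_continuous]) auto
  \<comment> \<open>Starting the integral at u - 1 puts u into the interior of the interval, where
    the derivative within the interval is a two-sided one.\<close>
  have int: "integral {u - 1..x} G = g x \<bullet> n - g (u - 1) \<bullet> n" if "u - 1 \<le> x" for x
  proof -
    have "((\<lambda>w. v w *\<^sub>R f' w) has_integral (g x - g (u - 1))) {u - 1..x}"
      using entropy that unfolding entropy_pair_def by blast
    then have "((\<lambda>w. (v w *\<^sub>R f' w) \<bullet> n) has_integral ((g x - g (u - 1)) \<bullet> n)) {u - 1..x}"
      using has_integral_linear[OF _ bounded_linear_inner_left, of _ "g x - g (u - 1)" "{u - 1..x}" n]
      unfolding comp_def by blast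
    then show ?thesis by (simp add: G_def[abs_def] integral_unique inner_diff_left)
  qed
  have "((\<lambda>x. integral {u - 1..x} G) has_real_derivative G u) (at u within {u - 1..u + 1})"
    by (rule integral_has_real_derivative) (use G_cont in auto)
  then have "((\<lambda>x. integral {u - 1..x} G) has_real_derivative G u) (at u)"
    by (subst (asm) at_within_interior) (auto simp: interior_atLeastAtMost_real)
  then have "((\<lambda>x. g x \<bullet> n - g (u - 1) \<bullet> n) has_real_derivative G u) (at u)"
    by (rule has_field_derivative_transform_within_open[of _ _ _ "{u - 1<..}"]) (use int in auto)
  then have "((\<lambda>x. (g x \<bullet> n - g (u - 1) \<bullet> n) + g (u - 1) \<bullet> n) has_real_derivative G u + 0) (at u)"
    by (intro DERIV_add) auto
  then show ?thesis by (simp add: G_def)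
qed

text \<open>The terms v f' cancel by the entropy relation, so the derivatives of
  \<open>\<psi>\<close> and \<open>v\<close> have the ratio \<open>f\<close>. This is why Cauchy's
  mean value theorem for these two functions returns a value of the flux.\<close>

lemma potential_deriv: "((\<lambda>u. \<psi> u \<bullet> n) has_real_derivative v' u * (f u \<bullet> n)) (at u)"
proof -
  have "((\<lambda>u. v u * (f u \<bullet> n) - g u \<bullet> n) has_real_derivative
      (v' u * (f u \<bullet> n) + (f' u \<bullet> n) * v u) - v u * (f' u \<bullet> n)) (at u)"
    using DERIV_diff[OF DERIV_mult[OF v_deriv[of u] flux_inner_deriv[where u = u and n = n]]
        entropy_flux_deriv[where u = u and n = n]] .
  moreover have "(\<lambda>u. \<psi> u \<bullet> n) = (\<lambda>u. v u * (f u \<bullet> n) - g u \<bullet> n)"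
    by (simp add: entropy_potential_def inner_diff_left fun_eq_iff)
  ultimately show ?thesis by simp
qed

lemma hec_eq_quotient: "a \<noteq> b \<Longrightarrow> hec a b n = ((\<psi> b - \<psi> a) \<bullet> n) / (v b - v a)"
  using v_eq_iff[of a b]
  by (subst nonzero_eq_divide_eq) (auto simp: hec_entropy mult.commute[of "hec a b n"])

lemma hec_intermediate:
  assumes "a < b"
  obtains c where "a < c" "c < b" "hec a b n = f c \<bullet> n"
proof -
  have "\<exists>c. a < c \<and> c < b \<and> (\<psi> b \<bullet> n - \<psi> a \<bullet> n) * v' c = (v b - v a) * (v' c * (f c \<bullet> n))"
    by (rule GMVT'[OF assms]; rule DERIV_isCont[OF potential_deriv] DERIV_isCont[OF v_deriv] v_deriv potential_deriv)
  then obtain c where c: "a < c" "c < b" "(\<psi> b \<bullet> n - \<psi> a \<bullet> n) * v' c = (v b - v a) * (v' c * (f c \<bullet> n))"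
    by blast
  have "v' c * (\<psi> b \<bullet> n - \<psi> a \<bullet> n) = v' c * ((v b - v a) * (f c \<bullet> n))"
    unfolding mult.commute[of "v' c" "\<psi> b \<bullet> n - \<psi> a \<bullet> n"] c(3) by (rule mult.left_commute)
  then have "\<psi> b \<bullet> n - \<psi> a \<bullet> n = (v b - v a) * (f c \<bullet> n)"
    using convex[of c] by (simp only: mult_cancel_left) auto
  then have "hec a b n = f c \<bullet> n"
    unfolding hec_eq_quotient[OF less_imp_neq[OF assms]] inner_diff_left
    using v_less[OF assms] by simp
  with c show ?thesis by (intro that)
qed

text \<open>Off the diagonal the flux is the divided difference of \<open>\<psi>\<close> over
  \<open>v\<close>, and the numerator of the quotient rule collapses to the deviation of f(b) . n
  from the flux itself. That deviation is of order b - a and compensates the small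
  denominator.\<close>

lemma hec_deriv:
  assumes "a \<noteq> b"
  shows "((\<lambda>b. hec a b n) has_real_derivative v' b * (f b \<bullet> n - hec a b n) / (v b - v a)) (at b)"
proof -
  have nz: "v b - v a \<noteq> 0" using assms v_eq_iff by auto
  have "((\<lambda>b. (\<psi> b \<bullet> n - \<psi> a \<bullet> n) / (v b - v a)) has_real_derivative
      (v' b * (f b \<bullet> n) * (v b - v a) - (\<psi> b \<bullet> n - \<psi> a \<bullet> n) * v' b) / ((v b - v a) * (v b - v a))) (at b)"
    by (rule DERIV_divide[OF DERIV_cong[OF DERIV_diff[OF potential_deriv DERIV_const]]
          DERIV_cong[OF DERIV_diff[OF v_deriv DERIV_const]] nz]) simp_all
  moreover have "(v' b * (f b \<bullet> n) * (v b - v a) - (\<psi> b \<bullet> n - \<psi> a \<bullet> n) * v' b) / ((v b - v a) * (v b - v a))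
      = v' b * (f b \<bullet> n - hec a b n) / (v b - v a)"
    using nz assms by (simp add: hec_eq_quotient inner_diff_left field_simps)
  ultimately have *: "((\<lambda>b. (\<psi> b \<bullet> n - \<psi> a \<bullet> n) / (v b - v a)) has_real_derivative
      v' b * (f b \<bullet> n - hec a b n) / (v b - v a)) (at b)" by simp
  show ?thesis
  proof (rule has_field_derivative_transform_within_open[OF *])
    show "(\<psi> x \<bullet> n - \<psi> a \<bullet> n) / (v x - v a) = hec a x n" if "x \<in> - {a}" for x
      using hec_eq_quotient[of a x n] that by (simp only: inner_diff_left) auto
  qed (use assms in auto)
qed

text \<open>A real \<open>Sup\<close> says something only about sets bounded above; the bound here
  is that of |f'| on the compact interval, via the mean value theorem.\<close>

lemma flux_lipschitz_bdd:
  "bdd_above {\<bar>(f a - f b) \<bullet> n\<bar> / \<bar>a - b\<bar> | a b n. a \<in> {m..M} \<and> b \<in> {m..M} \<and> a \<noteq> b \<and> n \<in> sphere 0 1}"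
proof -
  have "compact ((\<lambda>u. f' u) ` {m..M})"
    by (intro compact_continuous_image continuous_on_subset[OF flux_deriv_continuous]) auto
  then obtain B where B: "\<And>u. u \<in> {m..M} \<Longrightarrow> norm (f' u) \<le> B"
    by (meson bounded_iff compact_imp_bounded imageI)
  have *: "\<bar>(f a - f b) \<bullet> n\<bar> / \<bar>a - b\<bar> \<le> B" if "a \<in> {m..M}" "b \<in> {m..M}" "a < b" "norm n = 1"
    for a b and n :: pt
  proof -
    obtain z where z: "a < z" "z < b" "f b \<bullet> n - f a \<bullet> n = (b - a) * (f' z \<bullet> n)"
      using MVT2[OF \<open>a < b\<close>, of "\<lambda>u. f u \<bullet> n" "\<lambda>u. f' u \<bullet> n"] flux_inner_deriv by blast
    have "\<bar>f' z \<bullet> n\<bar> \<le> B"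
      using Cauchy_Schwarz_ineq2[of "f' z" n] B[of z] z that by auto
    moreover have "(f a - f b) \<bullet> n = - ((b - a) * (f' z \<bullet> n))"
      using z(3) by (simp add: inner_diff_left)
    ultimately show ?thesis using that by (simp add: abs_mult)
  qed
  have "\<bar>(f a - f b) \<bullet> n\<bar> / \<bar>a - b\<bar> \<le> B" if "a \<in> {m..M}" "b \<in> {m..M}" "a \<noteq> b" "norm n = 1"
    for a b and n :: pt
  proof (cases "a < b")
    case False
    then show ?thesis using *[of b a n] that by (simp add: abs_minus_commute inner_diff_left)
  qed (use * that in blast)
  then show ?thesis by (auto intro!: bdd_aboveI)
qed

lemma Lf_nonneg: "Lf \<ge> 0"
  unfolding flux_lipschitz_def by (rule cSup_upper) (use flux_lipschitz_bdd in auto)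

lemma flux_lipschitz_bound:
  assumes "a \<in> {m..M}" "b \<in> {m..M}"
  shows "\<bar>(f a - f b) \<bullet> n\<bar> \<le> Lf * norm n * \<bar>a - b\<bar>"
proof (cases "a = b \<or> n = 0")
  case False
  let ?n = "n /\<^sub>R norm n"
  have "\<bar>(f a - f b) \<bullet> ?n\<bar> / \<bar>a - b\<bar> \<le> Lf"
    unfolding flux_lipschitz_def
  proof (rule cSup_upper)
    show "\<bar>(f a - f b) \<bullet> ?n\<bar> / \<bar>a - b\<bar> \<in> insert 0 {\<bar>(f a - f b) \<bullet> n\<bar> / \<bar>a - b\<bar> | a b n.
       a \<in> {m..M} \<and> b \<in> {m..M} \<and> a \<noteq> b \<and> n \<in> sphere 0 1}"
      using False assms by (intro insertI2 CollectI exI[of _ a] exI[of _ b] exI[of _ ?n]) auto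
  qed (use flux_lipschitz_bdd in auto)
  moreover have "\<bar>(f a - f b) \<bullet> ?n\<bar> = \<bar>(f a - f b) \<bullet> n\<bar> / norm n"
    by (simp add: abs_mult divide_inverse mult.commute)
  ultimately show ?thesis using False by (simp add: divide_le_eq mult_ac)
qed auto

text \<open>The mean value theorem turns the quotient into \<open>v' a / v' c\<close>, and the
  continuous positive function \<open>v'\<close> has a maximum and a positive minimum on the
  interval.\<close>

lemma entropy_ratio_bdd:
  "bdd_above {v' a * (a - b) / (v a - v b) | a b. a \<in> {m..M} \<and> b \<in> {m..M} \<and> a \<noteq> b}"
proof (cases "m \<le> M")
  case True
  have cont: "continuous_on {m..M} v'" using v'_continuous by (rule continuous_on_subset) auto
  obtain u where u: "u \<in> {m..M}" "\<And>w. w \<in> {m..M} \<Longrightarrow> v' u \<le> v' w"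
    using continuous_attains_inf[OF _ _ cont] True by auto
  obtain s where s: "s \<in> {m..M}" "\<And>w. w \<in> {m..M} \<Longrightarrow> v' w \<le> v' s"
    using continuous_attains_sup[OF _ _ cont] True by auto
  have "v' a * (a - b) / (v a - v b) \<le> v' s / v' u" if "a \<in> {m..M}" "b \<in> {m..M}" "a \<noteq> b" for a b
  proof -
    have "\<exists>c\<in>{m..M}. v a - v b = (a - b) * v' c"
    proof (cases "a < b")
      case True
      then obtain z where "a < z" "z < b" "v b - v a = (b - a) * v' z"
        using MVT2[OF True, of v v'] v_deriv by blast
      then show ?thesis using that by (intro bexI[of _ z]) (auto simp: algebra_simps)
    next
      case False
      then have "b < a" using that by auto
      then obtain z where "b < z" "z < a" "v a - v b = (a - b) * v' z"
        using MVT2[of b a v v'] v_deriv by blast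
      then show ?thesis using that by (intro bexI[of _ z]) auto
    qed
    then obtain c where c: "c \<in> {m..M}" "v a - v b = (a - b) * v' c" by blast
    have "v' a * (a - b) / (v a - v b) = v' a / v' c" using c(2) that(3) convex[of c] by simp
    also have "\<dots> \<le> v' s / v' u"
      using u s c that convex[of u] convex[of s] by (intro frac_le) (auto intro: less_imp_le[OF convex])
    finally show ?thesis .
  qed
  then show ?thesis by (auto intro!: bdd_aboveI)
qed auto

lemma Lu_nonneg: "Lu \<ge> 0"
  unfolding entropy_ratio_def by (rule cSup_upper) (use entropy_ratio_bdd in auto)

lemma entropy_ratio_bound:
  assumes "a \<in> {m..M}" "b \<in> {m..M}" "a \<noteq> b"
  shows "v' a * \<bar>a - b\<bar> / \<bar>v a - v b\<bar> \<le> Lu"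
proof -
  have "v' a * (a - b) / (v a - v b) \<le> Lu"
    unfolding entropy_ratio_def
  proof (rule cSup_upper)
    show "v' a * (a - b) / (v a - v b) \<in> insert 0 {v' a * (a - b) / (v a - v b) | a b.
       a \<in> {m..M} \<and> b \<in> {m..M} \<and> a \<noteq> b}"
      using assms by (intro insertI2 CollectI exI[of _ a] exI[of _ b]) auto
  qed (use entropy_ratio_bdd in auto)
  moreover have "\<bar>a - b\<bar> / \<bar>v a - v b\<bar> = (a - b) / (v a - v b)"
  proof (cases "a < b")
    case True
    then show ?thesis using v_less[OF True] by (simp add: field_simps)
  next
    case False
    then have "b < a" using assms by auto
    then show ?thesis using v_less[of b a] by simp
  qed
  ultimately show ?thesis by (metis times_divide_eq_right)
qed

text \<open>The state \<open>c\<close> whose flux equals the two-point flux lies between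
  \<open>a\<close> and \<open>b\<close>, so the deviation is at most \<open>Lf * norm n\<close>
  times |b - a|. What remains is the quotient bounded by \<open>Lu\<close>. This is the origin of
  both constants in the viscosity condition.\<close>

lemma hec_deriv_bound:
  assumes "a \<in> {m..M}" "b \<in> {m..M}" "a \<noteq> b"
  shows "\<bar>v' b * (f b \<bullet> n - hec a b n) / (v b - v a)\<bar> \<le> Lf * Lu * norm n"
proof -
  obtain c where c: "c \<in> {m..M}" "\<bar>b - c\<bar> \<le> \<bar>b - a\<bar>" "hec a b n = f c \<bullet> n"
  proof (cases "a < b")
    case True
    then obtain c where "a < c" "c < b" "hec a b n = f c \<bullet> n" by (rule hec_intermediate)
    then show ?thesis using assms by (intro that[of c]) auto
  next
    case False
    then have "b < a" using assms by auto
    then obtain c where "b < c" "c < a" "hec b a n = f c \<bullet> n" by (rule hec_intermediate)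
    then show ?thesis using assms by (intro that[of c]) (auto simp: hec_sym[of a b])
  qed
  have "\<bar>f b \<bullet> n - hec a b n\<bar> \<le> Lf * norm n * \<bar>b - c\<bar>"
    using flux_lipschitz_bound[OF assms(2) c(1), of n] c(3) by (simp add: inner_diff_left)
  also have "\<dots> \<le> Lf * norm n * \<bar>b - a\<bar>"
    using c(2) Lf_nonneg by (intro mult_left_mono) auto
  finally have 1: "\<bar>f b \<bullet> n - hec a b n\<bar> \<le> Lf * norm n * \<bar>b - a\<bar>" .
  have "\<bar>v' b * (f b \<bullet> n - hec a b n) / (v b - v a)\<bar>
      = v' b / \<bar>v b - v a\<bar> * \<bar>f b \<bullet> n - hec a b n\<bar>"
    using convex[of b] by (simp add: abs_mult)
  also have "\<dots> \<le> v' b / \<bar>v b - v a\<bar> * (Lf * norm n * \<bar>b - a\<bar>)"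
    using 1 convex[of b] by (intro mult_left_mono) auto
  also have "\<dots> = Lf * norm n * (v' b * \<bar>b - a\<bar> / \<bar>v b - v a\<bar>)" by simp
  also have "\<dots> \<le> Lf * norm n * Lu"
    using entropy_ratio_bound[of b a] assms Lf_nonneg by (intro mult_left_mono) auto
  finally show ?thesis by (simp add: mult_ac)
qed

text \<open>The derivative formula breaks down where the moving state meets \<open>a\<close>, so
  \<open>a\<close> is kept out of the interior of the interval; at an endpoint continuity is enough
  for the mean value theorem.\<close>

lemma hec_lipschitz_aux:
  assumes "a \<in> {m..M}" "b \<in> {m..M}" "b' \<in> {m..M}" "b < b'" "a \<le> b \<or> b' \<le> a"
  shows "\<bar>hec a b' n - hec a b n\<bar> \<le> Lf * Lu * norm n * (b' - b)"
proof -
  have "\<exists>l z. b < z \<and> z < b' \<and> ((\<lambda>b. hec a b n) has_real_derivative l) (at z) \<and>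
      hec a b' n - hec a b n = (b' - b) * l"
  proof (rule MVT[OF assms(4)])
    show "continuous_on {b..b'} (\<lambda>b. hec a b n)"
      using hec_isCont by (intro continuous_at_imp_continuous_on) auto
    show "(\<lambda>b. hec a b n) differentiable (at x)" if "b < x" "x < b'" for x
      using hec_deriv[of a x n] assms(5) that by (auto simp: real_differentiable_def)
  qed
  then obtain l z where z: "b < z" "z < b'" "((\<lambda>b. hec a b n) has_real_derivative l) (at z)"
    and eq: "hec a b' n - hec a b n = (b' - b) * l" by blast
  have za: "a \<noteq> z" using z assms(5) by auto
  have "\<bar>l\<bar> \<le> Lf * Lu * norm n"
    using DERIV_unique[OF z(3) hec_deriv[OF za]] hec_deriv_bound[of a z n] za z assms by auto
  then show ?thesis unfolding eq using assms(4) by (simp add: abs_mult)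
qed

text \<open>If \<open>a\<close> lies strictly between the two states, the intervals on its two sides
  are estimated separately and their lengths add up.\<close>

lemma hec_lipschitz:
  assumes "a \<in> {m..M}" "b \<in> {m..M}" "b' \<in> {m..M}"
  shows "\<bar>hec a b' n - hec a b n\<bar> \<le> Lf * Lu * norm n * \<bar>b' - b\<bar>"
proof -
  have *: "\<bar>hec a b' n - hec a b n\<bar> \<le> Lf * Lu * norm n * (b' - b)"
    if "b \<in> {m..M}" "b' \<in> {m..M}" "b < b'" for b b'
  proof (cases "a \<le> b \<or> b' \<le> a")
    case False
    have "\<bar>hec a b' n - hec a a n\<bar> \<le> Lf * Lu * norm n * (b' - a)"
      "\<bar>hec a a n - hec a b n\<bar> \<le> Lf * Lu * norm n * (a - b)"
      using False that assms by (intro hec_lipschitz_aux; auto)+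
    then show ?thesis by (simp add: algebra_simps)
  qed (use hec_lipschitz_aux that assms in blast)
  consider "b < b'" | "b' < b" | "b = b'" by linarith
  then show ?thesis
  proof cases
    case 2
    then show ?thesis using *[of b' b] assms by (simp add: abs_minus_commute)
  qed (use *[of b b'] assms in auto)
qed

end

section \<open>Consistency, conservation, monotonicity and Lipschitz bounds of the interface
  flux\<close>

lemma interface_fluxD:
  assumes "interface_flux f m M h"
  shows "norm n = 1 \<Longrightarrow> u \<in> {m..M} \<Longrightarrow> h u u n = f u \<bullet> n"
    and "norm n = 1 \<Longrightarrow> a \<in> {m..M} \<Longrightarrow> b \<in> {m..M} \<Longrightarrow> h a b n = - h b a (- n)"
    and "norm n = 1 \<Longrightarrow> w \<in> {m..M} \<Longrightarrow> a \<in> {m..M} \<Longrightarrow> b \<in> {m..M} \<Longrightarrow> a \<le> b \<Longrightarrow> h a w n \<le> h b w n"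
    and "norm n = 1 \<Longrightarrow> w \<in> {m..M} \<Longrightarrow> a \<in> {m..M} \<Longrightarrow> b \<in> {m..M} \<Longrightarrow> a \<le> b \<Longrightarrow> h w b n \<le> h w a n"
proof -
  have A: "\<forall>n\<in>sphere 0 1. \<forall>u\<in>{m..M}. h u u n = f u \<bullet> n"
    "\<forall>n\<in>sphere 0 1. \<forall>a\<in>{m..M}. \<forall>b\<in>{m..M}. h a b n = - h b a (- n)"
    "\<forall>n\<in>sphere 0 1. \<forall>w\<in>{m..M}. mono_on {m..M} (\<lambda>u. h u w n) \<and> antimono_on {m..M} (\<lambda>u. h w u n)"
    using assms unfolding interface_flux_def by argo+
  show "norm n = 1 \<Longrightarrow> u \<in> {m..M} \<Longrightarrow> h u u n = f u \<bullet> n"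
    using A(1) unfolding mem_sphere_0 Ball_def by blast
  show "norm n = 1 \<Longrightarrow> a \<in> {m..M} \<Longrightarrow> b \<in> {m..M} \<Longrightarrow> h a b n = - h b a (- n)"
    using A(2) unfolding mem_sphere_0 Ball_def by blast
  show "norm n = 1 \<Longrightarrow> w \<in> {m..M} \<Longrightarrow> a \<in> {m..M} \<Longrightarrow> b \<in> {m..M} \<Longrightarrow> a \<le> b \<Longrightarrow> h a w n \<le> h b w n"
    "norm n = 1 \<Longrightarrow> w \<in> {m..M} \<Longrightarrow> a \<in> {m..M} \<Longrightarrow> b \<in> {m..M} \<Longrightarrow> a \<le> b \<Longrightarrow> h w b n \<le> h w a n"
    using A(3)[unfolded mem_sphere_0 Ball_def, rule_format, of n w] unfolding monotone_on_def by auto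
qed

lemma interface_flux_lipschitz:
  assumes "interface_flux f m M h"
  obtains L where "L \<ge> 0"
    "\<And>n w a b. norm n = 1 \<Longrightarrow> w \<in> {m..M} \<Longrightarrow> a \<in> {m..M} \<Longrightarrow> b \<in> {m..M} \<Longrightarrow>
        \<bar>h a w n - h b w n\<bar> \<le> L * \<bar>a - b\<bar>"
    "\<And>n w a b. norm n = 1 \<Longrightarrow> w \<in> {m..M} \<Longrightarrow> a \<in> {m..M} \<Longrightarrow> b \<in> {m..M} \<Longrightarrow>
        \<bar>h w a n - h w b n\<bar> \<le> L * \<bar>a - b\<bar>"
proof -
  from assms obtain L1 L2 where
    L: "\<And>n w. n \<in> sphere 0 1 \<Longrightarrow> w \<in> {m..M} \<Longrightarrow>
      L1-lipschitz_on {m..M} (\<lambda>u. h u w n) \<and> L2-lipschitz_on {m..M} (\<lambda>u. h w u n)"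
    unfolding interface_flux_def by metis
  \<comment> \<open>The maximum with 0 keeps the constant nonnegative also for empty
    \<open>{m..M}\<close>, where the Lipschitz conditions say nothing about the signs of
    \<open>L1\<close> and \<open>L2\<close>.\<close>
  have le: "L1 * \<bar>a - b\<bar> \<le> max 0 (max L1 L2) * \<bar>a - b\<bar>" "L2 * \<bar>a - b\<bar> \<le> max 0 (max L1 L2) * \<bar>a - b\<bar>"
    for a b :: real by (intro mult_right_mono; simp)+
  show ?thesis
  proof (rule that[of "max 0 (max L1 L2)"])
    fix n w a b assume *: "norm (n :: pt) = 1" "w \<in> {m..M}" "a \<in> {m..M}" "b \<in> {m..M}"
    have "L1-lipschitz_on {m..M} (\<lambda>u. h u w n)" "L2-lipschitz_on {m..M} (\<lambda>u. h w u n)"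
      using L[of n w] * by auto
    from lipschitz_onD[OF this(1) *(3,4)] lipschitz_onD[OF this(2) *(3,4)]
    have "\<bar>h a w n - h b w n\<bar> \<le> L1 * \<bar>a - b\<bar>" "\<bar>h w a n - h w b n\<bar> \<le> L2 * \<bar>a - b\<bar>"
      by (simp_all add: dist_real_def)
    then show "\<bar>h a w n - h b w n\<bar> \<le> max 0 (max L1 L2) * \<bar>a - b\<bar>"
      "\<bar>h w a n - h w b n\<bar> \<le> max 0 (max L1 L2) * \<bar>a - b\<bar>"
      using le[of a b] by linarith+
  qed simp
qed

section \<open>Geometry of the mesh\<close>

lemma vector_2_eq_iff: "(x :: pt) = y \<longleftrightarrow> x $ 1 = y $ 1 \<and> x $ 2 = y $ 2"
  by (simp add: vec_eq_iff forall_2)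

lemma mem_ref_square: "z \<in> ref_square \<longleftrightarrow> \<bar>z $ 1\<bar> \<le> 1 \<and> \<bar>z $ 2\<bar> \<le> 1"
  by (auto simp: ref_square_def mem_box_cart forall_2 abs_le_iff)

lemma mem_interior_ref_square: "z \<in> interior ref_square \<longleftrightarrow> \<bar>z $ 1\<bar> < 1 \<and> \<bar>z $ 2\<bar> < 1"
  by (auto simp: ref_square_def interior_cbox mem_box_cart forall_2 abs_less_iff)

definition elem_dxi :: "dg_mesh \<Rightarrow> pt set \<Rightarrow> pt \<Rightarrow> pt" where
  "elem_dxi T \<kappa> z = (\<Sum>i\<le>deg T. \<Sum>j\<le>deg T.
     (poly (pderiv (ell T i)) (z $ 1) * poly (ell T j) (z $ 2)) *\<^sub>R geo_node T \<kappa> i j)"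

definition elem_dzeta :: "dg_mesh \<Rightarrow> pt set \<Rightarrow> pt \<Rightarrow> pt" where
  "elem_dzeta T \<kappa> z = (\<Sum>i\<le>deg T. \<Sum>j\<le>deg T.
     (poly (ell T i) (z $ 1) * poly (pderiv (ell T j)) (z $ 2)) *\<^sub>R geo_node T \<kappa> i j)"

definition elem_deriv :: "dg_mesh \<Rightarrow> pt set \<Rightarrow> pt \<Rightarrow> pt \<Rightarrow> pt" where
  "elem_deriv T \<kappa> z h = h $ 1 *\<^sub>R elem_dxi T \<kappa> z + h $ 2 *\<^sub>R elem_dzeta T \<kappa> z"

lemma poly_component_has_derivative:
  "((\<lambda>z :: pt. poly q (z $ i)) has_derivative (\<lambda>h. poly (pderiv q) (z $ i) * h $ i)) (at z)"
  by (rule has_derivative_compose[OF bounded_linear_imp_has_derivative[OF bounded_linear_vec_nth]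
        poly_DERIV[unfolded has_field_derivative_def]])

lemma elem_map_has_derivative: "(elem_map T \<kappa> has_derivative elem_deriv T \<kappa> z) (at z)"
proof -
  have d: "((\<lambda>z. \<Sum>i\<le>deg T. \<Sum>j\<le>deg T. (poly (ell T i) (z $ 1) * poly (ell T j) (z $ 2)) *\<^sub>R geo_node T \<kappa> i j)
     has_derivative (\<lambda>h. \<Sum>i\<le>deg T. \<Sum>j\<le>deg T. (poly (ell T i) (z $ 1) * (poly (pderiv (ell T j)) (z $ 2) * h $ 2) +
        poly (pderiv (ell T i)) (z $ 1) * h $ 1 * poly (ell T j) (z $ 2)) *\<^sub>R geo_node T \<kappa> i j)) (at z)"
    by (intro has_derivative_sum has_derivative_scaleR_left has_derivative_mult poly_component_has_derivative)
  show ?thesis unfolding elem_map_def[abs_def]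
    by (rule has_derivative_eq_rhs[OF d])
       (auto simp: elem_deriv_def elem_dxi_def elem_dzeta_def scaleR_sum_right scaleR_add_left
         sum.distrib mult_ac fun_eq_iff add.commute)
qed

lemma elem_map_continuous: "continuous_on S (elem_map T \<kappa>)"
  using elem_map_has_derivative
  by (meson continuous_at_imp_continuous_on has_derivative_continuous)

lemma frechet_elem_map: "frechet_derivative (elem_map T \<kappa>) (at z) = elem_deriv T \<kappa> z"
  using elem_map_has_derivative frechet_derivative_at by metis

lemma det_elem_deriv:
  "det (matrix (elem_deriv T \<kappa> z)) =
     elem_dxi T \<kappa> z $ 1 * elem_dzeta T \<kappa> z $ 2 - elem_dzeta T \<kappa> z $ 1 * elem_dxi T \<kappa> z $ 2"
  by (simp add: det_2 matrix_def elem_deriv_def axis_def)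

lemma jac_eq_det: "jac T \<kappa> i j = det (matrix (elem_deriv T \<kappa> (ref_node T i j)))"
  by (simp add: jac_def jac_matrix_def frechet_elem_map)

lemma linear_elem_deriv: "linear (elem_deriv T \<kappa> z)"
  using elem_map_has_derivative has_derivative_linear by blast

lemma elem_deriv_inverse:
  assumes "det (matrix (elem_deriv T \<kappa> z)) \<noteq> 0"
  obtains B where "linear B" "\<And>w. elem_deriv T \<kappa> z (B w) = w" "\<And>w. B (elem_deriv T \<kappa> z w) = w"
proof -
  have "inj (elem_deriv T \<kappa> z)"
    using assms linear_elem_deriv det_nz_iff_inj by blast
  then show ?thesis
    using linear_injective_isomorphism[OF linear_elem_deriv] that by blast
qed

text \<open>At an endpoint the perturbation is kept below half of the inward displacement r |a|,
  which preserves its sign, while r |a| < 1/2 prevents reaching the other end. Inside the interval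
  it suffices that r (|a| + 1) stays below the distance to the ends.\<close>

lemma interval_cone:
  fixes c a :: real
  assumes "\<bar>c\<bar> \<le> 1" "c = 1 \<Longrightarrow> a < 0" "c = -1 \<Longrightarrow> a > 0"
  obtains \<delta> r0 where "\<delta> > 0" "r0 > 0"
    "\<And>r y. 0 < r \<Longrightarrow> r < r0 \<Longrightarrow> \<bar>y - (c + r * a)\<bar> \<le> r * \<delta> \<Longrightarrow> \<bar>y\<bar> < 1"
proof (cases "\<bar>c\<bar> = 1")
  case True
  then have c: "c = 1 \<or> c = -1" by linarith
  then have a: "a \<noteq> 0" using assms by auto
  show ?thesis
  proof (rule that[of "\<bar>a\<bar> / 2" "1 / (2 * \<bar>a\<bar>)"])
    fix r y assume r: "0 < r" "r < 1 / (2 * \<bar>a\<bar>)" "\<bar>y - (c + r * a)\<bar> \<le> r * (\<bar>a\<bar> / 2)"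
    have small: "r * \<bar>a\<bar> < 1 / 2" using r(2) a by (simp add: field_simps)
    have pos: "r * \<bar>a\<bar> > 0" using r a by simp
    have le: "\<bar>y - (c + r * a)\<bar> \<le> r * \<bar>a\<bar> / 2" using r(3) by simp
    from c show "\<bar>y\<bar> < 1"
    proof
      assume "c = 1"
      then have "r * a = - (r * \<bar>a\<bar>)" using assms(2) by simp
      then show ?thesis using \<open>c = 1\<close> le small pos by linarith
    next
      assume "c = -1"
      then have "r * a = r * \<bar>a\<bar>" using assms(3) by simp
      then show ?thesis using \<open>c = -1\<close> le small pos by linarith
    qed
  qed (use a in auto)
next
  case False
  then have c: "\<bar>c\<bar> < 1" using assms by auto
  show ?thesis
  proof (rule that[of 1 "(1 - \<bar>c\<bar>) / (\<bar>a\<bar> + 1)"])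
    fix r y assume r: "0 < r" "r < (1 - \<bar>c\<bar>) / (\<bar>a\<bar> + 1)" "\<bar>y - (c + r * a)\<bar> \<le> r * 1"
    have "r * \<bar>a\<bar> + r < 1 - \<bar>c\<bar>" using r(2) by (simp add: field_simps)
    moreover have "\<bar>r * a\<bar> = r * \<bar>a\<bar>" using r by (simp add: abs_mult)
    ultimately show "\<bar>y\<bar> < 1" using r(3) by linarith
  qed (use c in auto)
qed

lemma square_cone:
  fixes c a :: pt
  assumes "\<And>i. \<bar>c $ i\<bar> \<le> 1" "\<And>i. c $ i = 1 \<Longrightarrow> a $ i < 0" "\<And>i. c $ i = -1 \<Longrightarrow> a $ i > 0"
  obtains \<delta> r0 where "\<delta> > 0" "r0 > 0"
    "\<And>r. 0 < r \<Longrightarrow> r < r0 \<Longrightarrow> cball (c + r *\<^sub>R a) (r * \<delta>) \<subseteq> interior ref_square"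
proof -
  obtain d1 r1 where 1: "d1 > 0" "r1 > 0"
    "\<And>r y. 0 < r \<Longrightarrow> r < r1 \<Longrightarrow> \<bar>y - (c $ 1 + r * a $ 1)\<bar> \<le> r * d1 \<Longrightarrow> \<bar>y\<bar> < 1"
    using interval_cone[of "c $ 1" "a $ 1"] assms by blast
  obtain d2 r2 where 2: "d2 > 0" "r2 > 0"
    "\<And>r y. 0 < r \<Longrightarrow> r < r2 \<Longrightarrow> \<bar>y - (c $ 2 + r * a $ 2)\<bar> \<le> r * d2 \<Longrightarrow> \<bar>y\<bar> < 1"
    using interval_cone[of "c $ 2" "a $ 2"] assms by blast
  show ?thesis
  proof (rule that[of "min d1 d2" "min r1 r2"])
    fix r assume r: "0 < r" "r < min r1 r2"
    have le: "r * min d1 d2 \<le> r * d1" "r * min d1 d2 \<le> r * d2"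
      using r by (auto intro!: mult_left_mono)
    show "cball (c + r *\<^sub>R a) (r * min d1 d2) \<subseteq> interior ref_square"
    proof
      fix z assume "z \<in> cball (c + r *\<^sub>R a) (r * min d1 d2)"
      then have n: "norm (z - (c + r *\<^sub>R a)) \<le> r * min d1 d2" by (simp add: dist_norm norm_minus_commute)
      have "\<bar>z $ i - (c $ i + r * a $ i)\<bar> \<le> r * min d1 d2" for i
        using component_le_norm_cart[of "z - (c + r *\<^sub>R a)" i] n by simp
      from this[of 1] this[of 2] show "z \<in> interior ref_square"
        unfolding mem_interior_ref_square using 1(3)[of r "z $ 1"] 2(3)[of r "z $ 2"] r le by auto
    qed
  qed (use 1 2 in auto)
qed

text \<open>By Brouwer's theorem for a simplified Newton iteration, the image of a cone with apex \<open>z\<close>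
  contains the image of its axis under the derivative.\<close>
lemma image_contains_cone_axis:
  fixes F :: "'a::euclidean_space \<Rightarrow> 'a"
  assumes F: "(F has_derivative A) (at z)" "continuous_on UNIV F"
    and B: "linear B" "\<And>w. A (B w) = w" "\<And>w. B (A w) = w"
    and cone: "\<delta> > 0" "r0 > 0" "\<And>r. 0 < r \<Longrightarrow> r < r0 \<Longrightarrow> cball (z + r *\<^sub>R a) (r * \<delta>) \<subseteq> S"
  obtains r1 where "r1 > 0" "\<And>r. 0 < r \<Longrightarrow> r < r1 \<Longrightarrow> F z + r *\<^sub>R A a \<in> F ` S"
proof -
  have A: "linear A" using F(1) has_derivative_linear by blast
  obtain C where C: "C > 0" "\<And>x. norm (B x) \<le> norm x * C"
    using linear_conv_bounded_linear B(1) bounded_linear.pos_bounded by blast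
  define R where "R = norm a + \<delta>"
  have R: "R > 0" using cone(1) by (simp add: R_def add_nonneg_pos)
  \<comment> \<open>With this choice the linearization error within distance r R, amplified by the
    bound \<open>C\<close> of the inverse, is at most r \<delta>, so the iteration maps the ball
    into itself.\<close>
  define \<eta> where "\<eta> = \<delta> / (C * R)"
  have "\<eta> > 0" using C R cone(1) by (simp add: \<eta>_def)
  then obtain d where d: "d > 0" "\<And>y. norm (y - z) < d \<Longrightarrow> norm (F y - F z - A (y - z)) \<le> \<eta> * norm (y - z)"
    using F(1) unfolding has_derivative_at_alt by blast
  show ?thesis
  proof (rule that[of "min r0 (d / R)"])
    show "0 < min r0 (d / R)" using cone d R by simp
    fix r assume r: "0 < r" "r < min r0 (d / R)"
    then have rR: "r * R < d" using R by (simp add: field_simps)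
    let ?K = "cball (z + r *\<^sub>R a) (r * \<delta>)"
    let ?G = "\<lambda>y. y - B (F y - (F z + r *\<^sub>R A a))"
    have cG: "continuous_on ?K ?G"
      by (intro continuous_intros linear_continuous_on_compose[OF _ B(1)] continuous_on_subset[OF F(2)]) auto
    have mG: "?G \<in> ?K \<rightarrow> ?K"
    proof
      fix y assume y: "y \<in> ?K"
      have "norm (y - z) \<le> norm (y - (z + r *\<^sub>R a)) + norm (r *\<^sub>R a)"
        using norm_triangle_ineq[of "y - (z + r *\<^sub>R a)" "r *\<^sub>R a"] by (simp add: algebra_simps)
      also have "\<dots> \<le> r * R" using y r by (simp add: R_def dist_norm norm_minus_commute algebra_simps)
      finally have yR: "norm (y - z) \<le> r * R" .
      have "B (F y - F z - A (y - z)) = B (F y - F z) - (y - z)"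
        by (simp add: linear_diff[OF B(1)] B(3))
      moreover have "B (F y - (F z + r *\<^sub>R A a)) = B (F y - F z) - r *\<^sub>R a"
        unfolding diff_diff_eq[symmetric]
        by (simp add: linear_diff[OF B(1)] linear_cmul[OF B(1)] B(3))
      ultimately have "?G y - (z + r *\<^sub>R a) = - B (F y - F z - A (y - z))"
        by (simp add: algebra_simps)
      then have "norm (?G y - (z + r *\<^sub>R a)) \<le> norm (F y - F z - A (y - z)) * C"
        using C(2) by (simp only: norm_minus_cancel)
      also have "\<dots> \<le> \<eta> * norm (y - z) * C"
        using d(2)[of y] yR rR C(1) by (intro mult_right_mono) auto
      also have "\<dots> \<le> \<eta> * (r * R) * C"
        using yR C(1) \<open>\<eta> > 0\<close> by (intro mult_right_mono mult_left_mono) auto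
      also have "\<dots> = r * \<delta>" using C(1) R by (simp add: \<eta>_def)
      finally show "?G y \<in> ?K" by (simp add: dist_norm norm_minus_commute)
    qed
    have "z + r *\<^sub>R a \<in> ?K" using r cone(1) by simp
    then have "?K \<noteq> {}" by blast
    from brouwer[OF compact_cball convex_cball this cG mG] obtain y where y: "y \<in> ?K" "?G y = y" .
    then have "B (F y - (F z + r *\<^sub>R A a)) = 0" by simp
    then have "F y - (F z + r *\<^sub>R A a) = A 0" by (metis B(2))
    then have "F y = F z + r *\<^sub>R A a" using linear_0[OF A] by simp
    moreover have "y \<in> S" using y cone(3)[of r] r by auto
    ultimately show "F z + r *\<^sub>R A a \<in> F ` S" by (metis imageI)
  qed
qed

fun side_tangent :: "side \<Rightarrow> pt" where
  "side_tangent West = vector [0, 1]"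
| "side_tangent East = vector [0, 1]"
| "side_tangent South = vector [1, 0]"
| "side_tangent North = vector [1, 0]"

lemma side_point_in_square: "t \<in> {-1..1} \<Longrightarrow> side_point s t \<in> ref_square"
  by (cases s) (auto simp: mem_ref_square)

lemma side_point_has_derivative:
  "((\<lambda>t. side_point s (\<sigma> * t)) has_derivative (\<lambda>h. (h * \<sigma>) *\<^sub>R side_tangent s)) (at t within S)"
proof -
  have eq: "side_point s (\<sigma> * t) = side_point s 0 + (\<sigma> * t) *\<^sub>R side_tangent s" for t
    by (cases s) (auto simp: vector_2_eq_iff)
  show ?thesis unfolding eq by (auto intro!: derivative_eq_intros simp: mult.commute)
qed

text \<open>In the plane the vectors orthogonal to \<open>n\<close> form the line through
  \<open>n\<close> turned by a right angle; \<open>\<tau>\<close> spans it and w - (w . n) n lies on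
  it.\<close>

lemma plane_decomposition:
  fixes n \<tau> w :: pt
  assumes "norm n = 1" "n \<bullet> \<tau> = 0" "\<tau> \<noteq> 0"
  obtains \<beta> where "w = (w \<bullet> n) *\<^sub>R n + \<beta> *\<^sub>R \<tau>"
proof -
  let ?r = "w - (w \<bullet> n) *\<^sub>R n"
  have n: "n $ 1 * n $ 1 + n $ 2 * n $ 2 = 1"
    using assms(1) by (simp add: norm_eq_1 inner_vec_def sum_2)
  have "?r \<bullet> n = 0" using assms(1) by (simp add: inner_diff_left norm_eq_1)
  then have r: "?r $ 1 * n $ 1 + ?r $ 2 * n $ 2 = 0" by (simp only: inner_vec_def sum_2 inner_real_def)
  have t: "\<tau> $ 1 * n $ 1 + \<tau> $ 2 * n $ 2 = 0"
    using assms(2) by (simp add: inner_vec_def sum_2 mult.commute)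
  let ?J = "vector [- n $ 2, n $ 1] :: pt"
  have J: "x = (x \<bullet> ?J) *\<^sub>R ?J" if "x $ 1 * n $ 1 + x $ 2 * n $ 2 = 0" for x :: pt
    unfolding vector_2_eq_iff using n that by (simp add: inner_vec_def sum_2) algebra
  have nz: "\<tau> \<bullet> ?J \<noteq> 0" using J[OF t] assms(3) by (metis scale_zero_left)
  have "?r = (?r \<bullet> ?J) *\<^sub>R ?J" by (rule J[OF r])
  also have "\<dots> = (?r \<bullet> ?J / (\<tau> \<bullet> ?J)) *\<^sub>R ((\<tau> \<bullet> ?J) *\<^sub>R ?J)" using nz by simp
  also have "(\<tau> \<bullet> ?J) *\<^sub>R ?J = \<tau>" by (rule J[OF t, symmetric])
  finally show ?thesis by (intro that[of "?r \<bullet> ?J / (\<tau> \<bullet> ?J)"]) (simp add: algebra_simps)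
qed

fun side_index :: "nat \<Rightarrow> side \<Rightarrow> nat \<Rightarrow> nat \<times> nat" where
  "side_index p West l = (0, l)"
| "side_index p East l = (p, l)"
| "side_index p South l = (l, 0)"
| "side_index p North l = (l, p)"

lemma UNIV_side: "UNIV = {West, East, South, North}"
  by (auto intro: side.exhaust)

section \<open>Edge nodes, neighbours and normals\<close>

locale dg_scheme_mesh =
  fixes T :: dg_mesh
  assumes mesh: "admissible_mesh T"
begin

sublocale gauss_lobatto "deg T" "gl T"
  using mesh by unfold_locales (auto simp: admissible_mesh_def)

lemma mesh_partition: "mesh_partition T" and mesh_watertight: "mesh_watertight T"
  and mesh_normals: "mesh_normals T" and metric_identities: "discrete_metric_identities T"
  and face_metrics: "face_metrics T" and mesh_regular: "mesh_regular T"
  using mesh by (auto simp: admissible_mesh_def)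

lemma elem_image: "\<kappa> \<in> elems T \<Longrightarrow> \<kappa> = elem_map T \<kappa> ` interior ref_square"
  and elem_inj: "\<kappa> \<in> elems T \<Longrightarrow> inj_on (elem_map T \<kappa>) ref_square"
  and elem_open: "\<kappa> \<in> elems T \<Longrightarrow> open \<kappa>"
  and jac_pos: "\<kappa> \<in> elems T \<Longrightarrow> i \<le> deg T \<Longrightarrow> j \<le> deg T \<Longrightarrow> jac T \<kappa> i j > 0"
  using mesh_partition by (simp_all add: mesh_partition_def)

lemma elems_disjoint: "\<kappa> \<in> elems T \<Longrightarrow> \<kappa>' \<in> elems T \<Longrightarrow> \<kappa> \<noteq> \<kappa>' \<Longrightarrow> \<kappa> \<inter> \<kappa>' = {}"
  using mesh_partition by (auto simp: mesh_partition_def pairwise_def disjnt_def)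

lemma edge_jac_pos: "\<kappa> \<in> elems T \<Longrightarrow> e \<in> edges T \<kappa> \<Longrightarrow> k \<le> deg T \<Longrightarrow> edge_jac T e k > 0"
  using mesh_regular unfolding mesh_regular_def by blast

lemma ref_node_component [simp]: "ref_node T i j $ 1 = gl T i" "ref_node T i j $ 2 = gl T j"
  by (simp_all add: ref_node_def)

lemma ref_node_in_square: "i \<le> deg T \<Longrightarrow> j \<le> deg T \<Longrightarrow> ref_node T i j \<in> ref_square"
  using node_bounds by (auto simp: mem_ref_square abs_le_iff minus_le_iff)

lemma elem_map_ref_node:
  assumes "i \<le> deg T" "j \<le> deg T"
  shows "elem_map T \<kappa> (ref_node T i j) = geo_node T \<kappa> i j"
proof -
  have "elem_map T \<kappa> (ref_node T i j)
      = (\<Sum>a\<le>deg T. \<Sum>b\<le>deg T. if b = j then if a = i then geo_node T \<kappa> i j else 0 else 0)"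
    unfolding elem_map_def using assms by (intro sum.cong refl) (auto simp: lag_node)
  then show ?thesis using assms by simp
qed

lemma basis_fun_elem_map:
  assumes "\<kappa> \<in> elems T" "z \<in> ref_square"
  shows "basis_fun T \<kappa> i j (elem_map T \<kappa> z) = poly (ell T i) (z $ 1) * poly (ell T j) (z $ 2)"
  using inv_into_f_f[OF elem_inj[OF assms(1)] assms(2)] by (simp add: basis_fun_def Let_def)

lemma basis_fun_node:
  assumes "\<kappa> \<in> elems T" "i \<le> deg T" "j \<le> deg T" "a \<le> deg T" "b \<le> deg T"
  shows "basis_fun T \<kappa> i j (geo_node T \<kappa> a b) = (if i = a \<and> j = b then 1 else 0)"
  using basis_fun_elem_map[OF assms(1) ref_node_in_square[OF assms(4,5)], of i j] assms
  by (simp add: elem_map_ref_node lag_node)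

lemma dg_fun_node:
  assumes "\<kappa> \<in> elems T" "a \<le> deg T" "b \<le> deg T"
  shows "dg_fun T U \<kappa> (geo_node T \<kappa> a b) = U \<kappa> a b"
proof -
  have "dg_fun T U \<kappa> (geo_node T \<kappa> a b)
      = (\<Sum>i\<le>deg T. \<Sum>j\<le>deg T. if j = b then if i = a then U \<kappa> a b else 0 else 0)"
    unfolding dg_fun_def using assms by (intro sum.cong refl) (auto simp: basis_fun_node)
  then show ?thesis using assms by simp
qed

lemma side_point_gl: "side_point s (gl T l) = ref_node T (fst (side_index (deg T) s l)) (snd (side_index (deg T) s l))"
  by (cases s) (auto simp: vector_2_eq_iff)

text \<open>The common parametrization of an edge may run against the reference coordinate of the element,
  in which case the node numbers are reversed.\<close>
definition edge_dof :: "pt set \<Rightarrow> side \<Rightarrow> nat \<Rightarrow> nat" where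
  "edge_dof \<kappa> s k = (if \<forall>t\<in>{-1..1}. edge_map T (side_edge T \<kappa> s) t = elem_map T \<kappa> (side_point s t)
     then k else deg T - k)"

lemma edge_param:
  assumes "\<kappa> \<in> elems T"
  obtains \<sigma> where "\<sigma> = 1 \<or> \<sigma> = -1" "\<And>k. k \<le> deg T \<Longrightarrow> \<sigma> * gl T k = gl T (edge_dof \<kappa> s k)"
    "\<And>t. t \<in> {-1..1} \<Longrightarrow> edge_map T (side_edge T \<kappa> s) t = elem_map T \<kappa> (side_point s (\<sigma> * t))"
proof -
  obtain \<sigma> where s: "\<sigma> \<in> {1, -1}"
    "\<forall>t\<in>{-1..1}. edge_map T (side_edge T \<kappa> s) t = elem_map T \<kappa> (side_point s (\<sigma> * t))"
    using mesh_watertight assms unfolding mesh_watertight_def by blast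
  show ?thesis
  proof (cases "\<forall>t\<in>{-1..1}. edge_map T (side_edge T \<kappa> s) t = elem_map T \<kappa> (side_point s t)")
    case True
    then show ?thesis by (intro that[of 1]) (auto simp: edge_dof_def)
  next
    case False
    then have "\<sigma> = -1" using s by auto
    then show ?thesis using s False by (intro that[of \<sigma>]) (auto simp: edge_dof_def node_symmetric)
  qed
qed

lemma edge_dof_le: "k \<le> deg T \<Longrightarrow> edge_dof \<kappa> s k \<le> deg T"
  and edge_dof_involution: "k \<le> deg T \<Longrightarrow> edge_dof \<kappa> s (edge_dof \<kappa> s k) = k"
  and weight_edge_dof: "k \<le> deg T \<Longrightarrow> omega T (edge_dof \<kappa> s k) = omega T k"
  by (auto simp: edge_dof_def weight_symmetric)

lemma edge_dof_bij: "bij_betw (edge_dof \<kappa> s) {..deg T} {..deg T}"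
  by (rule bij_betw_byWitness[where f' = "edge_dof \<kappa> s"])
     (auto simp: edge_dof_le edge_dof_involution)

definition edge_i :: "pt set \<Rightarrow> side \<Rightarrow> nat \<Rightarrow> nat" where
  "edge_i \<kappa> s k = fst (side_index (deg T) s (edge_dof \<kappa> s k))"

definition edge_j :: "pt set \<Rightarrow> side \<Rightarrow> nat \<Rightarrow> nat" where
  "edge_j \<kappa> s k = snd (side_index (deg T) s (edge_dof \<kappa> s k))"

lemma edge_ij_le: "k \<le> deg T \<Longrightarrow> edge_i \<kappa> s k \<le> deg T" "k \<le> deg T \<Longrightarrow> edge_j \<kappa> s k \<le> deg T"
  using edge_dof_le[of k \<kappa> s] by (cases s; simp add: edge_i_def edge_j_def)+

lemma side_point_edge_dof:
  "side_point s (gl T (edge_dof \<kappa> s k)) = ref_node T (edge_i \<kappa> s k) (edge_j \<kappa> s k)"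
  by (simp add: side_point_gl edge_i_def edge_j_def)

lemma edge_node_eq_map:
  assumes "\<kappa> \<in> elems T" "k \<le> deg T"
  shows "edge_node T (side_edge T \<kappa> s) k = elem_map T \<kappa> (side_point s (gl T (edge_dof \<kappa> s k)))"
  unfolding edge_node_def using edge_param[OF assms(1), of s] node_bounds[OF assms(2)] assms(2) by metis

lemma edge_node_eq:
  assumes "\<kappa> \<in> elems T" "k \<le> deg T"
  shows "edge_node T (side_edge T \<kappa> s) k = geo_node T \<kappa> (edge_i \<kappa> s k) (edge_j \<kappa> s k)"
  unfolding edge_node_eq_map[OF assms] side_point_edge_dof
  by (rule elem_map_ref_node) (simp_all add: edge_ij_le assms)

lemma basis_fun_edge_node:
  assumes "\<kappa> \<in> elems T" "i \<le> deg T" "j \<le> deg T" "k \<le> deg T"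
  shows "basis_fun T \<kappa> i j (edge_node T (side_edge T \<kappa> s) k) =
    (if i = edge_i \<kappa> s k \<and> j = edge_j \<kappa> s k then 1 else 0)"
  using assms by (simp add: edge_node_eq basis_fun_node edge_ij_le)

lemma dg_fun_edge_node:
  assumes "\<kappa> \<in> elems T" "k \<le> deg T"
  shows "dg_fun T U \<kappa> (edge_node T (side_edge T \<kappa> s) k) = U \<kappa> (edge_i \<kappa> s k) (edge_j \<kappa> s k)"
  using assms by (simp add: edge_node_eq dg_fun_node edge_ij_le)

lemma dg_fun_edge_node_dof:
  assumes "\<kappa> \<in> elems T" "e \<in> edges T \<kappa>" "k \<le> deg T"
  obtains a b where "a \<le> deg T" "b \<le> deg T" "\<And>U. dg_fun T U \<kappa> (edge_node T e k) = U \<kappa> a b"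
proof -
  obtain s where "e = side_edge T \<kappa> s" using assms(2) by (auto simp: edges_def)
  then show ?thesis using assms by (intro that[of "edge_i \<kappa> s k" "edge_j \<kappa> s k"])
    (simp_all add: edge_ij_le dg_fun_edge_node)
qed

text \<open>The midpoint of a side of the square lies on no other side, and the mapping is injective
  on the closed square. So the set \<open>edges\<close> has four members, and a sum over it is a sum
  over the sides.\<close>

lemma side_edge_inj:
  assumes "\<kappa> \<in> elems T" shows "inj (side_edge T \<kappa>)"
proof (rule injI)
  fix s s' assume "side_edge T \<kappa> s = side_edge T \<kappa> s'"
  then have "elem_map T \<kappa> ` (side_point s ` {-1..1}) = elem_map T \<kappa> ` (side_point s' ` {-1..1})"
    by (simp add: side_edge_def image_image)
  then have eq: "side_point s ` {-1..1} = side_point s' ` {-1..1}"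
    by (subst (asm) inj_on_image_eq_iff[OF elem_inj[OF assms]]) (auto simp: side_point_in_square)
  have "side_point s 0 \<in> side_point s' ` {-1..1}" unfolding eq[symmetric] by auto
  then show "s = s'" by (cases s; cases s') (auto simp: vector_2_eq_iff)
qed

lemma sum_edges:
  assumes "\<kappa> \<in> elems T" shows "(\<Sum>e\<in>edges T \<kappa>. F e) = (\<Sum>s\<in>UNIV. F (side_edge T \<kappa> s))"
  unfolding edges_def using side_edge_inj[OF assms] by (subst sum.reindex) auto

lemma finite_edges: "finite (edges T \<kappa>)"
  unfolding edges_def UNIV_side by simp

lemma neighbour:
  assumes "\<kappa> \<in> elems T" "e \<in> edges T \<kappa>"
  shows "neighbour T \<kappa> e \<in> elems T" "neighbour T \<kappa> e \<noteq> \<kappa>" "e \<in> edges T (neighbour T \<kappa> e)"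
proof -
  have "\<exists>!\<kappa>'. \<kappa>' \<in> elems T \<and> \<kappa>' \<noteq> \<kappa> \<and> e \<in> edges T \<kappa>'"
    using mesh_watertight assms unfolding mesh_watertight_def by blast
  from theI'[OF this] show "neighbour T \<kappa> e \<in> elems T" "neighbour T \<kappa> e \<noteq> \<kappa>"
    "e \<in> edges T (neighbour T \<kappa> e)" unfolding neighbour_def by blast+
qed

lemma neighbour_neighbour:
  assumes "\<kappa> \<in> elems T" "e \<in> edges T \<kappa>"
  shows "neighbour T (neighbour T \<kappa> e) e = \<kappa>"
proof -
  note n = neighbour[OF assms]
  have "\<exists>!\<kappa>'. \<kappa>' \<in> elems T \<and> \<kappa>' \<noteq> neighbour T \<kappa> e \<and> e \<in> edges T \<kappa>'"
    using mesh_watertight n unfolding mesh_watertight_def by blast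
  then show ?thesis using n assms unfolding neighbour_def[of T "neighbour T \<kappa> e"]
    by (intro the1_equality) auto
qed

lemma edge_tangent_eq:
  assumes "\<kappa> \<in> elems T" "k \<le> deg T"
    and \<sigma>: "\<And>t. t \<in> {-1..1} \<Longrightarrow> edge_map T (side_edge T \<kappa> s) t = elem_map T \<kappa> (side_point s (\<sigma> * t))"
  shows "edge_tangent T (side_edge T \<kappa> s) k
    = elem_deriv T \<kappa> (side_point s (\<sigma> * gl T k)) (\<sigma> *\<^sub>R side_tangent s)"
proof -
  let ?A = "elem_deriv T \<kappa> (side_point s (\<sigma> * gl T k))"
  have mem: "gl T k \<in> {-1..1}" using node_bounds assms by auto
  have "((\<lambda>t. elem_map T \<kappa> (side_point s (\<sigma> * t))) has_derivative (\<lambda>h. ?A ((h * \<sigma>) *\<^sub>R side_tangent s)))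
      (at (gl T k) within {-1..1})"
    by (rule has_derivative_compose[OF side_point_has_derivative elem_map_has_derivative])
  moreover have "(\<lambda>h. ?A ((h * \<sigma>) *\<^sub>R side_tangent s)) = (\<lambda>h. h *\<^sub>R ?A (\<sigma> *\<^sub>R side_tangent s))"
    using linear_cmul[OF linear_elem_deriv[of T \<kappa> "side_point s (\<sigma> * gl T k)"]] by (metis scaleR_scaleR)
  ultimately have "((\<lambda>t. elem_map T \<kappa> (side_point s (\<sigma> * t))) has_vector_derivative ?A (\<sigma> *\<^sub>R side_tangent s))
      (at (gl T k) within {-1..1})"
    by (simp add: has_vector_derivative_def)
  then have "(edge_map T (side_edge T \<kappa> s) has_vector_derivative ?A (\<sigma> *\<^sub>R side_tangent s))
      (at (gl T k) within {-1..1})"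
    by (rule has_vector_derivative_transform[OF mem, rotated]) (simp add: \<sigma>)
  then show ?thesis
    unfolding edge_tangent_def using mem by (intro vector_derivative_within_closed_interval) auto
qed

lemma unit_normal:
  assumes "\<kappa> \<in> elems T" "k \<le> deg T"
  shows "norm (normal T \<kappa> (side_edge T \<kappa> s) k) = 1"
    "normal T \<kappa> (side_edge T \<kappa> s) k \<bullet> edge_tangent T (side_edge T \<kappa> s) k = 0"
    "normal T \<kappa> (side_edge T \<kappa> s) k \<bullet>
       elem_deriv T \<kappa> (side_point s (gl T (edge_dof \<kappa> s k))) (side_outward s) > 0"
  using mesh_normals assms edge_node_eq_map[OF assms, of s] node_bounds[OF edge_dof_le[OF assms(2), of \<kappa> s]]
  unfolding mesh_normals_def frechet_elem_map by blast+

lemma unit_normal_edge: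
  assumes "\<kappa> \<in> elems T" "e \<in> edges T \<kappa>" "k \<le> deg T"
  shows "norm (normal T \<kappa> e k) = 1" "normal T \<kappa> e k \<bullet> edge_tangent T e k = 0"
  using assms unit_normal(1,2) unfolding edges_def by auto

text \<open>At an end node of the edge, moving against the normal may leave the element, so a
  tangent pointing along the edge towards its other nodes is added, and the normal part only tilts
  it slightly inwards. The tangential weight \<open>l\<close> depends on the edge parametrization
  alone, so two neighbours get the same tangential part.\<close>

lemma inward_direction:
  assumes "\<kappa> \<in> elems T" "e \<in> edges T \<kappa>" "k \<le> deg T"
  defines "l \<equiv> (if \<bar>gl T k\<bar> = 1 then - gl T k else 0)"
  obtains \<epsilon>0 where "\<epsilon>0 > 0" "\<And>\<epsilon>. 0 < \<epsilon> \<Longrightarrow> \<epsilon> < \<epsilon>0 \<Longrightarrow> \<exists>r1>0. \<forall>r. 0 < r \<longrightarrow> r < r1 \<longrightarrow>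
    edge_node T e k + r *\<^sub>R (l *\<^sub>R edge_tangent T e k - \<epsilon> *\<^sub>R normal T \<kappa> e k) \<in> \<kappa>"
proof -
  obtain s where e: "e = side_edge T \<kappa> s" using assms(2) by (auto simp: edges_def)
  obtain \<sigma> where \<sigma>: "\<sigma> = 1 \<or> \<sigma> = -1" "\<And>k. k \<le> deg T \<Longrightarrow> \<sigma> * gl T k = gl T (edge_dof \<kappa> s k)"
    "\<And>t. t \<in> {-1..1} \<Longrightarrow> edge_map T (side_edge T \<kappa> s) t = elem_map T \<kappa> (side_point s (\<sigma> * t))"
    using edge_param[OF assms(1)] by blast
  define z where "z = side_point s (\<sigma> * gl T k)"
  define A where "A = elem_deriv T \<kappa> z"
  define n where "n = normal T \<kappa> e k"
  define \<tau> where "\<tau> = edge_tangent T e k"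
  have z': "z = side_point s (gl T (edge_dof \<kappa> s k))" using \<sigma>(2) assms(3) by (simp add: z_def)
  have "jac T \<kappa> (edge_i \<kappa> s k) (edge_j \<kappa> s k) > 0"
    by (intro jac_pos assms edge_ij_le)
  then have "det (matrix (elem_deriv T \<kappa> z)) \<noteq> 0"
    unfolding z' jac_eq_det side_point_edge_dof by simp
  then obtain B where B: "linear B" "\<And>w. A (B w) = w" "\<And>w. B (A w) = w"
    using elem_deriv_inverse unfolding A_def by metis
  have A: "linear A" unfolding A_def by (rule linear_elem_deriv)
  have A\<tau>: "A (\<sigma> *\<^sub>R side_tangent s) = \<tau>"
    using edge_tangent_eq[OF assms(1,3) \<sigma>(3)] by (simp add: \<tau>_def e A_def z_def)
  have "\<tau> \<noteq> 0" using edge_jac_pos[OF assms(1-3)] by (auto simp: \<tau>_def edge_jac_def)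
  moreover have n: "norm n = 1" "n \<bullet> \<tau> = 0" "n \<bullet> A (side_outward s) > 0"
    using unit_normal[OF assms(1,3), of s] by (simp_all add: n_def e \<tau>_def A_def z')
  ultimately obtain \<beta> where \<beta>: "A (side_outward s) = (A (side_outward s) \<bullet> n) *\<^sub>R n + \<beta> *\<^sub>R \<tau>"
    using plane_decomposition[of n \<tau> "A (side_outward s)"] by blast
  define \<alpha> where "\<alpha> = A (side_outward s) \<bullet> n"
  have \<alpha>: "\<alpha> > 0" using n by (simp add: \<alpha>_def inner_commute)
  show ?thesis
  proof (rule that[of "\<alpha> / (\<bar>\<beta>\<bar> + 1)"])
    fix \<epsilon> assume \<epsilon>: "0 < \<epsilon>" "\<epsilon> < \<alpha> / (\<bar>\<beta>\<bar> + 1)"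
    \<comment> \<open>The vector \<open>a\<close> is the preimage of the wanted direction under
      \<open>A\<close>. As \<open>A\<close> maps the outward reference direction to
      \<open>\<alpha> *\<^sub>R n + \<beta> *\<^sub>R \<tau>\<close>, going against it spills
      \<epsilon> \<beta> / \<alpha> onto the tangent, for which \<open>\<mu>\<close> compensates.
      The bound on \<epsilon> keeps this spill below 1, so that at a corner the sign of
      \<open>l\<close> decides.\<close>
    define \<mu> where "\<mu> = l + \<epsilon> / \<alpha> * \<beta>"
    define a where "a = (\<sigma> * \<mu>) *\<^sub>R side_tangent s - (\<epsilon> / \<alpha>) *\<^sub>R side_outward s"
    have "\<epsilon> * (\<bar>\<beta>\<bar> + 1) < \<alpha>" using \<epsilon>(2) by (simp add: field_simps)
    then have "\<epsilon> * \<bar>\<beta>\<bar> < \<alpha>" using \<epsilon>(1) by (simp add: distrib_left)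
    then have small: "\<bar>\<epsilon> / \<alpha> * \<beta>\<bar> < 1" using \<alpha> \<epsilon>(1) by (simp add: abs_mult field_simps)
    have mu: "gl T k = 1 \<Longrightarrow> \<mu> < 0" "gl T k = -1 \<Longrightarrow> \<mu> > 0"
      using small[unfolded abs_less_iff] by (auto simp: \<mu>_def l_def)
    have gk: "\<bar>gl T k\<bar> \<le> 1" using node_bounds[OF assms(3)] by (simp add: abs_le_iff)
    have Aa: "A a = l *\<^sub>R \<tau> - \<epsilon> *\<^sub>R n"
    proof -
      have "A a = \<mu> *\<^sub>R A (\<sigma> *\<^sub>R side_tangent s) - (\<epsilon> / \<alpha>) *\<^sub>R A (side_outward s)"
        unfolding a_def using linear_diff[OF A] linear_cmul[OF A] by (simp add: mult.commute)
      also have "\<dots> = \<mu> *\<^sub>R \<tau> - (\<epsilon> / \<alpha>) *\<^sub>R (\<alpha> *\<^sub>R n + \<beta> *\<^sub>R \<tau>)"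
        using \<beta> by (simp add: A\<tau> \<alpha>_def)
      also have "\<dots> = l *\<^sub>R \<tau> - \<epsilon> *\<^sub>R n"
        using \<alpha> by (simp add: \<mu>_def scaleR_add_left scaleR_add_right algebra_simps)
      finally show ?thesis .
    qed
    have sgn: "\<sigma> * gl T k = 1 \<Longrightarrow> \<sigma> * \<mu> < 0" "\<sigma> * gl T k = -1 \<Longrightarrow> \<sigma> * \<mu> > 0" "\<bar>\<sigma> * gl T k\<bar> \<le> 1"
      using \<sigma>(1) mu gk by (auto simp: abs_mult)
    have pos: "\<epsilon> / \<alpha> > 0" using \<epsilon> \<alpha> by simp
    have "\<forall>i. \<bar>z $ i\<bar> \<le> 1 \<and> (z $ i = 1 \<longrightarrow> a $ i < 0) \<and> (z $ i = -1 \<longrightarrow> a $ i > 0)"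
      unfolding forall_2 z_def a_def using sgn pos by (cases s) auto
    then obtain \<delta> r0 where cone: "\<delta> > 0" "r0 > 0"
      "\<And>r. 0 < r \<Longrightarrow> r < r0 \<Longrightarrow> cball (z + r *\<^sub>R a) (r * \<delta>) \<subseteq> interior ref_square"
      using square_cone[of z a] by blast
    obtain r1 where r1: "r1 > 0"
      "\<And>r. 0 < r \<Longrightarrow> r < r1 \<Longrightarrow> elem_map T \<kappa> z + r *\<^sub>R A a \<in> elem_map T \<kappa> ` interior ref_square"
      using image_contains_cone_axis[OF elem_map_has_derivative elem_map_continuous B[unfolded A_def] cone]
      unfolding A_def by blast
    have "elem_map T \<kappa> z = edge_node T e k"
      using edge_node_eq_map[OF assms(1,3), of s] by (simp add: e z')
    with r1 show "\<exists>r1>0. \<forall>r. 0 < r \<longrightarrow> r < r1 \<longrightarrow>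
        edge_node T e k + r *\<^sub>R (l *\<^sub>R edge_tangent T e k - \<epsilon> *\<^sub>R normal T \<kappa> e k) \<in> \<kappa>"
      using elem_image[OF assms(1)] unfolding Aa \<tau>_def n_def by metis
  qed (use \<alpha> in auto)
qed

text \<open>Both normals are unit vectors orthogonal to the common tangent, so they agree up to
  sign; equal signs contradict disjointness.\<close>

lemma normal_neighbour:
  assumes "\<kappa> \<in> elems T" "e \<in> edges T \<kappa>" "k \<le> deg T"
  shows "normal T (neighbour T \<kappa> e) e k = - normal T \<kappa> e k"
proof -
  let ?\<kappa>' = "neighbour T \<kappa> e" and ?n = "normal T \<kappa> e k" and ?n' = "normal T (neighbour T \<kappa> e) e k"
  note nb = neighbour[OF assms(1,2)]
  have \<tau>: "edge_tangent T e k \<noteq> 0" using edge_jac_pos[OF assms] by (auto simp: edge_jac_def)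
  note u = unit_normal_edge[OF assms] and u' = unit_normal_edge[OF nb(1,3) assms(3)]
  obtain \<beta> where \<beta>: "?n' = (?n' \<bullet> ?n) *\<^sub>R ?n + \<beta> *\<^sub>R edge_tangent T e k"
    using plane_decomposition[OF u \<tau>] .
  have "?n' \<bullet> edge_tangent T e k = \<beta> * (edge_tangent T e k \<bullet> edge_tangent T e k)"
    using u(2) by (subst \<beta>) (simp add: inner_add_left)
  then have "\<beta> = 0" using u'(2) \<tau> by simp
  then have eq: "?n' = (?n' \<bullet> ?n) *\<^sub>R ?n" using \<beta> by simp
  then have "norm ?n' = \<bar>?n' \<bullet> ?n\<bar> * norm ?n" by (metis norm_scaleR)
  then have "\<bar>?n' \<bullet> ?n\<bar> = 1" using u(1) u'(1) by simp
  then have "?n' \<bullet> ?n = 1 \<or> ?n' \<bullet> ?n = -1" by linarith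
  moreover have "?n' \<bullet> ?n \<noteq> 1"
  proof
    assume "?n' \<bullet> ?n = 1"
    then have same: "?n' = ?n" using eq by simp
    let ?l = "if \<bar>gl T k\<bar> = 1 then - gl T k else 0"
    obtain a where a: "a > 0" "\<And>\<epsilon>. 0 < \<epsilon> \<Longrightarrow> \<epsilon> < a \<Longrightarrow> \<exists>r1>0. \<forall>r. 0 < r \<longrightarrow> r < r1 \<longrightarrow>
        edge_node T e k + r *\<^sub>R (?l *\<^sub>R edge_tangent T e k - \<epsilon> *\<^sub>R ?n) \<in> \<kappa>"
      using inward_direction[OF assms] by blast
    obtain a' where a': "a' > 0" "\<And>\<epsilon>. 0 < \<epsilon> \<Longrightarrow> \<epsilon> < a' \<Longrightarrow> \<exists>r1>0. \<forall>r. 0 < r \<longrightarrow> r < r1 \<longrightarrow>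
        edge_node T e k + r *\<^sub>R (?l *\<^sub>R edge_tangent T e k - \<epsilon> *\<^sub>R ?n') \<in> ?\<kappa>'"
      using inward_direction[OF nb(1,3) assms(3)] by blast
    \<comment> \<open>One \<epsilon> below both thresholds gives a single ray from the edge node
      whose initial part lies in both elements.\<close>
    let ?\<epsilon> = "min a a' / 2"
    have "0 < ?\<epsilon>" "?\<epsilon> < a" "?\<epsilon> < a'" using a a' by auto
    then obtain r1 r2 where "r1 > 0" "r2 > 0"
      and r: "\<And>r. 0 < r \<Longrightarrow> r < r1 \<Longrightarrow>
        edge_node T e k + r *\<^sub>R (?l *\<^sub>R edge_tangent T e k - ?\<epsilon> *\<^sub>R ?n) \<in> \<kappa>"
      "\<And>r. 0 < r \<Longrightarrow> r < r2 \<Longrightarrow>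
        edge_node T e k + r *\<^sub>R (?l *\<^sub>R edge_tangent T e k - ?\<epsilon> *\<^sub>R ?n) \<in> ?\<kappa>'"
      using a(2)[of ?\<epsilon>] a'(2)[of ?\<epsilon>] unfolding same by blast
    then have "edge_node T e k + (min r1 r2 / 2) *\<^sub>R (?l *\<^sub>R edge_tangent T e k - ?\<epsilon> *\<^sub>R ?n) \<in> \<kappa> \<inter> ?\<kappa>'"
      by (intro IntI r) auto
    then show False using elems_disjoint[OF assms(1) nb(1)] nb(2) by auto
  qed
  ultimately have "?n' \<bullet> ?n = -1" by blast
  then show ?thesis using eq by simp
qed

end

section \<open>Areas of the elements\<close>

text \<open>Lebesgue measure is the image of a product of one-dimensional measures indexed by
  \<open>Basis\<close>; on that product this is Fubini's theorem.\<close>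

lemma lborel_integral_prod:
  fixes F :: "'a::euclidean_space \<Rightarrow> real \<Rightarrow> real"
  assumes "\<And>b. b \<in> Basis \<Longrightarrow> integrable lborel (F b)"
  shows "(\<integral>x. (\<Prod>b\<in>Basis. F b (x \<bullet> b)) \<partial>lborel) = (\<Prod>b\<in>Basis. \<integral>t. F b t \<partial>lborel)"
proof -
  interpret product_sigma_finite "\<lambda>_ :: 'a. lborel :: real measure" by standard
  have [measurable]: "F b \<in> borel_measurable borel" if "b \<in> Basis" for b
    using assms[OF that] by (simp add: borel_measurable_integrable[unfolded measurable_lborel1])
  have "(\<integral>x. (\<Prod>b\<in>Basis. F b (x \<bullet> b)) \<partial>lborel)
      = (\<integral>f. (\<Prod>b\<in>Basis. F b ((\<Sum>c\<in>Basis. f c *\<^sub>R c) \<bullet> b)) \<partial>(\<Pi>\<^sub>M b\<in>Basis. lborel))"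
    by (subst lborel_eq, subst integral_distr) measurable
  also have "\<dots> = (\<integral>f. (\<Prod>b\<in>Basis. F b (f b)) \<partial>(\<Pi>\<^sub>M b\<in>Basis. lborel))"
    by (intro Bochner_Integration.integral_cong prod.cong refl) (simp add: inner_sum_left_Basis)
  also have "\<dots> = (\<Prod>b\<in>Basis. \<integral>t. F b t \<partial>lborel)"
    by (rule product_integral_prod) (auto simp: assms)
  finally show ?thesis .
qed

lemma Basis_pt: "(Basis :: pt set) = {axis 1 1, axis 2 1}"
  by (auto simp: Basis_vec_def UNIV_2)

lemma ref_square_integral_separable:
  "((\<lambda>z. poly q (z $ 1) * poly r (z $ 2)) has_integral pint q * pint r) ref_square"
proof -
  let ?F = "\<lambda>z :: pt. poly q (z $ 1) * poly r (z $ 2)"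
  have cont: "continuous_on ref_square ?F"
    by (intro continuous_intros)
  have si: "set_integrable lborel ref_square ?F"
    unfolding set_integrable_def by (rule borel_integrable_compact[OF _ cont]) (simp add: ref_square_def compact_cbox)
  \<comment> \<open>The indicator of the square is distributed over the one-dimensional factors,
    which leaves an integral of a product over the whole plane.\<close>
  define G :: "pt \<Rightarrow> real \<Rightarrow> real" where
    "G b t = indicator {-1..1} t *\<^sub>R (if b = axis 1 1 then poly q t else poly r t)" for b t
  have cG: "continuous_on {-1..1} (\<lambda>t. if b = axis 1 1 then poly q t else poly r t)" for b :: pt
    by (cases "b = axis 1 1") (auto intro!: continuous_intros)
  have intG: "integrable lborel (G b)" for b
    unfolding G_def[abs_def] by (rule borel_integrable_compact[OF compact_Icc cG])
  have ax: "axis 1 1 \<noteq> (axis 2 1 :: pt)" by (simp add: axis_eq_axis)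
  have "integral ref_square ?F = (\<integral>x. indicator ref_square x *\<^sub>R ?F x \<partial>lborel)"
    using set_borel_integral_eq_integral(2)[OF si] by (simp add: set_lebesgue_integral_def)
  also have "\<dots> = (\<integral>x. (\<Prod>b\<in>Basis. G b (x \<bullet> b)) \<partial>lborel)"
    unfolding Basis_pt using ax
    by (intro Bochner_Integration.integral_cong refl)
       (auto simp: G_def inner_axis mem_ref_square indicator_def abs_le_iff)
  also have "\<dots> = (\<Prod>b\<in>Basis. \<integral>t. G b t \<partial>lborel)"
    by (rule lborel_integral_prod) (rule intG)
  also have "\<dots> = pint q * pint r"
  proof -
    have "(\<integral>t. indicator {-1..1} t *\<^sub>R poly w t \<partial>lborel) = pint w" for w :: "real poly"
    proof -
      have "set_integrable lborel {-1..1} (poly w)"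
        unfolding set_integrable_def
        by (rule borel_integrable_compact[OF compact_Icc]) (intro continuous_intros)
      from set_borel_integral_eq_integral(2)[OF this] show ?thesis
        by (simp add: pint_def set_lebesgue_integral_def)
    qed
    then show ?thesis unfolding Basis_pt using ax by (simp add: G_def[abs_def])
  qed
  finally show ?thesis
    using set_borel_integral_eq_integral(1)[OF si] by (simp add: has_integral_iff)
qed

context dg_scheme_mesh
begin

definition node_quadrature :: "(pt \<Rightarrow> real) \<Rightarrow> real" where
  "node_quadrature F = (\<Sum>a\<le>deg T. \<Sum>b\<le>deg T. omega T a * omega T b * F (ref_node T a b))"

definition exactly_integrated :: "(pt \<Rightarrow> real) \<Rightarrow> bool" where
  "exactly_integrated F \<longleftrightarrow> (F has_integral node_quadrature F) ref_square"

lemma exactly_integrated_diff: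
  "exactly_integrated F \<Longrightarrow> exactly_integrated G \<Longrightarrow> exactly_integrated (\<lambda>z. F z - G z)"
  unfolding exactly_integrated_def node_quadrature_def right_diff_distrib sum_subtractf
  by (rule has_integral_diff)

lemma exactly_integrated_cmult: "exactly_integrated F \<Longrightarrow> exactly_integrated (\<lambda>z. F z * c)"
  unfolding exactly_integrated_def node_quadrature_def mult.assoc[symmetric] sum_distrib_right[symmetric]
  by (rule has_integral_mult_left)

lemma exactly_integrated_sum:
  assumes "finite S" "\<And>i. i \<in> S \<Longrightarrow> exactly_integrated (F i)"
  shows "exactly_integrated (\<lambda>z. \<Sum>i\<in>S. F i z)"
proof -
  have "node_quadrature (\<lambda>z. \<Sum>i\<in>S. F i z) = (\<Sum>i\<in>S. node_quadrature (F i))"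
    unfolding node_quadrature_def sum_distrib_left
    by (subst sum.swap) (intro sum.cong refl, subst sum.swap, simp add: sum.swap[of _ S])
  then show ?thesis using assms unfolding exactly_integrated_def by (auto intro: has_integral_sum)
qed

lemma exactly_integrated_separable:
  assumes "degree q \<le> 2 * deg T - 1" "degree r \<le> 2 * deg T - 1"
  shows "exactly_integrated (\<lambda>z. poly q (z $ 1) * poly r (z $ 2))"
  using ref_square_integral_separable[of q r]
  by (simp add: exactly_integrated_def node_quadrature_def quadrature_exact[OF assms(1)]
      quadrature_exact[OF assms(2)] sum_product mult_ac)

lemma degree_lag_mult_pderiv:
  assumes "i \<le> deg T" "k \<le> deg T" shows "degree (ell T i * pderiv (ell T k)) \<le> 2 * deg T - 1"
  using degree_mult_le[of "ell T i" "pderiv (ell T k)"] degree_lag[OF assms(1)] degree_lag[OF assms(2)] p_pos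
  by (simp add: degree_pderiv)

text \<open>Each reference coordinate is differentiated in only one of the two factors, so the
  degree in each coordinate is at most 2p - 1, just within reach of the quadrature. The Jacobian
  determinant is a difference of such products.\<close>

lemma exactly_integrated_product:
  "exactly_integrated (\<lambda>z. elem_dxi T \<kappa> z $ c * elem_dzeta T \<kappa> z $ d)"
proof -
  have *: "exactly_integrated (\<lambda>z. poly (pderiv (ell T i)) (z $ 1) * poly (ell T j) (z $ 2) * X *
      (poly (ell T k) (z $ 1) * poly (pderiv (ell T l)) (z $ 2) * Y))"
    if "i \<le> deg T" "j \<le> deg T" "k \<le> deg T" "l \<le> deg T" for i j k l X Y
    using exactly_integrated_cmult[OF exactly_integrated_separable[OF
        degree_lag_mult_pderiv[OF that(3,1)] degree_lag_mult_pderiv[OF that(2,4)]], of "X * Y"]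
    by (simp add: mult_ac)
  show ?thesis
    unfolding elem_dxi_def elem_dzeta_def sum_component vector_scaleR_component real_scaleR_def
      sum_distrib_left sum_distrib_right
    by (intro exactly_integrated_sum *) auto
qed

lemma jacobian_exactly_integrated: "exactly_integrated (\<lambda>z. det (matrix (elem_deriv T \<kappa> z)))"
  unfolding det_elem_deriv mult.commute[of "elem_dzeta T \<kappa> _ $ 1"]
  by (intro exactly_integrated_diff exactly_integrated_product)

lemma elem_subset_image: "\<kappa> \<in> elems T \<Longrightarrow> \<kappa> \<subseteq> elem_map T \<kappa> ` ref_square"
  using elem_image interior_subset by blast

lemma elem_bounded:
  assumes "\<kappa> \<in> elems T" shows "bounded \<kappa>"
proof (rule bounded_subset[OF _ elem_subset_image[OF assms]])
  show "bounded (elem_map T \<kappa> ` ref_square)"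
    by (intro compact_imp_bounded compact_continuous_image elem_map_continuous) (simp add: ref_square_def compact_cbox)
qed

lemma elem_lmeasurable: "\<kappa> \<in> elems T \<Longrightarrow> \<kappa> \<in> lmeasurable"
  using elem_bounded elem_open lmeasurable_open by blast

text \<open>The quadrature of the Jacobian is its integral, while the area is the integral of its
  absolute value. Positivity is assumed at the nodes only, which is why an inequality is stated; it
  is the direction used later.\<close>

lemma area_lower_bound:
  assumes "\<kappa> \<in> elems T"
  shows "(\<Sum>a\<le>deg T. \<Sum>b\<le>deg T. omega T a * omega T b * jac T \<kappa> a b) \<le> measure lebesgue \<kappa>"
proof -
  let ?S = "interior ref_square" and ?det = "\<lambda>z. det (matrix (elem_deriv T \<kappa> z))"
  have S: "?S = box (vec (-1)) (vec 1)" by (simp add: ref_square_def interior_cbox)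
  have cont: "continuous_on A ?det" for A
    unfolding det_elem_deriv elem_dxi_def elem_dzeta_def sum_component vector_scaleR_component
    by (intro continuous_intros)
  have "(?det has_integral node_quadrature ?det) ref_square"
    using jacobian_exactly_integrated unfolding exactly_integrated_def .
  then have I: "(?det has_integral node_quadrature ?det) ?S"
    unfolding S using has_integral_open_interval[of ?det] by (simp add: ref_square_def)
  have abs: "(\<lambda>z. \<bar>?det z\<bar>) integrable_on ?S"
    unfolding S by (subst integrable_on_open_interval) (intro integrable_continuous continuous_intros cont)
  have "measure lebesgue (elem_map T \<kappa> ` ?S) = integral ?S (\<lambda>z. \<bar>?det z\<bar>)"
  proof (rule measure_differentiable_image_eq)
    show "inj_on (elem_map T \<kappa>) ?S"
      using elem_inj[OF assms] interior_subset inj_on_subset by blast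
    show "(elem_map T \<kappa> has_derivative elem_deriv T \<kappa> z) (at z within ?S)" for z
      by (rule has_derivative_at_withinI[OF elem_map_has_derivative])
  qed (use abs in auto)
  then have "measure lebesgue \<kappa> = integral ?S (\<lambda>z. \<bar>?det z\<bar>)"
    using elem_image[OF assms] by metis
  moreover have "node_quadrature ?det \<le> integral ?S (\<lambda>z. \<bar>?det z\<bar>)"
    by (rule has_integral_le[OF I integrable_integral[OF abs]]) auto
  ultimately show ?thesis by (simp add: node_quadrature_def jac_eq_det)
qed

section \<open>Elements inside a ball\<close>

definition elems_within :: "real \<Rightarrow> pt set set" where
  "elems_within R = {\<kappa> \<in> elems T. \<kappa> \<subseteq> cball 0 R}"

lemma sum_area_bound:
  assumes "finite A" "A \<subseteq> elems_within R"
  shows "(\<Sum>\<kappa>\<in>A. measure lebesgue \<kappa>) \<le> measure lebesgue (cball (0 :: pt) R)"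
proof -
  have A: "A \<subseteq> elems T" using assms(2) by (auto simp: elems_within_def)
  have "(\<Sum>\<kappa>\<in>A. measure lebesgue \<kappa>) = measure lebesgue (\<Union>A)"
  proof (rule measure_Union'[symmetric, OF assms(1)])
    show "pairwise disjnt A"
      using A elems_disjoint unfolding pairwise_def disjnt_def by blast
  qed (use A elem_lmeasurable in auto)
  also have "\<dots> \<le> measure lebesgue (cball (0 :: pt) R)"
  proof (rule measure_mono_fmeasurable)
    show "\<Union>A \<subseteq> cball 0 R" using assms(2) by (auto simp: elems_within_def)
    show "\<Union>A \<in> sets lebesgue"
      by (rule sets.finite_Union[OF assms(1)]) (use A elem_lmeasurable fmeasurableD in blast)
  qed simp
  finally show ?thesis .
qed

lemma mesh_size_pos: "elems T \<noteq> {} \<Longrightarrow> mesh_size T > 0"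
  and jac_lower_bound: "\<exists>c>0. \<forall>\<kappa>\<in>elems T. \<forall>i\<le>deg T. \<forall>j\<le>deg T. jac T \<kappa> i j \<ge> c"
  and edge_jac_upper_bound: "\<exists>C. \<forall>\<kappa>\<in>elems T. \<forall>e\<in>edges T \<kappa>. \<forall>k\<le>deg T. edge_jac T e k \<le> C"
proof -
  define P where "P b \<kappa> i j k \<longleftrightarrow> jac T \<kappa> i j \<ge> b / (2 * 2) * mesh_size T ^ 2 \<and>
        (\<forall>e\<in>edges T \<kappa>. 0 < edge_jac T e k \<and> edge_jac T e k \<le> 1 / (4 * 2 * b) * mesh_size T) \<and>
        0 < norm (metric_xi T \<kappa> i k j) \<and>
        norm (metric_xi T \<kappa> i k j) \<le> 1 / (4 * 2 * b) * mesh_size T \<and>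
        0 < norm (metric_zeta T \<kappa> i j k) \<and>
        norm (metric_zeta T \<kappa> i j k) \<le> 1 / (4 * 2 * b) * mesh_size T" for b \<kappa> i j k
  obtain b where b: "b > 0" and P: "\<forall>\<kappa>\<in>elems T. \<forall>i\<le>deg T. \<forall>j\<le>deg T. \<forall>k\<le>deg T. P b \<kappa> i j k"
    using mesh_regular unfolding mesh_regular_def P_def[symmetric] by blast
  have B1: "jac T \<kappa> i j \<ge> b / (2 * 2) * mesh_size T ^ 2"
    if "\<kappa> \<in> elems T" "i \<le> deg T" "j \<le> deg T" for \<kappa> i j
    using P that unfolding P_def by blast
  have B2: "0 < edge_jac T e k" "edge_jac T e k \<le> 1 / (4 * 2 * b) * mesh_size T"
    if "\<kappa> \<in> elems T" "e \<in> edges T \<kappa>" "k \<le> deg T" for \<kappa> e k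
    using P that unfolding P_def by blast+
  show pos: "mesh_size T > 0" if "elems T \<noteq> {}"
  proof -
    obtain \<kappa> where \<kappa>: "\<kappa> \<in> elems T" using \<open>elems T \<noteq> {}\<close> by auto
    have "side_edge T \<kappa> East \<in> edges T \<kappa>" by (simp add: edges_def)
    from B2[OF \<kappa> this, of 0] have "0 < 1 / (4 * 2 * b) * mesh_size T" by linarith
    then show ?thesis using b by (simp add: zero_less_divide_iff)
  qed
  show "\<exists>c>0. \<forall>\<kappa>\<in>elems T. \<forall>i\<le>deg T. \<forall>j\<le>deg T. jac T \<kappa> i j \<ge> c"
  proof (cases "elems T = {}")
    case True
    then show ?thesis by (intro exI[of _ 1]) auto
  next
    case False
    then have "b / (2 * 2) * mesh_size T ^ 2 > 0" using pos b by simp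
    then show ?thesis using B1 by blast
  qed
  show "\<exists>C. \<forall>\<kappa>\<in>elems T. \<forall>e\<in>edges T \<kappa>. \<forall>k\<le>deg T. edge_jac T e k \<le> C"
    using B2(2) by (intro exI[of _ "1 / (4 * 2 * b) * mesh_size T"]) blast
qed

text \<open>The uniform lower bound on the Jacobians bounds all areas from below, and disjoint
  elements in a ball share its finite area. Sums over balls are therefore finite even on an infinite
  mesh.\<close>

lemma finite_elems_within: "finite (elems_within R)"
proof -
  obtain c where c: "c > 0" "\<forall>\<kappa>\<in>elems T. \<forall>i\<le>deg T. \<forall>j\<le>deg T. jac T \<kappa> i j \<ge> c"
    using jac_lower_bound by blast
  define a where "a = (\<Sum>a\<le>deg T. \<Sum>b\<le>deg T. omega T a * omega T b * c)"
  have a: "a > 0" unfolding a_def using c by (intro sum_pos mult_pos_pos weight_pos) auto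
  have area: "a \<le> measure lebesgue \<kappa>" if "\<kappa> \<in> elems T" for \<kappa>
  proof -
    have "a \<le> (\<Sum>a\<le>deg T. \<Sum>b\<le>deg T. omega T a * omega T b * jac T \<kappa> a b)"
      unfolding a_def using c that by (intro sum_mono mult_left_mono) (auto intro!: mult_nonneg_nonneg less_imp_le[OF weight_pos])
    then show ?thesis using area_lower_bound[OF that] by linarith
  qed
  have "card G \<le> nat \<lfloor>measure lebesgue (cball (0 :: pt) R) / a\<rfloor>" if "G \<subseteq> elems_within R" "finite G" for G
  proof -
    have "real (card G) * a \<le> (\<Sum>\<kappa>\<in>G. measure lebesgue \<kappa>)"
      using that area by (intro sum_bounded_below) (auto simp: elems_within_def)
    also have "\<dots> \<le> measure lebesgue (cball (0 :: pt) R)" by (rule sum_area_bound[OF that(2,1)])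
    finally have "real (card G) \<le> measure lebesgue (cball (0 :: pt) R) / a"
      using a by (simp add: field_simps)
    then show ?thesis by linarith
  qed
  then show ?thesis using finite_if_finite_subsets_card_bdd by blast
qed

lemma diameter_elem: "\<kappa> \<in> elems T \<Longrightarrow> diameter \<kappa> \<le> mesh_size T"
  unfolding mesh_size_def
  by (rule cSUP_upper[OF _ mesh_regular[unfolded mesh_regular_def, THEN conjunct1]])

lemma edge_node_closure:
  assumes "\<kappa> \<in> elems T" "e \<in> edges T \<kappa>" "k \<le> deg T"
  shows "edge_node T e k \<in> closure \<kappa>"
proof -
  obtain s where e: "e = side_edge T \<kappa> s" using assms(2) by (auto simp: edges_def)
  have "ref_square = closure (interior ref_square)"
    unfolding ref_square_def interior_cbox by (rule closure_box[symmetric])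
      (simp add: interval_ne_empty_cart)
  moreover have "elem_map T \<kappa> ` closure (interior ref_square) \<subseteq> closure (elem_map T \<kappa> ` interior ref_square)"
    by (rule image_closure_subset[OF elem_map_continuous]) (auto simp: closure_subset)
  ultimately have "elem_map T \<kappa> ` ref_square \<subseteq> closure \<kappa>"
    using elem_image[OF assms(1)] by simp
  then show ?thesis unfolding e edge_node_eq_map[OF assms(1,3)]
    using side_point_in_square node_bounds edge_dof_le[OF assms(3)] by blast
qed

text \<open>The closures of both elements contain a node of the common edge, and the diameter of the
  second one is at most \<open>mesh_size T\<close>. This fixes the width of the shells.\<close>

lemma neighbour_within:
  assumes "\<kappa> \<in> elems_within R" "e \<in> edges T \<kappa>"
  shows "neighbour T \<kappa> e \<in> elems_within (R + mesh_size T)"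
proof -
  have \<kappa>: "\<kappa> \<in> elems T" "\<kappa> \<subseteq> cball 0 R" using assms by (auto simp: elems_within_def)
  let ?\<kappa>' = "neighbour T \<kappa> e" and ?x = "edge_node T e 0"
  note nb = neighbour[OF \<kappa>(1) assms(2)]
  have x: "?x \<in> closure \<kappa>" "?x \<in> closure ?\<kappa>'"
    using edge_node_closure[OF \<kappa>(1) assms(2)] edge_node_closure[OF nb(1,3)] by auto
  have "closure \<kappa> \<subseteq> cball 0 R" using \<kappa>(2) by (simp add: closure_minimal)
  then have x0: "norm ?x \<le> R" using x(1) by auto
  have "?\<kappa>' \<subseteq> cball 0 (R + mesh_size T)"
  proof
    fix y assume "y \<in> ?\<kappa>'"
    then have "y \<in> closure ?\<kappa>'" using closure_subset by blast
    then have "dist ?x y \<le> diameter (closure ?\<kappa>')"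
      using x(2) elem_bounded[OF nb(1)] by (intro diameter_bounded_bound) auto
    also have "\<dots> \<le> mesh_size T"
      using diameter_elem[OF nb(1)] elem_bounded[OF nb(1)] by (simp add: diameter_closure)
    finally have "norm (y - ?x) \<le> mesh_size T" by (simp add: dist_norm norm_minus_commute)
    then have "norm y \<le> R + mesh_size T"
      using x0 norm_triangle_sub[of y ?x] by linarith
    then show "y \<in> cball 0 (R + mesh_size T)" by simp
  qed
  then show ?thesis using nb by (simp add: elems_within_def)
qed

lemma elem_within_some:
  assumes "\<kappa> \<in> elems T" obtains R where "R \<ge> 0" "\<kappa> \<in> elems_within R"
proof -
  obtain R where "R > 0" "\<forall>x\<in>\<kappa>. norm x \<le> R"
    using elem_bounded[OF assms] unfolding bounded_pos by blast
  then show ?thesis using assms by (intro that[of R]) (auto simp: elems_within_def)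
qed

end

section \<open>Quasimonotone systems\<close>

text \<open>Perron's method: the pointwise supremum of the subsolutions is a solution, because raising a
  single component only lowers the other residuals.\<close>
lemma quasimonotone_system_maximal_solution:
  fixes F :: "('x \<Rightarrow> real) \<Rightarrow> 'x \<Rightarrow> real" and X :: "'x set"
  assumes "m \<le> M"
    and mono: "\<And>V V' x. x \<in> X \<Longrightarrow> (\<And>y. y \<in> X \<Longrightarrow> m \<le> V y \<and> V y \<le> V' y \<and> V' y \<le> M) \<Longrightarrow>
        V x = V' x \<Longrightarrow> F V' x \<le> F V x"
    and cont: "\<And>V x. x \<in> X \<Longrightarrow> (\<And>y. y \<in> X \<Longrightarrow> V y \<in> {m..M}) \<Longrightarrow>
        continuous_on {m..M} (\<lambda>t. F (V(x := t)) x)"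
    and low: "\<And>x. x \<in> X \<Longrightarrow> F (\<lambda>_. m) x \<le> 0"
    and high: "\<And>x. x \<in> X \<Longrightarrow> F (\<lambda>_. M) x \<ge> 0"
  obtains V where "\<And>x. x \<in> X \<Longrightarrow> V x \<in> {m..M}" "\<And>x. x \<in> X \<Longrightarrow> F V x = 0"
    "\<And>W x. (\<And>y. y \<in> X \<Longrightarrow> W y \<in> {m..M}) \<Longrightarrow> (\<And>y. y \<in> X \<Longrightarrow> F W y = 0) \<Longrightarrow> x \<in> X \<Longrightarrow> W x \<le> V x"
proof -
  define S where "S = {W. \<forall>x\<in>X. W x \<in> {m..M} \<and> F W x \<le> 0}"
  define V where "V x = Sup ((\<lambda>W. W x) ` S)" for x
  have mS: "(\<lambda>_. m) \<in> S" using low \<open>m \<le> M\<close> by (simp add: S_def)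
  have bdd: "bdd_above ((\<lambda>W. W x) ` S)" if "x \<in> X" for x
    using that by (intro bdd_aboveI[of _ M]) (auto simp: S_def)
  have le: "W x \<le> V x" if "W \<in> S" "x \<in> X" for W x
    unfolding V_def by (rule cSup_upper[OF _ bdd]) (use that in auto)
  have VM: "V x \<le> M" if "x \<in> X" for x
    unfolding V_def by (rule cSup_least) (use mS that in \<open>auto simp: S_def\<close>)
  have Vm: "m \<le> V x" if "x \<in> X" for x using le[OF mS that] by simp
  \<comment> \<open>A subsolution \<open>W\<close> nearly attaining the supremum at the single place
    \<open>x\<close> suffices: elsewhere \<open>W\<close> lies below \<open>V\<close>, so replacing
    it there by \<open>V\<close> does not raise the residual at \<open>x\<close>. Continuity in the
    component \<open>x\<close> closes the gap.\<close>
  have sub: "F V x \<le> 0" if x: "x \<in> X" for x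
  proof (rule ccontr)
    assume "\<not> F V x \<le> 0"
    moreover have "continuous_on {m..M} (\<lambda>t. F (V(x := t)) x)" by (rule cont[OF x]) (simp add: VM Vm)
    ultimately obtain \<delta> where \<delta>: "\<delta> > 0" "\<And>t. t \<in> {m..M} \<Longrightarrow> dist t (V x) < \<delta> \<Longrightarrow>
        dist (F (V(x := t)) x) (F V x) < F V x"
      unfolding continuous_on_iff using VM[OF x] Vm[OF x]
      by (metis atLeastAtMost_iff fun_upd_triv linorder_not_le)
    obtain W where W: "W \<in> S" "V x - \<delta> < W x"
      using less_cSup_iff[of "(\<lambda>W. W x) ` S" "V x - \<delta>"] bdd[OF x] mS \<delta>(1) unfolding V_def by auto
    have Wx: "W x \<in> {m..M}" using W x by (simp add: S_def)
    have "F (V(x := W x)) x \<le> F W x"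
    proof (rule mono[OF x])
      show "m \<le> W y \<and> W y \<le> (V(x := W x)) y \<and> (V(x := W x)) y \<le> M" if "y \<in> X" for y
        using W(1) that le[OF W(1) that] VM[OF that] Wx by (auto simp: S_def)
    qed simp
    then have "F (V(x := W x)) x \<le> 0" using W x by (auto simp: S_def)
    moreover have "dist (F (V(x := W x)) x) (F V x) < F V x"
      by (rule \<delta>(2)[OF Wx]) (use W(2) le[OF W(1) x] in \<open>simp add: dist_real_def\<close>)
    ultimately show False by (simp add: dist_real_def)
  qed
  have "F V x \<ge> 0" if x: "x \<in> X" for x
  proof (rule ccontr)
    assume neg: "\<not> F V x \<ge> 0"
    \<comment> \<open>At the ceiling there is no room to raise \<open>V\<close>, but there
      comparison with the supersolution \<open>M\<close> already gives a nonnegative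
      residual.\<close>
    have "V x \<noteq> M"
    proof
      assume "V x = M"
      then have "F (\<lambda>_. M) x \<le> F V x" by (intro mono[OF x]) (simp_all add: VM Vm)
      with high[OF x] neg show False by simp
    qed
    then have lt: "V x < M" using VM[OF x] by simp
    have "continuous_on {m..M} (\<lambda>t. F (V(x := t)) x)" by (rule cont[OF x]) (simp add: VM Vm)
    with neg obtain \<delta> where \<delta>: "\<delta> > 0" "\<And>t. t \<in> {m..M} \<Longrightarrow> dist t (V x) < \<delta> \<Longrightarrow>
        dist (F (V(x := t)) x) (F V x) < - F V x"
      unfolding continuous_on_iff using VM[OF x] Vm[OF x]
      by (metis atLeastAtMost_iff fun_upd_triv linorder_not_le neg_0_less_iff_less)
    \<comment> \<open>A small raise at \<open>x\<close> keeps the residual at \<open>x\<close>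
      negative and increases no other one, which produces a subsolution exceeding the
      supremum.\<close>
    define t where "t = min M (V x + \<delta> / 2)"
    have t: "t \<in> {m..M}" "V x < t" "dist t (V x) < \<delta>"
      using \<delta>(1) lt Vm[OF x] \<open>m \<le> M\<close> by (auto simp: t_def dist_real_def min_def)
    have "V(x := t) \<in> S"
      unfolding S_def
    proof (intro CollectI ballI conjI)
      fix y assume y: "y \<in> X"
      show "(V(x := t)) y \<in> {m..M}" using t y VM Vm by simp
      show "F (V(x := t)) y \<le> 0"
      proof (cases "y = x")
        case True
        then show ?thesis using \<delta>(2)[OF t(1,3)] by (simp add: dist_real_def)
      next
        case False
        have "F (V(x := t)) y \<le> F V y"
          by (rule mono[OF y]) (use False t VM Vm in \<open>auto simp: less_imp_le\<close>)
        then show ?thesis using sub[OF y] by simp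
      qed
    qed
    from le[OF this x] t(2) show False by simp
  qed
  then have "F V x = 0" if "x \<in> X" for x using sub that by (simp add: antisym)
  moreover have "W x \<le> V x" if "\<And>y. y \<in> X \<Longrightarrow> W y \<in> {m..M}" "\<And>y. y \<in> X \<Longrightarrow> F W y = 0" "x \<in> X" for W x
    using that by (intro le) (auto simp: S_def)
  ultimately show ?thesis using VM Vm by (intro that[of V]) auto
qed

text \<open>The growth condition reads E n \<le> r E (n + 1) with r = K / (K + 1) < 1. Hence E 0
  \<le> r^n E n, and a quadratic bound cannot keep up with this decay.\<close>

lemma quadratic_bound_imp_zero:
  fixes E :: "nat \<Rightarrow> real"
  assumes "K \<ge> 0" and nonneg: "\<And>n. E n \<ge> 0"
    and growth: "\<And>n. E n \<le> K * (E (Suc n) - E n)"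
    and bound: "\<And>n. E n \<le> C * (R + real n * \<rho>)\<^sup>2"
  shows "E 0 = 0"
proof -
  define r where "r = K / (K + 1)"
  have r: "0 \<le> r" "r < 1" using \<open>K \<ge> 0\<close> by (auto simp: r_def field_simps)
  have step: "E n \<le> r * E (Suc n)" for n
  proof -
    have "E n * (K + 1) \<le> K * E (Suc n)" using growth[of n] by (simp add: algebra_simps)
    then show ?thesis using \<open>K \<ge> 0\<close> by (simp add: r_def field_simps)
  qed
  have E0: "E 0 \<le> r ^ n * E n" for n
  proof (induction n)
    case (Suc n)
    have "r ^ n * E n \<le> r ^ n * (r * E (Suc n))" using step r by (intro mult_left_mono) auto
    with Suc show ?case by (simp add: mult_ac)
  qed simp
  \<comment> \<open>With the square root, r^n (R + n \<rho>)^2 becomes the square of R s^n + \<rho>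
    n s^n, and the standard limits of s^n and n s^n apply.\<close>
  define s where "s = sqrt r"
  have s: "0 \<le> s" "s < 1" "r = s\<^sup>2" using r by (auto simp: s_def)
  have "(\<lambda>n. C * (R * s ^ n + \<rho> * (real n * s ^ n))\<^sup>2) \<longlonglongrightarrow> C * (R * 0 + \<rho> * 0)\<^sup>2"
    using s by (intro tendsto_intros LIMSEQ_power_zero powser_times_n_limit_0) auto
  then have "(\<lambda>n. C * (R * s ^ n + \<rho> * (real n * s ^ n))\<^sup>2) \<longlonglongrightarrow> 0" by simp
  moreover have "E 0 \<le> C * (R * s ^ n + \<rho> * (real n * s ^ n))\<^sup>2" for n
  proof -
    have "E 0 \<le> r ^ n * (C * (R + real n * \<rho>)\<^sup>2)"
      using E0[of n] bound[of n] r by (meson mult_left_mono order.trans zero_le_power)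
    also have "\<dots> = C * (R * s ^ n + \<rho> * (real n * s ^ n))\<^sup>2"
      unfolding s(3) by (simp add: power2_eq_square power_mult_distrib algebra_simps)
    finally show ?thesis .
  qed
  ultimately have "E 0 \<le> 0" by (intro LIMSEQ_le_const) auto
  then show ?thesis using nonneg[of 0] by simp
qed

section \<open>The scheme\<close>

locale dg_scheme = dg_scheme_mesh T + entropy_fluxes f g \<theta> hec m M
  for T :: dg_mesh and f g :: "real \<Rightarrow> pt" and \<theta> :: "real \<Rightarrow> real"
    and hec :: "real \<Rightarrow> real \<Rightarrow> pt \<Rightarrow> real" and m M :: real +
  fixes h :: "real \<Rightarrow> real \<Rightarrow> pt \<Rightarrow> real" and d :: "pt set \<Rightarrow> real"
  assumes face_flux: "interface_flux f m M h"
    and viscosity: "\<And>\<kappa>. \<kappa> \<in> elems T \<Longrightarrow>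
      d \<kappa> \<ge> 4 * flux_lipschitz f m M * entropy_ratio \<theta> m M *
        Max {\<bar>Dm T k l\<bar> / omega T l | k l. k \<le> deg T \<and> l \<le> deg T \<and> k \<noteq> l}"
begin

text \<open>Flux and viscosity of a node pair are kept together because it is their sum that is
  monotone in the second state. Splitting off \<open>omega T i * omega T j\<close> has turned
  \<open>Qm\<close> into \<open>Dm\<close>.\<close>

definition cell_term :: "pt set \<Rightarrow> nat \<Rightarrow> nat \<Rightarrow> real \<Rightarrow> real \<Rightarrow> pt \<Rightarrow> real" where
  "cell_term \<kappa> i k a b n = 2 * Dm T i k * hec a b n + d \<kappa> * (omega T k / 2 * norm n * (a - b))"

definition face_term :: "pt set \<Rightarrow> nat \<Rightarrow> nat \<Rightarrow> pt set \<Rightarrow> nat \<Rightarrow> real \<Rightarrow> real \<Rightarrow> real" where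
  "face_term \<kappa> i j e k a b = basis_fun T \<kappa> i j (edge_node T e k) * omega T k * edge_jac T e k *
     (h a b (normal T \<kappa> e k) - f a \<bullet> normal T \<kappa> e k)"

abbreviation trace :: "dofs \<Rightarrow> pt set \<Rightarrow> pt set \<Rightarrow> nat \<Rightarrow> real" where
  "trace U \<kappa> e k \<equiv> dg_fun T U \<kappa> (edge_node T e k)"

lemma spatial_operator_eq:
  "residual T f hec h U \<kappa> i j + graph_viscosity T d U \<kappa> i j =
     omega T i * omega T j * ((\<Sum>k\<le>deg T. cell_term \<kappa> i k (U \<kappa> i j) (U \<kappa> k j) (metric_xi T \<kappa> i k j)) +
       (\<Sum>k\<le>deg T. cell_term \<kappa> j k (U \<kappa> i j) (U \<kappa> i k) (metric_zeta T \<kappa> i j k))) +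
     (\<Sum>e\<in>edges T \<kappa>. \<Sum>k\<le>deg T. face_term \<kappa> i j e k (U \<kappa> i j) (trace U (neighbour T \<kappa> e) e k))"
  unfolding residual_def graph_viscosity_def cell_term_def face_term_def Qmat_def
  by (simp add: sum.distrib sum_distrib_left distrib_left mult_ac)

text \<open>Per unit length of the normal, the left side bounds the slope of the flux part of
  \<open>cell_term\<close> in the second state, and the right side is the slope of its viscous part.
  The 2 of the flux and the 1/2 of the viscosity make up the factor 4 of the viscosity
  condition.\<close>

lemma viscosity_bound:
  assumes "\<kappa> \<in> elems T" "i \<le> deg T" "k \<le> deg T" "i \<noteq> k"
  shows "2 * \<bar>Dm T i k\<bar> * (Lf * Lu) \<le> d \<kappa> * (omega T k / 2)"
proof -
  let ?S = "{\<bar>Dm T k l\<bar> / omega T l | k l. k \<le> deg T \<and> l \<le> deg T \<and> k \<noteq> l}"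
  have "finite ((\<lambda>(k, l). \<bar>Dm T k l\<bar> / omega T l) ` ({..deg T} \<times> {..deg T}))" by simp
  then have "finite ?S" by (rule finite_subset[rotated]) auto
  then have "\<bar>Dm T i k\<bar> / omega T k \<le> Max ?S" by (rule Max_ge) (use assms in auto)
  then have "4 * Lf * Lu * (\<bar>Dm T i k\<bar> / omega T k) \<le> 4 * Lf * Lu * Max ?S"
    using Lf_nonneg Lu_nonneg by (intro mult_left_mono) auto
  also have "\<dots> \<le> d \<kappa>" by (rule viscosity[OF assms(1)])
  finally show ?thesis using weight_pos[OF assms(3)] by (simp add: field_simps)
qed

lemma cell_term_antimono:
  assumes "\<kappa> \<in> elems T" "i \<le> deg T" "k \<le> deg T" "i \<noteq> k"
    and "a \<in> {m..M}" "b \<in> {m..M}" "b' \<in> {m..M}" "b \<le> b'"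
  shows "cell_term \<kappa> i k a b' n \<le> cell_term \<kappa> i k a b n"
proof -
  have "2 * Dm T i k * (hec a b' n - hec a b n) \<le> \<bar>2 * Dm T i k * (hec a b' n - hec a b n)\<bar>" by simp
  also have "\<dots> = 2 * \<bar>Dm T i k\<bar> * \<bar>hec a b' n - hec a b n\<bar>" by (simp add: abs_mult)
  also have "\<dots> \<le> 2 * \<bar>Dm T i k\<bar> * (Lf * Lu * norm n * \<bar>b' - b\<bar>)"
    by (intro mult_left_mono hec_lipschitz assms) auto
  also have "\<dots> = (2 * \<bar>Dm T i k\<bar> * (Lf * Lu)) * (norm n * (b' - b))" using assms(8) by simp
  also have "\<dots> \<le> (d \<kappa> * (omega T k / 2)) * (norm n * (b' - b))"
    using assms(8) by (intro mult_right_mono viscosity_bound assms) auto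
  finally have "2 * Dm T i k * hec a b' n - 2 * Dm T i k * hec a b n
      \<le> d \<kappa> * (omega T k / 2 * norm n * (b' - b))"
    unfolding right_diff_distrib[of "2 * Dm T i k"] by (simp only: mult.assoc)
  moreover have "d \<kappa> * (omega T k / 2 * norm n * (b' - b))
      = d \<kappa> * (omega T k / 2 * norm n * (a - b)) - d \<kappa> * (omega T k / 2 * norm n * (a - b'))"
    unfolding right_diff_distrib[symmetric] by simp
  ultimately show ?thesis unfolding cell_term_def by linarith
qed

lemma trace_within:
  assumes "dofs_within T m M U" "\<kappa> \<in> elems T" "e \<in> edges T \<kappa>" "k \<le> deg T"
  shows "trace U \<kappa> e k \<in> {m..M}"
proof -
  obtain a b where ab: "a \<le> deg T" "b \<le> deg T" "\<And>U. trace U \<kappa> e k = U \<kappa> a b"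
    using dg_fun_edge_node_dof[OF assms(2-4)] by blast
  then show ?thesis using assms(1,2) by (simp add: dofs_within_def)
qed

lemma trace_mono:
  assumes "\<kappa> \<in> elems T" "e \<in> edges T \<kappa>" "k \<le> deg T"
    and "\<And>i j. i \<le> deg T \<Longrightarrow> j \<le> deg T \<Longrightarrow> U \<kappa> i j \<le> V \<kappa> i j"
  shows "trace U \<kappa> e k \<le> trace V \<kappa> e k"
proof -
  obtain a b where "a \<le> deg T" "b \<le> deg T" "\<And>U. trace U \<kappa> e k = U \<kappa> a b"
    using dg_fun_edge_node_dof[OF assms(1-3)] by blast
  then show ?thesis using assms(4) by simp
qed

lemma basis_fun_edge_node_nonneg:
  assumes "\<kappa> \<in> elems T" "e \<in> edges T \<kappa>" "i \<le> deg T" "j \<le> deg T" "k \<le> deg T"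
  shows "basis_fun T \<kappa> i j (edge_node T e k) \<ge> 0"
proof -
  obtain s where "e = side_edge T \<kappa> s" using assms(2) by (auto simp: edges_def)
  then show ?thesis using assms by (simp add: basis_fun_edge_node)
qed

lemma face_term_antimono:
  assumes "\<kappa> \<in> elems T" "e \<in> edges T \<kappa>" "i \<le> deg T" "j \<le> deg T" "k \<le> deg T"
    and "a \<in> {m..M}" "b \<in> {m..M}" "b' \<in> {m..M}" "b \<le> b'"
  shows "face_term \<kappa> i j e k a b' \<le> face_term \<kappa> i j e k a b"
proof -
  have "h a b' (normal T \<kappa> e k) \<le> h a b (normal T \<kappa> e k)"
    by (rule interface_fluxD(4)[OF face_flux]) (use unit_normal_edge assms in auto)
  then show ?thesis unfolding face_term_def
    using assms basis_fun_edge_node_nonneg[OF assms(1-5)] weight_pos[OF assms(5)] edge_jac_pos[OF assms(1,2,5)]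
    by (intro mult_left_mono) auto
qed

lemma spatial_operator_quasimonotone:
  assumes "\<kappa> \<in> elems T" "i \<le> deg T" "j \<le> deg T"
    and "dofs_within T m M U" "dofs_within T m M V"
    and le: "\<And>\<kappa> i j. \<kappa> \<in> elems T \<Longrightarrow> i \<le> deg T \<Longrightarrow> j \<le> deg T \<Longrightarrow> U \<kappa> i j \<le> V \<kappa> i j"
    and eq: "U \<kappa> i j = V \<kappa> i j"
  shows "residual T f hec h V \<kappa> i j + graph_viscosity T d V \<kappa> i j
    \<le> residual T f hec h U \<kappa> i j + graph_viscosity T d U \<kappa> i j"
proof -
  have U: "U \<kappa> a b \<in> {m..M}" and V: "V \<kappa> a b \<in> {m..M}" if "a \<le> deg T" "b \<le> deg T" for a b
    using assms(1,4,5) that by (auto simp: dofs_within_def)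
  \<comment> \<open>The slope bound requires distinct nodes. For \<open>i = k\<close> both states
    are the DOF at \<open>(i, j)\<close>, which \<open>U\<close> and \<open>V\<close> share.\<close>
  have c1: "cell_term \<kappa> i k (V \<kappa> i j) (V \<kappa> k j) n \<le> cell_term \<kappa> i k (U \<kappa> i j) (U \<kappa> k j) n" if "k \<le> deg T" for k n
    by (cases "i = k") (use eq that assms(1-3) U V le in \<open>auto intro!: cell_term_antimono\<close>)
  have c2: "cell_term \<kappa> j k (V \<kappa> i j) (V \<kappa> i k) n \<le> cell_term \<kappa> j k (U \<kappa> i j) (U \<kappa> i k) n" if "k \<le> deg T" for k n
    by (cases "j = k") (use eq that assms(1-3) U V le in \<open>auto intro!: cell_term_antimono\<close>)
  have f: "face_term \<kappa> i j e k (V \<kappa> i j) (trace V (neighbour T \<kappa> e) e k)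
      \<le> face_term \<kappa> i j e k (U \<kappa> i j) (trace U (neighbour T \<kappa> e) e k)"
    if "e \<in> edges T \<kappa>" "k \<le> deg T" for e k
    unfolding eq
    by (intro face_term_antimono trace_within trace_mono assms that neighbour V)
  have w: "0 \<le> omega T i * omega T j"
    using weight_pos assms(2,3) by (intro mult_nonneg_nonneg less_imp_le) auto
  show ?thesis unfolding spatial_operator_eq
    by (intro add_mono mult_left_mono sum_mono w c1 c2 f) auto
qed

lemma spatial_operator_const:
  assumes "\<kappa> \<in> elems T" "i \<le> deg T" "j \<le> deg T" "c \<in> {m..M}"
  shows "residual T f hec h (\<lambda>_ _ _. c) \<kappa> i j + graph_viscosity T d (\<lambda>_ _ _. c) \<kappa> i j = 0"
proof -
  have tr: "trace (\<lambda>_ _ _. c) (neighbour T \<kappa> e) e k = c" if "e \<in> edges T \<kappa>" "k \<le> deg T" for e k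
    using dg_fun_edge_node_dof[OF neighbour(1,3)[OF assms(1) that(1)] that(2)] by metis
  have "face_term \<kappa> i j e k c (trace (\<lambda>_ _ _. c) (neighbour T \<kappa> e) e k) = 0"
    if "e \<in> edges T \<kappa>" "k \<le> deg T" for e k
    unfolding face_term_def tr[OF that]
    using interface_fluxD(1)[OF face_flux unit_normal_edge(1)[OF assms(1) that] assms(4)] by simp
  then have faces: "(\<Sum>e\<in>edges T \<kappa>. \<Sum>k\<le>deg T. face_term \<kappa> i j e k c (trace (\<lambda>_ _ _. c) (neighbour T \<kappa> e) e k)) = 0"
    by (simp add: sum.neutral)
  have "(\<Sum>k\<le>deg T. cell_term \<kappa> i k c c (metric_xi T \<kappa> i k j)) + (\<Sum>k\<le>deg T. cell_term \<kappa> j k c c (metric_zeta T \<kappa> i j k))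
      = 2 * (f c \<bullet> (\<Sum>k\<le>deg T. Dm T i k *\<^sub>R metric_xi T \<kappa> i k j + Dm T j k *\<^sub>R metric_zeta T \<kappa> i j k))"
    by (simp add: cell_term_def hec_diag inner_sum_right inner_add_right sum.distrib sum_distrib_left mult.assoc)
  also have "\<dots> = 0"
    using metric_identities assms unfolding discrete_metric_identities_def by simp
  finally show ?thesis unfolding spatial_operator_eq faces by simp
qed

lemma hec_continuous: "continuous_on S (\<lambda>t. hec t b n)"
  using hec_isCont[where a = b and n = n] by (subst hec_sym) (auto intro: continuous_at_imp_continuous_on)

lemma flux_continuous: "continuous_on S (\<lambda>t. f t \<bullet> n)"
  by (intro continuous_at_imp_continuous_on ballI DERIV_isCont[OF flux_inner_deriv])

lemma cell_term_continuous: "continuous_on S (\<lambda>t. cell_term \<kappa> i k t b n)"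
  unfolding cell_term_def by (intro continuous_intros hec_continuous)

lemma cell_term_diag_continuous: "continuous_on S (\<lambda>t. cell_term \<kappa> i k t t n)"
  unfolding cell_term_def hec_diag by (intro continuous_intros flux_continuous)

lemma face_term_continuous:
  assumes "\<kappa> \<in> elems T" "e \<in> edges T \<kappa>" "k \<le> deg T" "b \<in> {m..M}"
  shows "continuous_on {m..M} (\<lambda>t. face_term \<kappa> i j e k t b)"
proof -
  obtain L where L: "L \<ge> 0" "\<And>n w a b. norm n = 1 \<Longrightarrow> w \<in> {m..M} \<Longrightarrow> a \<in> {m..M} \<Longrightarrow> b \<in> {m..M} \<Longrightarrow>
        \<bar>h a w n - h b w n\<bar> \<le> L * \<bar>a - b\<bar>"
    using interface_flux_lipschitz[OF face_flux] by metis
  have "L-lipschitz_on {m..M} (\<lambda>t. h t b (normal T \<kappa> e k))"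
    using L unit_normal_edge(1)[OF assms(1-3)] assms(4) by (intro lipschitz_onI) (auto simp: dist_real_def)
  then have "continuous_on {m..M} (\<lambda>t. h t b (normal T \<kappa> e k))" by (rule lipschitz_on_continuous_on)
  then show ?thesis unfolding face_term_def by (intro continuous_intros flux_continuous)
qed

text \<open>The varied DOF fills both states of the pair with \<open>k = i\<close>, where continuity
  in each state separately is not enough; there the flux is f . n by consistency. The outer traces
  do not see the variation because a neighbour is a different element.\<close>

lemma spatial_operator_continuous:
  assumes "\<kappa> \<in> elems T" "i \<le> deg T" "j \<le> deg T" "dofs_within T m M U"
    and V: "\<And>t \<kappa>' a b. V t \<kappa>' a b = (if \<kappa>' = \<kappa> \<and> a = i \<and> b = j then t else U \<kappa>' a b)"
  shows "continuous_on {m..M} (\<lambda>t. residual T f hec h (V t) \<kappa> i j + graph_viscosity T d (V t) \<kappa> i j)"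
proof -
  have tr: "trace (V t) (neighbour T \<kappa> e) e k = trace U (neighbour T \<kappa> e) e k" if "e \<in> edges T \<kappa>" for t e k
    using neighbour(2)[OF assms(1) that] unfolding dg_fun_def V by simp
  have c1: "continuous_on {m..M} (\<lambda>t. cell_term \<kappa> i k (V t \<kappa> i j) (V t \<kappa> k j) n)" for k n
    unfolding V by (cases "k = i") (simp_all add: cell_term_continuous cell_term_diag_continuous)
  have c2: "continuous_on {m..M} (\<lambda>t. cell_term \<kappa> j k (V t \<kappa> i j) (V t \<kappa> i k) n)" for k n
    unfolding V by (cases "k = j") (simp_all add: cell_term_continuous cell_term_diag_continuous)
  have fc: "continuous_on {m..M} (\<lambda>t. face_term \<kappa> i j e k (V t \<kappa> i j) (trace (V t) (neighbour T \<kappa> e) e k))"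
    if "e \<in> edges T \<kappa>" "k \<le> deg T" for e k
  proof -
    have "continuous_on {m..M} (\<lambda>t. face_term \<kappa> i j e k t (trace U (neighbour T \<kappa> e) e k))"
      by (intro face_term_continuous trace_within neighbour assms that)
    then show ?thesis by (simp add: tr[OF that(1)] V)
  qed
  show ?thesis unfolding spatial_operator_eq
    by (intro continuous_intros continuous_on_sum c1 c2 fc) auto
qed

section \<open>Existence of a largest solution\<close>

lemma maximal_solution:
  assumes "dt > 0" "dofs_within T m M U" "m \<le> M"
  obtains V where "backward_euler_step T f hec h d dt U V" "dofs_within T m M V"
    "\<And>W \<kappa> i j. backward_euler_step T f hec h d dt U W \<Longrightarrow> dofs_within T m M W \<Longrightarrow>
      \<kappa> \<in> elems T \<Longrightarrow> i \<le> deg T \<Longrightarrow> j \<le> deg T \<Longrightarrow> W \<kappa> i j \<le> V \<kappa> i j"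
proof -
  define X where "X = elems T \<times> {..deg T} \<times> {..deg T}"
  define dof :: "(pt set \<times> nat \<times> nat \<Rightarrow> real) \<Rightarrow> dofs" where "dof V \<kappa> i j = V (\<kappa>, i, j)" for V \<kappa> i j
  define S where "S V \<kappa> i j = residual T f hec h V \<kappa> i j + graph_viscosity T d V \<kappa> i j" for V \<kappa> i j
  define F where "F V = (\<lambda>(\<kappa>, i, j). omega T i * omega T j * jac T \<kappa> i j * ((V (\<kappa>, i, j) - U \<kappa> i j) / dt)
      + S (dof V) \<kappa> i j)" for V
  have within: "dofs_within T m M (dof V)" if "\<And>y. y \<in> X \<Longrightarrow> m \<le> V y \<and> V y \<le> M" for V
    using that by (auto simp: dofs_within_def X_def dof_def)
  have const: "dof (\<lambda>_. c) = (\<lambda>_ _ _. c)" for c by (simp add: dof_def fun_eq_iff)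
  have coeff: "0 \<le> omega T i * omega T j * jac T \<kappa> i j" if "\<kappa> \<in> elems T" "i \<le> deg T" "j \<le> deg T" for \<kappa> i j
    using that weight_pos jac_pos by (intro mult_nonneg_nonneg less_imp_le) auto
  have step_iff: "backward_euler_step T f hec h d dt U (dof V) \<longleftrightarrow> (\<forall>x\<in>X. F V x = 0)" for V
    by (auto simp: backward_euler_step_def X_def F_def S_def dof_def add.assoc)
  obtain V where V: "\<And>x. x \<in> X \<Longrightarrow> V x \<in> {m..M}" "\<And>x. x \<in> X \<Longrightarrow> F V x = 0"
    "\<And>W x. (\<And>y. y \<in> X \<Longrightarrow> W y \<in> {m..M}) \<Longrightarrow> (\<And>y. y \<in> X \<Longrightarrow> F W y = 0) \<Longrightarrow> x \<in> X \<Longrightarrow> W x \<le> V x"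
  proof (rule quasimonotone_system_maximal_solution[of m M X F])
    fix V V' x assume x: "x \<in> X" and le: "\<And>y. y \<in> X \<Longrightarrow> m \<le> V y \<and> V y \<le> V' y \<and> V' y \<le> M" and eq: "V x = V' x"
    obtain \<kappa> i j where xe: "x = (\<kappa>, i, j)" by (cases x) auto
    have "S (dof V') \<kappa> i j \<le> S (dof V) \<kappa> i j"
      unfolding S_def
    proof (rule spatial_operator_quasimonotone)
      show "dofs_within T m M (dof V)" "dofs_within T m M (dof V')"
        using le by (auto intro!: within intro: order.trans)
      show "dof V \<kappa> i j \<le> dof V' \<kappa> i j" if "\<kappa> \<in> elems T" "i \<le> deg T" "j \<le> deg T" for \<kappa> i j
        using le that by (simp add: dof_def X_def)
    qed (use x xe eq in \<open>auto simp: X_def dof_def\<close>)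
    then show "F V' x \<le> F V x" using eq by (simp add: F_def xe)
  next
    fix V x assume x: "x \<in> X" and V: "\<And>y. y \<in> X \<Longrightarrow> V y \<in> {m..M}"
    obtain \<kappa> i j where xe: "x = (\<kappa>, i, j)" by (cases x) auto
    have "continuous_on {m..M} (\<lambda>t. S (dof (V(x := t))) \<kappa> i j)"
      unfolding S_def
      by (rule spatial_operator_continuous[where U = "dof V"])
         (use x xe V in \<open>auto simp: X_def dof_def intro!: within\<close>)
    then show "continuous_on {m..M} (\<lambda>t. F (V(x := t)) x)"
      unfolding F_def xe prod.case by (auto intro!: continuous_intros simp: \<open>dt > 0\<close>[THEN less_imp_neq, symmetric])
  next
    fix x assume x: "x \<in> X"
    obtain \<kappa> i j where xe: "x = (\<kappa>, i, j)" by (cases x) auto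
    have mem: "\<kappa> \<in> elems T" "i \<le> deg T" "j \<le> deg T" using x by (auto simp: X_def xe)
    have U: "m \<le> U \<kappa> i j" "U \<kappa> i j \<le> M" using assms(2) mem by (auto simp: dofs_within_def)
    \<comment> \<open>As the spatial operator vanishes on constants, the sign of the residual there
      is that of the time difference.\<close>
    have S: "S (dof (\<lambda>_. c)) \<kappa> i j = 0" if "c \<in> {m..M}" for c
      unfolding S_def const using spatial_operator_const[OF mem that] .
    show "F (\<lambda>_. m) x \<le> 0"
      using U S[of m] assms(1,3) coeff[OF mem] by (simp add: F_def xe mult_nonneg_nonpos divide_nonpos_pos)
    show "F (\<lambda>_. M) x \<ge> 0"
      using U S[of M] assms(1,3) coeff[OF mem] by (simp add: F_def xe)
  qed (use assms in auto)
  show ?thesis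
  proof (rule that[of "dof V"])
    show "backward_euler_step T f hec h d dt U (dof V)" using V(2) step_iff by blast
    show "dofs_within T m M (dof V)" using V(1) by (intro within) auto
    fix W \<kappa> i j assume W: "backward_euler_step T f hec h d dt U W" "dofs_within T m M W"
      and mem: "\<kappa> \<in> elems T" "i \<le> deg T" "j \<le> deg T"
    let ?W = "\<lambda>(\<kappa>, i, j). W \<kappa> i j"
    have dW: "dof ?W = W" by (simp add: dof_def fun_eq_iff)
    have "?W (\<kappa>, i, j) \<le> V (\<kappa>, i, j)"
    proof (rule V(3))
      show "?W y \<in> {m..M}" if "y \<in> X" for y using W(2) that by (auto simp: X_def dofs_within_def)
      show "F ?W y = 0" if "y \<in> X" for y using W(1) step_iff[of ?W] that unfolding dW by blast
    qed (use mem in \<open>simp add: X_def\<close>)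
    then show "W \<kappa> i j \<le> dof V \<kappa> i j" by (simp add: dof_def)
  qed
qed

end

section \<open>Conservation and uniqueness\<close>

lemma antisymmetric_sum_eq_0:
  fixes G :: "'a \<Rightarrow> 'a \<Rightarrow> real"
  assumes "\<And>i k. i \<in> S \<Longrightarrow> k \<in> S \<Longrightarrow> G i k = - G k i"
  shows "(\<Sum>i\<in>S. \<Sum>k\<in>S. G i k) = 0"
proof -
  have "(\<Sum>i\<in>S. \<Sum>k\<in>S. G i k) = (\<Sum>i\<in>S. \<Sum>k\<in>S. - G k i)"
    by (intro sum.cong refl) (rule assms)
  also have "\<dots> = - (\<Sum>i\<in>S. \<Sum>k\<in>S. G i k)"
    by (subst sum.swap) (simp add: sum_negf)
  finally show ?thesis by simp
qed

lemma sum_swap_pairs: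
  "(\<Sum>i\<in>A. \<Sum>j\<in>B. \<Sum>e\<in>C. \<Sum>k\<in>D. g i j e k) = (\<Sum>e\<in>C. \<Sum>k\<in>D. \<Sum>i\<in>A. \<Sum>j\<in>B. g i j e k)"
proof -
  have "(\<Sum>i\<in>A. \<Sum>j\<in>B. \<Sum>e\<in>C. \<Sum>k\<in>D. g i j e k) = (\<Sum>i\<in>A. \<Sum>e\<in>C. \<Sum>j\<in>B. \<Sum>k\<in>D. g i j e k)"
    by (rule sum.cong[OF refl], rule sum.swap)
  also have "\<dots> = (\<Sum>e\<in>C. \<Sum>i\<in>A. \<Sum>j\<in>B. \<Sum>k\<in>D. g i j e k)" by (rule sum.swap)
  also have "\<dots> = (\<Sum>e\<in>C. \<Sum>i\<in>A. \<Sum>k\<in>D. \<Sum>j\<in>B. g i j e k)"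
    by (rule sum.cong[OF refl], rule sum.cong[OF refl], rule sum.swap)
  also have "\<dots> = (\<Sum>e\<in>C. \<Sum>k\<in>D. \<Sum>i\<in>A. \<Sum>j\<in>B. g i j e k)"
    by (rule sum.cong[OF refl], rule sum.swap)
  finally show ?thesis .
qed

section \<open>Balances of single elements\<close>

context dg_scheme_mesh
begin

text \<open>For symmetric \<open>H\<close> the factor 2 replaces \<open>Qm\<close> by the sum of it
  and its transpose, which summation by parts reduces to the two endpoint entries.\<close>

lemma symmetric_flux_sum:
  assumes "\<And>i k. i \<le> deg T \<Longrightarrow> k \<le> deg T \<Longrightarrow> H i k = H k i"
  shows "(\<Sum>i\<le>deg T. \<Sum>k\<le>deg T. 2 * (Qm T i k * H i k)) = H (deg T) (deg T) - H 0 0"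
proof -
  have "(\<Sum>i\<le>deg T. \<Sum>k\<le>deg T. Qm T i k * H i k) = (\<Sum>i\<le>deg T. \<Sum>k\<le>deg T. Qm T k i * H k i)"
    by (rule sum.swap)
  also have "\<dots> = (\<Sum>i\<le>deg T. \<Sum>k\<le>deg T. Qm T k i * H i k)"
    by (intro sum.cong refl arg_cong2[where f = times] assms) auto
  finally have "(\<Sum>i\<le>deg T. \<Sum>k\<le>deg T. 2 * (Qm T i k * H i k))
      = (\<Sum>i\<le>deg T. \<Sum>k\<le>deg T. Qm T i k * H i k) + (\<Sum>i\<le>deg T. \<Sum>k\<le>deg T. Qm T k i * H i k)"
    by (simp only: mult_2 sum.distrib)
  also have "\<dots> = (\<Sum>i\<le>deg T. \<Sum>k\<le>deg T. (Qm T i k + Qm T k i) * H i k)"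
    by (simp add: sum.distrib[symmetric] distrib_right)
  also have "\<dots> = (\<Sum>i\<le>deg T. \<Sum>k\<le>deg T. (if k = deg T then if i = deg T then H (deg T) (deg T) else 0 else 0)
      - (if k = 0 then if i = 0 then H 0 0 else 0 else 0))"
    by (intro sum.cong refl) (auto simp: summation_by_parts)
  also have "\<dots> = H (deg T) (deg T) - H 0 0"
    by (simp add: sum_subtractf)
  finally show ?thesis .
qed

lemma metric_xi_sym: "metric_xi T \<kappa> i k j = metric_xi T \<kappa> k i j"
  and metric_zeta_sym: "metric_zeta T \<kappa> i j k = metric_zeta T \<kappa> i k j"
  by (simp_all add: metric_xi_def metric_zeta_def add.commute)

text \<open>The signs make this the outward normal scaled by the edge Jacobian on all four
  sides.\<close>

fun side_metric :: "pt set \<Rightarrow> side \<Rightarrow> nat \<Rightarrow> pt" where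
  "side_metric \<kappa> West l = - metric_xi T \<kappa> 0 0 l"
| "side_metric \<kappa> East l = metric_xi T \<kappa> (deg T) (deg T) l"
| "side_metric \<kappa> South l = - metric_zeta T \<kappa> l 0 0"
| "side_metric \<kappa> North l = metric_zeta T \<kappa> l (deg T) (deg T)"

lemma face_metric:
  assumes "\<kappa> \<in> elems T" "k \<le> deg T"
  shows "edge_jac T (side_edge T \<kappa> s) k *\<^sub>R normal T \<kappa> (side_edge T \<kappa> s) k = side_metric \<kappa> s (edge_dof \<kappa> s k)"
proof -
  note fm = face_metrics[unfolded face_metrics_def Let_def, rule_format,
      OF assms(1) edge_dof_le[OF assms(2), of \<kappa> s] assms(2)]
  note en = edge_node_eq[OF assms, of s]
  show ?thesis
  proof (cases s)
    case West
    then show ?thesis using fm en by (simp add: edge_i_def edge_j_def)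
  next
    case East
    then show ?thesis using fm en by (simp add: edge_i_def edge_j_def)
  next
    case South
    then show ?thesis using fm en by (simp add: edge_i_def edge_j_def)
  next
    case North
    then show ?thesis using fm en by (simp add: edge_i_def edge_j_def)
  qed
qed

text \<open>The metric terms are symmetric in the two nodes of a pair, so what one node gains the
  other loses.\<close>

lemma graph_viscosity_sum: "(\<Sum>i\<le>deg T. \<Sum>j\<le>deg T. graph_viscosity T d U \<kappa> i j) = 0"
proof -
  define G where "G j i k = omega T i * omega T k * (norm (metric_xi T \<kappa> i k j) * (U \<kappa> i j - U \<kappa> k j))" for i j k
  define G' where "G' i j k = omega T j * omega T k * (norm (metric_zeta T \<kappa> i j k) * (U \<kappa> i j - U \<kappa> i k))" for i j k
  have 1: "(\<Sum>i\<le>deg T. \<Sum>k\<le>deg T. G j i k) = 0" for j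
    by (rule antisymmetric_sum_eq_0) (simp add: G_def metric_xi_sym[of \<kappa>] algebra_simps)
  have 2: "(\<Sum>j\<le>deg T. \<Sum>k\<le>deg T. G' i j k) = 0" for i
    by (rule antisymmetric_sum_eq_0) (simp add: G'_def metric_zeta_sym[of \<kappa>] algebra_simps)
  have "graph_viscosity T d U \<kappa> i j = d \<kappa> / 2 * (omega T j * (\<Sum>k\<le>deg T. G j i k))
      + d \<kappa> / 2 * (omega T i * (\<Sum>k\<le>deg T. G' i j k))" for i j
    unfolding graph_viscosity_def G_def G'_def by (simp add: sum_distrib_left sum.distrib mult_ac distrib_left)
  then have "(\<Sum>i\<le>deg T. \<Sum>j\<le>deg T. graph_viscosity T d U \<kappa> i j)
      = (\<Sum>j\<le>deg T. \<Sum>i\<le>deg T. d \<kappa> / 2 * (omega T j * (\<Sum>k\<le>deg T. G j i k)))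
      + (\<Sum>i\<le>deg T. \<Sum>j\<le>deg T. d \<kappa> / 2 * (omega T i * (\<Sum>k\<le>deg T. G' i j k)))"
    by (simp only: sum.distrib) (subst sum.swap, rule refl)
  also have "\<dots> = (\<Sum>j\<le>deg T. d \<kappa> / 2 * (omega T j * (\<Sum>i\<le>deg T. \<Sum>k\<le>deg T. G j i k)))
      + (\<Sum>i\<le>deg T. d \<kappa> / 2 * (omega T i * (\<Sum>j\<le>deg T. \<Sum>k\<le>deg T. G' i j k)))"
    by (simp only: sum_distrib_left)
  finally show ?thesis by (simp add: 1 2)
qed

end

context dg_scheme
begin

definition face_flux_term :: "dofs \<Rightarrow> pt set \<Rightarrow> pt set \<Rightarrow> nat \<Rightarrow> real" where
  "face_flux_term U \<kappa> e k = omega T k * edge_jac T e k *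
     h (trace U \<kappa> e k) (trace U (neighbour T \<kappa> e) e k) (normal T \<kappa> e k)"

text \<open>Summation by parts leaves f . n at the face nodes, with the normals expressed by the
  metric terms. The face metric condition identifies these with the edge normals, so that the terms
  -f . n of the residual cancel them and only interface fluxes survive.\<close>

lemma residual_sum:
  assumes "\<kappa> \<in> elems T"
  shows "(\<Sum>i\<le>deg T. \<Sum>j\<le>deg T. residual T f hec h U \<kappa> i j)
    = (\<Sum>e\<in>edges T \<kappa>. \<Sum>k\<le>deg T. face_flux_term U \<kappa> e k)"
proof -
  let ?p = "deg T" and ?u = "U \<kappa>"
  define fx where "fx = (\<Sum>j\<le>?p. omega T j * (f (?u ?p j) \<bullet> metric_xi T \<kappa> ?p ?p j - f (?u 0 j) \<bullet> metric_xi T \<kappa> 0 0 j))"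
  define fz where "fz = (\<Sum>i\<le>?p. omega T i * (f (?u i ?p) \<bullet> metric_zeta T \<kappa> i ?p ?p - f (?u i 0) \<bullet> metric_zeta T \<kappa> i 0 0))"
  define face where "face i j = (\<Sum>e\<in>edges T \<kappa>. \<Sum>k\<le>?p. face_term \<kappa> i j e k (?u i j) (trace U (neighbour T \<kappa> e) e k))" for i j
  have "(\<Sum>i\<le>?p. \<Sum>k\<le>?p. 2 * (Qm T i k * hec (?u i j) (?u k j) (metric_xi T \<kappa> i k j)))
      = hec (?u ?p j) (?u ?p j) (metric_xi T \<kappa> ?p ?p j) - hec (?u 0 j) (?u 0 j) (metric_xi T \<kappa> 0 0 j)" for j
    by (rule symmetric_flux_sum) (subst metric_xi_sym, rule hec_sym)
  then have x: "(\<Sum>j\<le>?p. omega T j * (\<Sum>i\<le>?p. \<Sum>k\<le>?p. 2 * (Qm T i k * hec (?u i j) (?u k j) (metric_xi T \<kappa> i k j)))) = fx"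
    by (simp add: fx_def hec_diag)
  have "(\<Sum>j\<le>?p. \<Sum>k\<le>?p. 2 * (Qm T j k * hec (?u i j) (?u i k) (metric_zeta T \<kappa> i j k)))
      = hec (?u i ?p) (?u i ?p) (metric_zeta T \<kappa> i ?p ?p) - hec (?u i 0) (?u i 0) (metric_zeta T \<kappa> i 0 0)" for i
    by (rule symmetric_flux_sum) (subst metric_zeta_sym, rule hec_sym)
  then have z: "(\<Sum>i\<le>?p. omega T i * (\<Sum>j\<le>?p. \<Sum>k\<le>?p. 2 * (Qm T j k * hec (?u i j) (?u i k) (metric_zeta T \<kappa> i j k)))) = fz"
    by (simp add: fz_def hec_diag)
  have "residual T f hec h U \<kappa> i j =
      (omega T j * (\<Sum>k\<le>?p. 2 * (Qm T i k * hec (?u i j) (?u k j) (metric_xi T \<kappa> i k j))) +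
       omega T i * (\<Sum>k\<le>?p. 2 * (Qm T j k * hec (?u i j) (?u i k) (metric_zeta T \<kappa> i j k)))) + face i j" for i j
    unfolding residual_def face_def face_term_def sum_distrib_left[symmetric] by (simp add: distrib_left)
  then have "(\<Sum>i\<le>?p. \<Sum>j\<le>?p. residual T f hec h U \<kappa> i j) =
      (\<Sum>j\<le>?p. \<Sum>i\<le>?p. omega T j * (\<Sum>k\<le>?p. 2 * (Qm T i k * hec (?u i j) (?u k j) (metric_xi T \<kappa> i k j)))) +
      (\<Sum>i\<le>?p. \<Sum>j\<le>?p. omega T i * (\<Sum>k\<le>?p. 2 * (Qm T j k * hec (?u i j) (?u i k) (metric_zeta T \<kappa> i j k)))) +
      (\<Sum>i\<le>?p. \<Sum>j\<le>?p. face i j)"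
    by (simp only: sum.distrib) (subst sum.swap, rule refl)
  also have "\<dots> = fx + fz + (\<Sum>i\<le>?p. \<Sum>j\<le>?p. face i j)"
    unfolding x[symmetric] z[symmetric] by (simp only: sum_distrib_left)
  finally have total: "(\<Sum>i\<le>?p. \<Sum>j\<le>?p. residual T f hec h U \<kappa> i j) = fx + fz + (\<Sum>i\<le>?p. \<Sum>j\<le>?p. face i j)" .

  \<comment> \<open>Exactly one basis function of the element is nonzero at an edge node, so the sum
    over its DOFs reduces to the trace.\<close>
  have pick: "(\<Sum>i\<le>?p. \<Sum>j\<le>?p. face_term \<kappa> i j e k (?u i j) w)
      = omega T k * edge_jac T e k * (h (trace U \<kappa> e k) w (normal T \<kappa> e k) - f (trace U \<kappa> e k) \<bullet> normal T \<kappa> e k)"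
    if e: "e = side_edge T \<kappa> s" and k: "k \<le> ?p" for e s k w
  proof -
    let ?i = "edge_i \<kappa> s k" and ?j = "edge_j \<kappa> s k"
    define c where "c = omega T k * edge_jac T e k * (h (?u ?i ?j) w (normal T \<kappa> e k) - f (?u ?i ?j) \<bullet> normal T \<kappa> e k)"
    have "(\<Sum>i\<le>?p. \<Sum>j\<le>?p. face_term \<kappa> i j e k (?u i j) w)
        = (\<Sum>i\<le>?p. \<Sum>j\<le>?p. if j = ?j then if i = ?i then c else 0 else 0)"
      unfolding face_term_def using assms k
      by (intro sum.cong refl) (auto simp: e basis_fun_edge_node c_def)
    also have "\<dots> = c" using edge_ij_le[OF k, of \<kappa> s] by simp
    finally show ?thesis using assms k by (simp add: c_def e dg_fun_edge_node)
  qed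
  have "(\<Sum>i\<le>?p. \<Sum>j\<le>?p. face i j) = (\<Sum>e\<in>edges T \<kappa>. \<Sum>k\<le>?p. \<Sum>i\<le>?p. \<Sum>j\<le>?p.
      face_term \<kappa> i j e k (?u i j) (trace U (neighbour T \<kappa> e) e k))"
    unfolding face_def by (rule sum_swap_pairs)
  also have "\<dots> = (\<Sum>e\<in>edges T \<kappa>. \<Sum>k\<le>?p. face_flux_term U \<kappa> e k
      - omega T k * (f (trace U \<kappa> e k) \<bullet> (edge_jac T e k *\<^sub>R normal T \<kappa> e k)))"
  proof (intro sum.cong refl)
    fix e k assume "e \<in> edges T \<kappa>" and k: "k \<in> {..?p}"
    then obtain s where e: "e = side_edge T \<kappa> s" by (auto simp: edges_def)
    show "(\<Sum>i\<le>?p. \<Sum>j\<le>?p. face_term \<kappa> i j e k (?u i j) (trace U (neighbour T \<kappa> e) e k))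
      = face_flux_term U \<kappa> e k - omega T k * (f (trace U \<kappa> e k) \<bullet> (edge_jac T e k *\<^sub>R normal T \<kappa> e k))"
      using k by (subst pick[OF e]) (simp_all add: face_flux_term_def right_diff_distrib)
  qed
  also have "\<dots> = (\<Sum>e\<in>edges T \<kappa>. \<Sum>k\<le>?p. face_flux_term U \<kappa> e k)
      - (\<Sum>s\<in>UNIV. \<Sum>k\<le>?p. omega T k * (f (trace U \<kappa> (side_edge T \<kappa> s) k) \<bullet>
          (edge_jac T (side_edge T \<kappa> s) k *\<^sub>R normal T \<kappa> (side_edge T \<kappa> s) k)))"
    by (simp only: sum_subtractf sum_edges[OF assms])
  also have "(\<Sum>s\<in>UNIV. \<Sum>k\<le>?p. omega T k * (f (trace U \<kappa> (side_edge T \<kappa> s) k) \<bullet>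
          (edge_jac T (side_edge T \<kappa> s) k *\<^sub>R normal T \<kappa> (side_edge T \<kappa> s) k))) = fx + fz"
  proof -
    have "(\<Sum>k\<le>?p. omega T k * (f (trace U \<kappa> (side_edge T \<kappa> s) k) \<bullet>
          (edge_jac T (side_edge T \<kappa> s) k *\<^sub>R normal T \<kappa> (side_edge T \<kappa> s) k)))
        = (\<Sum>l\<le>?p. omega T l * (f (?u (fst (side_index ?p s l)) (snd (side_index ?p s l))) \<bullet> side_metric \<kappa> s l))"
      (is "?L s = ?R s") for s
    proof -
      \<comment> \<open>The edge may number its nodes backwards; \<open>edge_dof\<close> undoes
        this, and the weights are invariant under it.\<close>
      have "?L s = (\<Sum>k\<le>?p. omega T (edge_dof \<kappa> s k) * (f (?u (edge_i \<kappa> s k) (edge_j \<kappa> s k)) \<bullet> side_metric \<kappa> s (edge_dof \<kappa> s k)))"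
        using assms by (intro sum.cong refl) (simp add: face_metric dg_fun_edge_node weight_edge_dof del: inner_scaleR_right)
      also have "\<dots> = ?R s"
        unfolding edge_i_def edge_j_def by (rule sum.reindex_bij_betw[OF edge_dof_bij])
      finally show ?thesis .
    qed
    then show ?thesis
      by (simp add: UNIV_side fx_def fz_def sum_subtractf right_diff_distrib sum_negf)
  qed
  finally show ?thesis using total by simp
qed

lemma face_flux_term_neighbour:
  assumes "dofs_within T m M U" "\<kappa> \<in> elems T" "e \<in> edges T \<kappa>" "k \<le> deg T"
  shows "face_flux_term U (neighbour T \<kappa> e) e k = - face_flux_term U \<kappa> e k"
proof -
  note nb = neighbour[OF assms(2,3)]
  have "h (trace U \<kappa> e k) (trace U (neighbour T \<kappa> e) e k) (normal T \<kappa> e k)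
      = - h (trace U (neighbour T \<kappa> e) e k) (trace U \<kappa> e k) (- normal T \<kappa> e k)"
    by (intro interface_fluxD(2)[OF face_flux] trace_within assms nb unit_normal_edge)
  then show ?thesis
    using normal_neighbour[OF assms(2-4)] neighbour_neighbour[OF assms(2,3)]
    by (simp add: face_flux_term_def)
qed

lemma card_edges: "\<kappa> \<in> elems T \<Longrightarrow> card (edges T \<kappa>) = 4"
  using sum_edges[of \<kappa> "\<lambda>_. 1 :: nat"] by (simp add: UNIV_side)

lemma step_balance:
  assumes "backward_euler_step T f hec h d dt U V" "\<kappa> \<in> elems T"
  shows "(\<Sum>i\<le>deg T. \<Sum>j\<le>deg T. omega T i * omega T j * jac T \<kappa> i j * ((V \<kappa> i j - U \<kappa> i j) / dt))
    + (\<Sum>e\<in>edges T \<kappa>. \<Sum>k\<le>deg T. face_flux_term V \<kappa> e k) = 0"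
proof -
  have "(\<Sum>i\<le>deg T. \<Sum>j\<le>deg T. omega T i * omega T j * jac T \<kappa> i j * ((V \<kappa> i j - U \<kappa> i j) / dt)
      + residual T f hec h V \<kappa> i j + graph_viscosity T d V \<kappa> i j) = 0"
    using assms by (intro sum.neutral ballI) (auto simp: backward_euler_step_def)
  then show ?thesis by (simp add: sum.distrib residual_sum[OF assms(2)] graph_viscosity_sum)
qed

text \<open>Exchange between two members of \<open>A\<close> cancels, so the total over
  \<open>A\<close> equals what enters from \<open>B - A\<close>, where it is bounded by the masses
  on the far side of the edges. The factor 4 counts the edges through which one element of
  \<open>B - A\<close> can be charged.\<close>

lemma neighbour_exchange_sum:
  fixes E :: "pt set \<Rightarrow> real" and G :: "pt set \<Rightarrow> pt set \<Rightarrow> real"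
  assumes A: "finite A" "A \<subseteq> elems T" and B: "finite B" "A \<subseteq> B" "B \<subseteq> elems T"
    and AB: "\<And>\<kappa> e. \<kappa> \<in> A \<Longrightarrow> e \<in> edges T \<kappa> \<Longrightarrow> neighbour T \<kappa> e \<in> B"
    and E: "\<And>\<kappa>. \<kappa> \<in> elems T \<Longrightarrow> E \<kappa> \<ge> 0" and "K \<ge> 0"
    and balance: "\<And>\<kappa>. \<kappa> \<in> elems T \<Longrightarrow> E \<kappa> = - (\<Sum>e\<in>edges T \<kappa>. G \<kappa> e)"
    and anti: "\<And>\<kappa> e. \<kappa> \<in> elems T \<Longrightarrow> e \<in> edges T \<kappa> \<Longrightarrow> G (neighbour T \<kappa> e) e = - G \<kappa> e"
    and bound: "\<And>\<kappa> e. \<kappa> \<in> elems T \<Longrightarrow> e \<in> edges T \<kappa> \<Longrightarrow> - G \<kappa> e \<le> K * E (neighbour T \<kappa> e)"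
  shows "(\<Sum>\<kappa>\<in>A. E \<kappa>) \<le> 4 * K * ((\<Sum>\<kappa>\<in>B. E \<kappa>) - (\<Sum>\<kappa>\<in>A. E \<kappa>))"
proof -
  define P where "P = Sigma A (edges T)"
  define inner where "inner = {x \<in> P. neighbour T (fst x) (snd x) \<in> A}"
  \<comment> \<open>The same edge seen from its other side: an involution that pairs the inner edges
    and makes the charging of \<open>B - A\<close> injective.\<close>
  define swap where "swap x = (neighbour T (fst x) (snd x), snd x)" for x :: "pt set \<times> pt set"
  let ?G = "\<lambda>x. G (fst x) (snd x)"
  have finP: "finite P" unfolding P_def using A(1) finite_edges by (intro finite_SigmaI)
  have P: "fst x \<in> elems T" "snd x \<in> edges T (fst x)" "fst x \<in> A" if "x \<in> P" for x
    using that A(2) by (auto simp: P_def)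
  have swap_swap: "swap (swap x) = x" if "x \<in> P" for x
    using neighbour_neighbour[OF P(1,2)[OF that]] by (simp add: swap_def)
  have swap_inner: "swap x \<in> inner" if "x \<in> inner" for x
  proof -
    have x: "x \<in> P" "neighbour T (fst x) (snd x) \<in> A" using that by (auto simp: inner_def)
    show ?thesis
      using neighbour[OF P(1,2)[OF x(1)]] neighbour_neighbour[OF P(1,2)[OF x(1)]] P(3)[OF x(1)] x(2)
      by (simp add: inner_def P_def swap_def)
  qed
  have "(\<Sum>x\<in>inner. ?G x) = (\<Sum>x\<in>inner. - ?G x)"
  proof (rule sum.reindex_bij_witness[of inner swap swap])
    fix x assume x: "x \<in> inner"
    then have xP: "x \<in> P" by (simp add: inner_def)
    show "swap (swap x) = x" by (rule swap_swap[OF xP])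
    then show "swap (swap x) = x" .
    show "swap x \<in> inner" by (rule swap_inner[OF x])
    then show "swap x \<in> inner" .
    show "- ?G (swap x) = ?G x" using anti[OF P(1,2)[OF xP]] by (simp add: swap_def)
  qed
  then have inner0: "(\<Sum>x\<in>inner. ?G x) = 0" by (simp add: sum_negf)
  have "(\<Sum>\<kappa>\<in>A. E \<kappa>) = (\<Sum>\<kappa>\<in>A. \<Sum>e\<in>edges T \<kappa>. - G \<kappa> e)"
    using A(2) balance by (intro sum.cong refl) (auto simp: sum_negf)
  also have "\<dots> = (\<Sum>x\<in>P. - ?G x)"
    unfolding P_def using A(1) finite_edges by (subst sum.Sigma) (auto simp: case_prod_beta)
  also have "\<dots> = (\<Sum>x\<in>P - inner. - ?G x) + (\<Sum>x\<in>inner. - ?G x)"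
    by (rule sum.subset_diff[OF _ finP]) (auto simp: inner_def)
  also have "\<dots> = (\<Sum>x\<in>P - inner. - ?G x)" using inner0 by (simp add: sum_negf)
  also have "\<dots> \<le> (\<Sum>x\<in>P - inner. K * E (fst (swap x)))"
    by (intro sum_mono) (use bound P in \<open>auto simp: swap_def\<close>)
  also have "\<dots> = (\<Sum>y\<in>swap ` (P - inner). K * E (fst y))"
    by (subst sum.reindex) (auto simp: comp_def intro!: inj_on_inverseI[of _ swap] swap_swap)
  also have "\<dots> \<le> (\<Sum>y\<in>Sigma (B - A) (edges T). K * E (fst y))"
  proof (rule sum_mono2)
    show "finite (Sigma (B - A) (edges T))" using B(1) finite_edges by (intro finite_SigmaI) auto
    show "swap ` (P - inner) \<subseteq> Sigma (B - A) (edges T)"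
    proof
      fix y assume "y \<in> swap ` (P - inner)"
      then obtain x where x: "x \<in> P" "x \<notin> inner" "y = swap x" by auto
      then have "neighbour T (fst x) (snd x) \<notin> A" by (simp add: inner_def)
      then show "y \<in> Sigma (B - A) (edges T)"
        using AB[OF P(3,2)[OF x(1)]] neighbour(3)[OF P(1,2)[OF x(1)]] by (simp add: x(3) swap_def)
    qed
    show "0 \<le> K * E (fst y)" if "y \<in> Sigma (B - A) (edges T) - swap ` (P - inner)" for y
      using that B(3) E \<open>K \<ge> 0\<close> by (auto intro!: mult_nonneg_nonneg)
  qed
  also have "\<dots> = (\<Sum>\<kappa>\<in>B - A. \<Sum>e\<in>edges T \<kappa>. K * E \<kappa>)"
    using B(1) finite_edges by (subst sum.Sigma) (auto simp: case_prod_beta)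
  also have "\<dots> = (\<Sum>\<kappa>\<in>B - A. 4 * K * E \<kappa>)"
    using B(3) by (intro sum.cong refl) (auto simp: card_edges)
  also have "\<dots> = 4 * K * ((\<Sum>\<kappa>\<in>B. E \<kappa>) - (\<Sum>\<kappa>\<in>A. E \<kappa>))"
    using B(1,2) by (simp add: sum_distrib_left[symmetric] sum_diff)
  finally show ?thesis .
qed

text \<open>The order makes all terms of \<open>E\<close> nonnegative, so \<open>E\<close> controls
  every single DOF difference. It also gives the inner trace the favourable sign in the monotone
  interface flux, so that the inflow through an edge is bounded by \<open>E\<close> of the
  neighbour.\<close>

lemma ordered_solutions_equal:
  assumes dt: "dt > 0"
    and step: "backward_euler_step T f hec h d dt U V" "backward_euler_step T f hec h d dt U W"
    and within: "dofs_within T m M V" "dofs_within T m M W"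
    and le: "\<And>\<kappa> i j. \<kappa> \<in> elems T \<Longrightarrow> i \<le> deg T \<Longrightarrow> j \<le> deg T \<Longrightarrow> W \<kappa> i j \<le> V \<kappa> i j"
  shows "dofs_eq T W V"
proof -
  define c where "c \<kappa> i j = omega T i * omega T j * jac T \<kappa> i j" for \<kappa> i j
  define E where "E \<kappa> = (\<Sum>i\<le>deg T. \<Sum>j\<le>deg T. c \<kappa> i j * ((V \<kappa> i j - W \<kappa> i j) / dt))" for \<kappa>
  define G where "G \<kappa> e = (\<Sum>k\<le>deg T. face_flux_term V \<kappa> e k - face_flux_term W \<kappa> e k)" for \<kappa> e
  have c_pos: "c \<kappa> i j > 0" if "\<kappa> \<in> elems T" "i \<le> deg T" "j \<le> deg T" for \<kappa> i j
    unfolding c_def using that by (intro mult_pos_pos weight_pos jac_pos)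
  have E_term: "0 \<le> c \<kappa> i j * ((V \<kappa> i j - W \<kappa> i j) / dt)" if "\<kappa> \<in> elems T" "i \<le> deg T" "j \<le> deg T" for \<kappa> i j
    using c_pos[OF that] le[OF that] dt by simp
  have E_nonneg: "E \<kappa> \<ge> 0" if "\<kappa> \<in> elems T" for \<kappa>
    unfolding E_def using E_term that by (intro sum_nonneg) auto
  have E_ge: "c \<kappa> a b * ((V \<kappa> a b - W \<kappa> a b) / dt) \<le> E \<kappa>"
    if "\<kappa> \<in> elems T" "a \<le> deg T" "b \<le> deg T" for \<kappa> a b
  proof -
    have "c \<kappa> a b * ((V \<kappa> a b - W \<kappa> a b) / dt) \<le> (\<Sum>j\<le>deg T. c \<kappa> a j * ((V \<kappa> a j - W \<kappa> a j) / dt))"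
      by (rule member_le_sum) (use E_term that in auto)
    also have "\<dots> \<le> E \<kappa>"
      unfolding E_def
      by (rule member_le_sum[of a "{..deg T}" "\<lambda>i. \<Sum>j\<le>deg T. c \<kappa> i j * ((V \<kappa> i j - W \<kappa> i j) / dt)"])
         (use E_term that in \<open>auto intro!: sum_nonneg\<close>)
    finally show ?thesis .
  qed
  have balance: "E \<kappa> = - (\<Sum>e\<in>edges T \<kappa>. G \<kappa> e)" if "\<kappa> \<in> elems T" for \<kappa>
  proof -
    have "E \<kappa> = (\<Sum>i\<le>deg T. \<Sum>j\<le>deg T. c \<kappa> i j * ((V \<kappa> i j - U \<kappa> i j) / dt))
        - (\<Sum>i\<le>deg T. \<Sum>j\<le>deg T. c \<kappa> i j * ((W \<kappa> i j - U \<kappa> i j) / dt))"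
      unfolding E_def sum_subtractf[symmetric] right_diff_distrib[symmetric] diff_divide_distrib[symmetric]
      by simp
    moreover have "(\<Sum>e\<in>edges T \<kappa>. G \<kappa> e) = (\<Sum>e\<in>edges T \<kappa>. \<Sum>k\<le>deg T. face_flux_term V \<kappa> e k)
        - (\<Sum>e\<in>edges T \<kappa>. \<Sum>k\<le>deg T. face_flux_term W \<kappa> e k)"
      by (simp add: G_def sum_subtractf)
    ultimately show ?thesis
      using step_balance[OF step(1) that] step_balance[OF step(2) that] unfolding c_def by linarith
  qed
  have anti: "G (neighbour T \<kappa> e) e = - G \<kappa> e" if "\<kappa> \<in> elems T" "e \<in> edges T \<kappa>" for \<kappa> e
    unfolding G_def sum_negf[symmetric]
    by (intro sum.cong refl) (simp add: face_flux_term_neighbour within that)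
  obtain L where L: "L \<ge> 0" "\<And>n w a b. norm n = 1 \<Longrightarrow> w \<in> {m..M} \<Longrightarrow> a \<in> {m..M} \<Longrightarrow> b \<in> {m..M} \<Longrightarrow>
        \<bar>h w a n - h w b n\<bar> \<le> L * \<bar>a - b\<bar>"
    using interface_flux_lipschitz[OF face_flux] by metis
  obtain J where J: "\<forall>\<kappa>\<in>elems T. \<forall>i\<le>deg T. \<forall>j\<le>deg T. jac T \<kappa> i j \<ge> J" "J > 0"
    using jac_lower_bound by blast
  obtain C where C: "\<forall>\<kappa>\<in>elems T. \<forall>e\<in>edges T \<kappa>. \<forall>k\<le>deg T. edge_jac T e k \<le> C"
    using edge_jac_upper_bound by blast
  define w where "w = Min (omega T ` {..deg T})"
  have w: "w > 0" "\<And>i. i \<le> deg T \<Longrightarrow> w \<le> omega T i" using weight_pos by (auto simp: w_def)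
  \<comment> \<open>A lower bound, uniform over the mesh, for the coefficients in \<open>E\<close>;
    dividing by it recovers the DOF differences.\<close>
  define q where "q = w * w * J / dt"
  have q: "q > 0" using w J dt by (simp add: q_def)
  have D_le: "V \<kappa> a b - W \<kappa> a b \<le> E \<kappa> / q" if "\<kappa> \<in> elems T" "a \<le> deg T" "b \<le> deg T" for \<kappa> a b
  proof -
    have "q * (V \<kappa> a b - W \<kappa> a b) = w * w * J * ((V \<kappa> a b - W \<kappa> a b) / dt)" by (simp add: q_def)
    also have "\<dots> \<le> c \<kappa> a b * ((V \<kappa> a b - W \<kappa> a b) / dt)"
      unfolding c_def using w w(2)[OF that(2)] w(2)[OF that(3)] J that le[OF that] dt
      by (intro mult_right_mono mult_mono mult_nonneg_nonneg less_imp_le[OF weight_pos]) auto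
    also have "\<dots> \<le> E \<kappa>" by (rule E_ge[OF that])
    finally show ?thesis using q by (simp add: field_simps)
  qed
  define K where "K = (\<Sum>k\<le>deg T. omega T k * \<bar>C\<bar> * L / q)"
  have "K \<ge> 0" unfolding K_def using weight_pos L q
    by (intro sum_nonneg divide_nonneg_pos mult_nonneg_nonneg) (auto intro: less_imp_le)
  have bound: "- G \<kappa> e \<le> K * E (neighbour T \<kappa> e)" if \<kappa>: "\<kappa> \<in> elems T" "e \<in> edges T \<kappa>" for \<kappa> e
  proof -
    let ?\<kappa>' = "neighbour T \<kappa> e"
    note nb = neighbour[OF \<kappa>]
    have "- (face_flux_term V \<kappa> e k - face_flux_term W \<kappa> e k) \<le> omega T k * \<bar>C\<bar> * L / q * E ?\<kappa>'"
      if k: "k \<le> deg T" for k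
    proof -
      let ?n = "normal T \<kappa> e k" and ?V = "trace V \<kappa> e k" and ?W = "trace W \<kappa> e k"
        and ?V' = "trace V ?\<kappa>' e k" and ?W' = "trace W ?\<kappa>' e k"
      have n: "norm ?n = 1" by (rule unit_normal_edge[OF \<kappa> k])
      have mem: "?V \<in> {m..M}" "?W \<in> {m..M}" "?V' \<in> {m..M}" "?W' \<in> {m..M}"
        by (intro trace_within within \<kappa> nb k)+
      obtain a b where ab: "a \<le> deg T" "b \<le> deg T" "\<And>U. trace U ?\<kappa>' e k = U ?\<kappa>' a b"
        using dg_fun_edge_node_dof[OF nb(1,3) k] by blast
      have D: "0 \<le> ?V' - ?W'" "?V' - ?W' \<le> E ?\<kappa>' / q"
        using D_le[OF nb(1) ab(1,2)] le[OF nb(1) ab(1,2)] by (simp_all add: ab(3))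
      \<comment> \<open>Raising the inner state from \<open>W\<close> to \<open>V\<close> can only
        increase the outflow, so the difference inside the element drops out of the inflow
        estimate.\<close>
      have "h ?W ?V' ?n \<le> h ?V ?V' ?n"
        by (intro interface_fluxD(3)[OF face_flux n] mem trace_mono \<kappa> k le)
      moreover have "h ?W ?W' ?n - h ?W ?V' ?n \<le> L * (?V' - ?W')"
        using L(2)[OF n mem(2,4,3)] D(1) by (simp add: abs_minus_commute[of ?W'])
      ultimately have "h ?W ?W' ?n - h ?V ?V' ?n \<le> L * (?V' - ?W')" by linarith
      also have "\<dots> \<le> L * (E ?\<kappa>' / q)" using D L(1) by (intro mult_left_mono)
      finally have hd: "h ?W ?W' ?n - h ?V ?V' ?n \<le> L * (E ?\<kappa>' / q)" .
      have J0: "0 < edge_jac T e k" "edge_jac T e k \<le> \<bar>C\<bar>"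
        using edge_jac_pos[OF \<kappa> k] C \<kappa> k by (auto intro: order.trans[OF _ abs_ge_self])
      have "- (face_flux_term V \<kappa> e k - face_flux_term W \<kappa> e k)
          = omega T k * edge_jac T e k * (h ?W ?W' ?n - h ?V ?V' ?n)"
        by (simp add: face_flux_term_def right_diff_distrib)
      also have "\<dots> \<le> omega T k * edge_jac T e k * (L * (E ?\<kappa>' / q))"
        using hd J0 weight_pos[OF k] by (intro mult_left_mono) auto
      also have "\<dots> \<le> omega T k * \<bar>C\<bar> * (L * (E ?\<kappa>' / q))"
        using J0 weight_pos[OF k] L(1) E_nonneg[OF nb(1)] q by (intro mult_right_mono mult_left_mono) auto
      finally show ?thesis by (simp add: mult_ac)
    qed
    then have "(\<Sum>k\<le>deg T. - (face_flux_term V \<kappa> e k - face_flux_term W \<kappa> e k))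
        \<le> (\<Sum>k\<le>deg T. omega T k * \<bar>C\<bar> * L / q * E ?\<kappa>')"
      by (intro sum_mono) auto
    then show ?thesis unfolding G_def K_def sum_negf sum_distrib_right .
  qed
  \<comment> \<open>With all DOFs in [m,M], \<open>E\<close> is at most a multiple of the area of
    the element; this yields the quadratic bound in the radius of the ball.\<close>
  have E_area: "E \<kappa> \<le> (M - m) / dt * measure lebesgue \<kappa>" if "\<kappa> \<in> elems T" for \<kappa>
  proof -
    have "E \<kappa> \<le> (\<Sum>i\<le>deg T. \<Sum>j\<le>deg T. c \<kappa> i j * ((M - m) / dt))"
      unfolding E_def
    proof (intro sum_mono mult_left_mono divide_right_mono)
      fix i j assume "i \<in> {..deg T}" "j \<in> {..deg T}"
      then have ij: "i \<le> deg T" "j \<le> deg T" by auto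
      show "V \<kappa> i j - W \<kappa> i j \<le> M - m"
        using within that ij unfolding dofs_within_def by (meson diff_mono)
      show "0 \<le> c \<kappa> i j" using c_pos[OF that ij] by simp
    qed (use dt in auto)
    also have "\<dots> = (M - m) / dt * (\<Sum>i\<le>deg T. \<Sum>j\<le>deg T. c \<kappa> i j)"
      by (simp add: sum_distrib_left mult.commute)
    also have "\<dots> \<le> (M - m) / dt * measure lebesgue \<kappa>"
    proof (rule mult_left_mono)
      show "(\<Sum>i\<le>deg T. \<Sum>j\<le>deg T. c \<kappa> i j) \<le> measure lebesgue \<kappa>"
        using area_lower_bound[OF that] by (simp add: c_def)
      have "m \<le> V \<kappa> 0 0" "V \<kappa> 0 0 \<le> M" using within(1) that by (auto simp: dofs_within_def)
      then show "0 \<le> (M - m) / dt" using dt by simp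
    qed
    finally show ?thesis .
  qed
  have E_zero: "E \<kappa> = 0" if \<kappa>: "\<kappa> \<in> elems T" for \<kappa>
  proof -
    obtain R where R: "R \<ge> 0" "\<kappa> \<in> elems_within R" using elem_within_some[OF \<kappa>] by blast
    have h_pos: "mesh_size T > 0" using mesh_size_pos \<kappa> by auto
    have Mm: "(M - m) / dt \<ge> 0"
    proof -
      have "m \<le> V \<kappa> 0 0" "V \<kappa> 0 0 \<le> M" using within(1) \<kappa> by (auto simp: dofs_within_def)
      then show ?thesis using dt by simp
    qed
    \<comment> \<open>The radii increase by the mesh size, so the neighbours of the elements in one
      ball lie in the next one.\<close>
    define r where "r n = R + real n * mesh_size T" for n
    define A where "A n = elems_within (r n)" for n
    have A: "finite (A n)" "A n \<subseteq> elems T" for n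
      using finite_elems_within by (auto simp: A_def elems_within_def)
    have A_mono: "A n \<subseteq> A (Suc n)" for n
      using h_pos by (auto simp: A_def elems_within_def r_def subset_cball algebra_simps)
    have A_nb: "neighbour T \<kappa> e \<in> A (Suc n)" if "\<kappa> \<in> A n" "e \<in> edges T \<kappa>" for \<kappa> e n
      using neighbour_within[of \<kappa> "r n" e] that by (simp add: A_def r_def algebra_simps)
    have "(\<Sum>\<kappa>\<in>A 0. E \<kappa>) = 0"
    proof (rule quadratic_bound_imp_zero[where E = "\<lambda>n. \<Sum>\<kappa>\<in>A n. E \<kappa>"])
      show "4 * K \<ge> 0" using \<open>K \<ge> 0\<close> by simp
      show "0 \<le> (\<Sum>\<kappa>\<in>A n. E \<kappa>)" for n using A E_nonneg by (intro sum_nonneg) auto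
      show "(\<Sum>\<kappa>\<in>A n. E \<kappa>) \<le> 4 * K * ((\<Sum>\<kappa>\<in>A (Suc n). E \<kappa>) - (\<Sum>\<kappa>\<in>A n. E \<kappa>))" for n
        by (rule neighbour_exchange_sum[where G = G])
           (use A A_mono A_nb E_nonneg \<open>K \<ge> 0\<close> balance anti bound in auto)
      fix n
      have "(\<Sum>\<kappa>\<in>A n. E \<kappa>) \<le> (\<Sum>\<kappa>\<in>A n. (M - m) / dt * measure lebesgue \<kappa>)"
        using A E_area by (intro sum_mono) auto
      also have "\<dots> = (M - m) / dt * (\<Sum>\<kappa>\<in>A n. measure lebesgue \<kappa>)" by (simp add: sum_distrib_left)
      also have "\<dots> \<le> (M - m) / dt * measure lebesgue (cball (0 :: pt) (r n))"
        using A Mm by (intro mult_left_mono sum_area_bound) (auto simp: A_def)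
      also have "measure lebesgue (cball (0 :: pt) (r n)) = unit_ball_vol 2 * (r n)\<^sup>2"
        using R(1) h_pos content_cball[of "r n" "0 :: pt"] by (simp add: measure_completion r_def)
      finally show "(\<Sum>\<kappa>\<in>A n. E \<kappa>) \<le> (M - m) / dt * unit_ball_vol 2 * (R + real n * mesh_size T)\<^sup>2"
        by (simp add: r_def)
    qed
    moreover have "\<kappa> \<in> A 0" using R by (simp add: A_def r_def)
    ultimately show ?thesis using A[of 0] E_nonneg by (subst (asm) sum_nonneg_eq_0_iff) auto
  qed
  show ?thesis
    unfolding dofs_eq_def
  proof (intro ballI allI impI)
    fix \<kappa> i j assume mem: "\<kappa> \<in> elems T" "i \<le> deg T" "j \<le> deg T"
    show "W \<kappa> i j = V \<kappa> i j"
      using D_le[OF mem] le[OF mem] E_zero[OF mem(1)] by simp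
  qed
qed

text \<open>Every other solution lies below the largest one, so uniqueness for ordered pairs is
  enough.\<close>

theorem unique_solution:
  assumes "dt > 0" "dofs_within T m M U"
  shows "\<exists>V. backward_euler_step T f hec h d dt U V \<and> dofs_within T m M V \<and>
    (\<forall>W. backward_euler_step T f hec h d dt U W \<and> dofs_within T m M W \<longrightarrow> dofs_eq T W V)"
proof (cases "elems T = {}")
  \<comment> \<open>Without elements \<open>U\<close> itself serves as the solution. Otherwise some
    DOF of \<open>U\<close> supplies \<open>m \<le> M\<close>, which Perron's method
    requires.\<close>
  case True
  then show ?thesis using assms(2) by (auto simp: backward_euler_step_def dofs_eq_def)
next
  case False
  then obtain \<kappa> where "\<kappa> \<in> elems T" by auto
  then have "m \<le> U \<kappa> 0 0" "U \<kappa> 0 0 \<le> M" using assms(2) by (auto simp: dofs_within_def)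
  then have "m \<le> M" by simp
  from maximal_solution[OF assms this] obtain V where
    V: "backward_euler_step T f hec h d dt U V" "dofs_within T m M V"
    and max: "\<And>W \<kappa> i j. backward_euler_step T f hec h d dt U W \<Longrightarrow> dofs_within T m M W \<Longrightarrow>
      \<kappa> \<in> elems T \<Longrightarrow> i \<le> deg T \<Longrightarrow> j \<le> deg T \<Longrightarrow> W \<kappa> i j \<le> V \<kappa> i j"
    by blast
  have "dofs_eq T W V" if "backward_euler_step T f hec h d dt U W" "dofs_within T m M W" for W
    by (rule ordered_solutions_equal[OF assms(1) V(1) that(1) V(2) that(2) max[OF that]])
  then show ?thesis using V by blast
qed

end

theorem theorem3p2:
  fixes T :: dg_mesh
    and f g :: "real \<Rightarrow> real ^ 2"
    and \<theta> :: "real \<Rightarrow> real"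
    and hec h :: "real \<Rightarrow> real \<Rightarrow> real ^ 2 \<Rightarrow> real"
    and u0 :: "real ^ 2 \<Rightarrow> real"
    and m M :: real
    and d :: "(real ^ 2) set \<Rightarrow> real"
    and dt :: "nat \<Rightarrow> real"
    and U :: "nat \<Rightarrow> dofs"
  assumes mesh: "admissible_mesh T"
    and flux: "locally_lipschitz f"
    and domain_measurable: "domain T \<in> sets lebesgue"
    and u0_measurable: "u0 \<in> borel_measurable (lebesgue_on (domain T))"
    and m_def: "ereal m = essinf (lebesgue_on (domain T)) (\<lambda>x. ereal (u0 x))"
    and M_def: "ereal M = esssup (lebesgue_on (domain T)) (\<lambda>x. ereal (u0 x))"
    and entropy: "entropy_pair f \<theta> g"
    and convex: "\<And>u. deriv (deriv \<theta>) u > 0"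
    and cell_flux: "entropy_conservative_flux f \<theta> g hec"
    and face_flux: "interface_flux f m M h"
    and viscosity: "\<And>\<kappa>. \<kappa> \<in> elems T \<Longrightarrow>
      d \<kappa> \<ge> 4 * flux_lipschitz f m M * entropy_ratio \<theta> m M *
        Max {\<bar>Dm T k l\<bar> / omega T l | k l. k \<le> deg T \<and> l \<le> deg T \<and> k \<noteq> l}"
  shows "\<forall>n. dt n > 0 \<longrightarrow> dofs_within T m M (U n) \<longrightarrow>
    (\<exists>V. backward_euler_step T f hec h d (dt n) (U n) V \<and> dofs_within T m M V \<and>
      (\<forall>W. backward_euler_step T f hec h d (dt n) (U n) W \<and> dofs_within T m M W
        \<longrightarrow> dofs_eq T W V))"
proof (intro allI impI)
  fix n assume "dt n > 0" "dofs_within T m M (U n)"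
  interpret dg_scheme T f g \<theta> hec m M h d
    by unfold_locales (fact mesh entropy convex cell_flux face_flux viscosity)+
  show "\<exists>V. backward_euler_step T f hec h d (dt n) (U n) V \<and> dofs_within T m M V \<and>
      (\<forall>W. backward_euler_step T f hec h d (dt n) (U n) W \<and> dofs_within T m M W
        \<longrightarrow> dofs_eq T W V)"
    by (rule unique_solution) fact+
qed

end
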